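(* Let $W$ be $W_{A_{n-1}}$, $W_{D_n}$ or $W_{B_n}$, and let $\ddot{\mathfrak H}^{\mathfrak c}_W$ be the rational double affine Hecke-Clifford algebra of $W$. The multiplication of the subalgebras $\mathbb C[\mathfrak h^*]=\mathbb C[x_1,\dots,x_n]$, $\mathcal C_n$, $\mathbb C W$ and $\mathbb C[\mathfrak h]=\mathbb C[y_1,\dots,y_n]$ induces a vector space isomorphism $$\mathbb C[\mathfrak h^*]\otimes \mathcal C_n\otimes \mathbb C W\otimes \mathbb C[\mathfrak h]\ \stackrel{\simeq}{\longrightarrow}\ \ddot{\mathfrak H}^{\mathfrak c}_W .$$ Equivalently, the elements $x^{\alpha}c^{\epsilon}w\,y^{\gamma}$ with $\alpha,\gamma\in\mathbb Z_+^n$, $\epsilon\in\mathbb Z_2^n$, $w\in W$ form a linear basis of $\ddot{\mathfrak H}^{\mathfrak c}_W$.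
   Context: Ground field $\mathbb C$; $\mathbb Z_+$ denotes the nonnegative integers. Weyl groups. $W_{A_{n-1}}=S_n$ acts on $\mathbb C^n$ by permuting the standard basis $e_1,\dots,e_n$; $W_{B_n}$ ($n\ge 2$) is the group of all signed permutations of $e_1,\dots,e_n$; $W_{D_n}$ ($n\ge 4$) is its subgroup of signed permutations with an even number of sign changes. For $i\ne j$: $s_{ij}=s_{ji}$ swaps $e_i,e_j$ and fixes the other $e_k$; $\overline{s}_{ij}=\overline{s}_{ji}$ sends $e_i\mapsto -e_j$, $e_j\mapsto -e_i$ and fixes the other $e_k$; $\tau_i$ sends $e_i\mapsto -e_i$ and fixes the other $e_k$. Clifford algebra. $\mathcal C_n$ is generated by $c_1,\dots,c_n$ with $c_i^2=1$, $c_ic_j=-c_jc_i$ ($i\ne j$); $W$ acts on it by algebra automorphisms, acting on the span of the $c_i$ as on the $e_i$. Let $\mathfrak h^*=\mathbb Cx_1+\dots+\mathbb Cx_n$ and $\mathfrak h=\mathbb Cy_1+\dots+\mathbb Cy_n$, where $W$ acts on the $x_i$ and on the $y_i$ by the same signed permutations as on the $e_i$. The algebra $\ddot{\mathfrak H}^{\mathfrak c}_W$. Let $u\in\mathbb C$ (and $v\in\mathbb C$ in type $B_n$). $\ddot{\mathfrak H}^{\mathfrak c}_W$ is the associative unital algebra generated by $x_i,y_i,c_i$ ($1\le i\le n$) and $W$, subject to the relations of $W$, of $\mathcal C_n$, and $x_ix_j=x_jx_i$, $y_iy_j=y_jy_i$, $y_ic_j=c_jy_i$ (all $i,j$); $x_ic_i=-c_ix_i$,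 $x_ic_j=c_jx_i$ ($i\neq j$); $wxw^{-1}=w(x)$, $wyw^{-1}=w(y)$, $wcw^{-1}=w(c)$ for $w\in W$, $x\in\mathfrak h^*$, $y\in\mathfrak h$, $c\in\mathcal C_n$; together with (where $[a,b]=ab-ba$): Type $A_{n-1}$: $[y_j,x_i]=u(1+c_jc_i)s_{ji}$ ($i\ne j$), $[y_i,x_i]=-u\sum_{k\neq i}(1+c_kc_i)s_{ki}$. Type $D_n$: $[y_j,x_i]=u\big((1+c_jc_i)s_{ij}-(1-c_jc_i)\overline{s}_{ij}\big)$ ($i\ne j$), $[y_i,x_i]=-u\sum_{k\ne i}\big((1+c_kc_i)s_{ki}+(1-c_kc_i)\overline{s}_{ki}\big)$. Type $B_n$: $[y_j,x_i]=u\big((1+c_jc_i)s_{ij}-(1-c_jc_i)\overline{s}_{ij}\big)$ ($i\ne j$), $[y_i,x_i]=-u\sum_{k\ne i}\big((1+c_kc_i)s_{ki}+(1-c_kc_i)\overline{s}_{ki}\big)-\sqrt2\,v\,\tau_i$. Notation: $x^\alpha=x_1^{\alpha_1}\cdots x_n^{\alpha_n}$, $y^\gamma=y_1^{\gamma_1}\cdots y_n^{\gamma_n}$, $c^\epsilon=c_1^{\epsilon_1}\cdots c_n^{\epsilon_n}$ with $\epsilon_i\in\{0,1\}$. *)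

theory Defs
  imports
    Complex_Main
    "HOL-Algebra.Algebra"
    "HOL-Algebra.Algebraic_Closure_Type"
    "HOL-Combinatorics.Permutations"
    "HOL-Library.Poly_Mapping"
begin

section \<open>Vector spaces and algebras over the complex numbers\<close>

text \<open>
  Complex vector spaces and (not necessarily commutative) complex algebras are carried by the
  records of type \<^typ>\<open>(complex, 'a) module\<close>. For a mere vector space the fields
  \<^const>\<open>monoid.mult\<close> and \<^const>\<open>one\<close> are irrelevant.
\<close>

definition free_space :: "'k set \<Rightarrow> (complex, 'k \<Rightarrow>\<^sub>0 complex) module" where
  "free_space K = \<lparr>carrier = {p. Poly_Mapping.keys p \<subseteq> K},
     monoid.mult = undefined, one = undefined, ring.zero = 0, ring.add = (+),
     module.smult = (\<lambda>a. Poly_Mapping.map ((*) a))\<rparr>"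

definition monoid_algebra ::
    "('m, 'b) monoid_scheme \<Rightarrow> (complex, 'm \<Rightarrow>\<^sub>0 complex) module" where
  "monoid_algebra M = (free_space (carrier M))
     \<lparr>monoid.mult := (\<lambda>p q. \<Sum>a\<in>Poly_Mapping.keys p. \<Sum>b\<in>Poly_Mapping.keys q.
         Poly_Mapping.single (a \<otimes>\<^bsub>M\<^esub> b) (Poly_Mapping.lookup p a * Poly_Mapping.lookup q b)),
      one := Poly_Mapping.single \<one>\<^bsub>M\<^esub> 1\<rparr>"

definition quotient :: "(complex, 'a) module \<Rightarrow> 'a set \<Rightarrow> (complex, 'a set) module" where
  "quotient V N = ring.extend (V Quot N)
     (module.fields (\<lambda>a B. \<Union>x\<in>B. N +>\<^bsub>V\<^esub> (a \<odot>\<^bsub>V\<^esub> x)))"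

definition linear_combination ::
    "(complex, 'a) module \<Rightarrow> ('k \<Rightarrow> 'a) \<Rightarrow> ('k \<Rightarrow>\<^sub>0 complex) \<Rightarrow> 'a" where
  "linear_combination V b p =
     (\<Oplus>\<^bsub>V\<^esub>k\<in>Poly_Mapping.keys p. Poly_Mapping.lookup p k \<odot>\<^bsub>V\<^esub> b k)"

definition linear_basis :: "(complex, 'a) module \<Rightarrow> 'k set \<Rightarrow> ('k \<Rightarrow> 'a) \<Rightarrow> bool" where
  "linear_basis V K b \<longleftrightarrow> b \<in> K \<rightarrow> carrier V \<and>
     (\<forall>p. Poly_Mapping.keys p \<subseteq> K \<and> linear_combination V b p = \<zero>\<^bsub>V\<^esub> \<longrightarrow> p = 0) \<and>
     (\<forall>v\<in>carrier V. \<exists>p. Poly_Mapping.keys p \<subseteq> K \<and> v = linear_combination V b p)"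

definition linear_iso ::
    "(complex, 'a) module \<Rightarrow> (complex, 'b) module \<Rightarrow> ('a \<Rightarrow> 'b) set" where
  "linear_iso V W = {\<phi> \<in> iso (add_monoid V) (add_monoid W).
     \<forall>a. \<forall>v\<in>carrier V. \<phi> (a \<odot>\<^bsub>V\<^esub> v) = a \<odot>\<^bsub>W\<^esub> \<phi> v}"

definition linear_span :: "(complex, 'a) module \<Rightarrow> 'a set \<Rightarrow> 'a set" where
  "linear_span V S = \<Inter>{N. submodule N ring_of_type_algebra V \<and> S \<subseteq> N}"


subsection \<open>Tensor products of vector spaces\<close>

definition tensor_relations ::
    "(complex, 'a) module \<Rightarrow> (complex, 'b) module \<Rightarrow> ('a \<times> 'b \<Rightarrow>\<^sub>0 complex) set" where
  "tensor_relations V W = (let e = (\<lambda>v w. Poly_Mapping.single (v, w) 1) in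
     {e (v \<oplus>\<^bsub>V\<^esub> v') w - (e v w + e v' w) | v v' w.
        v \<in> carrier V \<and> v' \<in> carrier V \<and> w \<in> carrier W} \<union>
     {e v (w \<oplus>\<^bsub>W\<^esub> w') - (e v w + e v w') | v w w'.
        v \<in> carrier V \<and> w \<in> carrier W \<and> w' \<in> carrier W} \<union>
     {e (a \<odot>\<^bsub>V\<^esub> v) w - Poly_Mapping.map ((*) a) (e v w) | a v w.
        v \<in> carrier V \<and> w \<in> carrier W} \<union>
     {e v (a \<odot>\<^bsub>W\<^esub> w) - Poly_Mapping.map ((*) a) (e v w) | a v w.
        v \<in> carrier V \<and> w \<in> carrier W})"

definition tensor_kernel ::
    "(complex, 'a) module \<Rightarrow> (complex, 'b) module \<Rightarrow> ('a \<times> 'b \<Rightarrow>\<^sub>0 complex) set" where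
  "tensor_kernel V W =
     linear_span (free_space (carrier V \<times> carrier W)) (tensor_relations V W)"

definition tensor_product ::
    "(complex, 'a) module \<Rightarrow> (complex, 'b) module \<Rightarrow>
      (complex, ('a \<times> 'b \<Rightarrow>\<^sub>0 complex) set) module" where
  "tensor_product V W = quotient (free_space (carrier V \<times> carrier W)) (tensor_kernel V W)"

definition pure_tensor ::
    "(complex, 'a) module \<Rightarrow> (complex, 'b) module \<Rightarrow> 'a \<Rightarrow> 'b \<Rightarrow>
      ('a \<times> 'b \<Rightarrow>\<^sub>0 complex) set" where
  "pure_tensor V W v w =
     tensor_kernel V W +>\<^bsub>free_space (carrier V \<times> carrier W)\<^esub> Poly_Mapping.single (v, w) 1"


subsection \<open>Algebras given by generators and relations\<close>

definition free_algebra :: "'g set \<Rightarrow> (complex, 'g list \<Rightarrow>\<^sub>0 complex) module" where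
  "free_algebra S = monoid_algebra \<lparr>carrier = lists S, monoid.mult = (@), one = []\<rparr>"

definition letter :: "'g \<Rightarrow> ('g list \<Rightarrow>\<^sub>0 complex)" where
  "letter s = Poly_Mapping.single [s] 1"

text \<open>A relation is a pair, to be read as the equation between its two components.\<close>

definition relation_ideal ::
    "'g set \<Rightarrow> (('g list \<Rightarrow>\<^sub>0 complex) \<times> ('g list \<Rightarrow>\<^sub>0 complex)) set \<Rightarrow>
      ('g list \<Rightarrow>\<^sub>0 complex) set" where
  "relation_ideal S R =
     Idl\<^bsub>free_algebra S\<^esub> {l \<ominus>\<^bsub>free_algebra S\<^esub> r | l r. (l, r) \<in> R}"

definition presented_algebra ::
    "'g set \<Rightarrow> (('g list \<Rightarrow>\<^sub>0 complex) \<times> ('g list \<Rightarrow>\<^sub>0 complex)) set \<Rightarrow>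
      (complex, ('g list \<Rightarrow>\<^sub>0 complex) set) module" where
  "presented_algebra S R = quotient (free_algebra S) (relation_ideal S R)"


section \<open>Weyl groups of types A, B and D\<close>

datatype weyl_type = TypeA | TypeB | TypeD

text \<open>
  \<open>TypeA\<close> at \<open>n\<close> stands for \<open>A\<^bsub>n-1\<^esub>\<close>, so that in all three types the group acts on \<open>n\<close>
  coordinates.
\<close>

definition valid_rank :: "weyl_type \<Rightarrow> nat \<Rightarrow> bool" where
  "valid_rank T n = (case T of TypeA \<Rightarrow> n \<ge> 1 | TypeB \<Rightarrow> n \<ge> 2 | TypeD \<Rightarrow> n \<ge> 4)"

text \<open>
  A signed permutation of \<open>e\<^sub>1, \<dots>, e\<^sub>n\<close> is encoded by the odd permutation \<open>w\<close> of
  \<open>{-n..n}\<close> such that it sends \<open>e\<^sub>i\<close> to \<open>e\<^sub>j\<close> if \<open>w i = j > 0\<close>, and to \<open>- e\<^sub>j\<close> if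
  \<open>w i = - j < 0\<close>. Products in the group are compositions of functions.
\<close>

definition signed_permutations :: "nat \<Rightarrow> (int \<Rightarrow> int) set" where
  "signed_permutations n = {w. w permutes {- int n..int n} \<and> (\<forall>i. w (- i) = - w i)}"

definition weyl_group :: "weyl_type \<Rightarrow> nat \<Rightarrow> (int \<Rightarrow> int) monoid" where
  "weyl_group T n = \<lparr>carrier = {w \<in> signed_permutations n. case T of
       TypeA \<Rightarrow> \<forall>i\<in>{1..int n}. w i > 0
     | TypeB \<Rightarrow> True
     | TypeD \<Rightarrow> even (card {i \<in> {1..int n}. w i < 0})},
     monoid.mult = (\<circ>), one = id\<rparr>"

definition s_refl :: "nat \<Rightarrow> nat \<Rightarrow> (int \<Rightarrow> int)" where
  "s_refl i j = transpose (int i) (int j) \<circ> transpose (- int i) (- int j)"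

definition sbar_refl :: "nat \<Rightarrow> nat \<Rightarrow> (int \<Rightarrow> int)" where
  "sbar_refl i j = transpose (int i) (- int j) \<circ> transpose (- int i) (int j)"

definition tau_refl :: "nat \<Rightarrow> (int \<Rightarrow> int)" where
  "tau_refl i = transpose (int i) (- int i)"


section \<open>The defining relations\<close>

context
  fixes A :: "(complex, 'a) module" (structure)
begin

definition commutator :: "'a \<Rightarrow> 'a \<Rightarrow> 'a" where
  "commutator a b = a \<otimes> b \<ominus> b \<otimes> a"

text \<open>\<open>\<plusminus> z\<^sub>j\<close> for \<open>k = \<plusminus> j\<close>, so that \<open>w\<close> maps \<open>z\<^sub>i\<close> to \<open>signed z (w i)\<close>.\<close>

definition signed :: "(nat \<Rightarrow> 'a) \<Rightarrow> int \<Rightarrow> 'a" where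
  "signed z k = (if k < 0 then \<ominus> z (nat (- k)) else z (nat k))"

definition clifford_relations :: "nat \<Rightarrow> (nat \<Rightarrow> 'a) \<Rightarrow> ('a \<times> 'a) set" where
  "clifford_relations n c =
     {(c i \<otimes> c i, \<one>) | i. i \<in> {1..n}} \<union>
     {(c i \<otimes> c j, \<ominus> (c j \<otimes> c i)) | i j. i \<in> {1..n} \<and> j \<in> {1..n} \<and> i \<noteq> j}"

definition group_relations :: "weyl_type \<Rightarrow> nat \<Rightarrow> ((int \<Rightarrow> int) \<Rightarrow> 'a) \<Rightarrow> ('a \<times> 'a) set" where
  "group_relations T n g =
     {(g id, \<one>)} \<union>
     {(g w \<otimes> g w', g (w \<circ> w')) | w w'.
        w \<in> carrier (weyl_group T n) \<and> w' \<in> carrier (weyl_group T n)}"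

definition commutation_relations ::
    "nat \<Rightarrow> (nat \<Rightarrow> 'a) \<Rightarrow> (nat \<Rightarrow> 'a) \<Rightarrow> (nat \<Rightarrow> 'a) \<Rightarrow> ('a \<times> 'a) set" where
  "commutation_relations n x y c =
     {(x i \<otimes> x j, x j \<otimes> x i) | i j. i \<in> {1..n} \<and> j \<in> {1..n}} \<union>
     {(y i \<otimes> y j, y j \<otimes> y i) | i j. i \<in> {1..n} \<and> j \<in> {1..n}} \<union>
     {(y i \<otimes> c j, c j \<otimes> y i) | i j. i \<in> {1..n} \<and> j \<in> {1..n}} \<union>
     {(x i \<otimes> c i, \<ominus> (c i \<otimes> x i)) | i. i \<in> {1..n}} \<union>
     {(x i \<otimes> c j, c j \<otimes> x i) | i j. i \<in> {1..n} \<and> j \<in> {1..n} \<and> i \<noteq> j}"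

definition conjugation_relations ::
    "weyl_type \<Rightarrow> nat \<Rightarrow> ((int \<Rightarrow> int) \<Rightarrow> 'a) \<Rightarrow> (nat \<Rightarrow> 'a) \<Rightarrow> ('a \<times> 'a) set" where
  "conjugation_relations T n g z =
     {(g w \<otimes> z i \<otimes> g (inv\<^bsub>weyl_group T n\<^esub> w), signed z (w (int i))) | w i.
        w \<in> carrier (weyl_group T n) \<and> i \<in> {1..n}}"

definition bracket_relations ::
    "weyl_type \<Rightarrow> nat \<Rightarrow> complex \<Rightarrow> complex \<Rightarrow> (nat \<Rightarrow> 'a) \<Rightarrow> (nat \<Rightarrow> 'a) \<Rightarrow> (nat \<Rightarrow> 'a) \<Rightarrow>
      ((int \<Rightarrow> int) \<Rightarrow> 'a) \<Rightarrow> ('a \<times> 'a) set" where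
  "bracket_relations T n u v x y c g =
    (let
      s = (\<lambda>i j. g (s_refl i j));
      sbar = (\<lambda>i j. g (sbar_refl i j));
      tau = (\<lambda>i. g (tau_refl i));
      offdiagonal = (\<lambda>i j. case T of
          TypeA \<Rightarrow> u \<odot> ((\<one> \<oplus> c j \<otimes> c i) \<otimes> s j i)
        | _ \<Rightarrow> u \<odot> ((\<one> \<oplus> c j \<otimes> c i) \<otimes> s i j \<ominus> (\<one> \<ominus> c j \<otimes> c i) \<otimes> sbar i j));
      diagonal = (\<lambda>i. case T of
          TypeA \<Rightarrow> \<ominus> (u \<odot> (\<Oplus>k\<in>{1..n} - {i}. (\<one> \<oplus> c k \<otimes> c i) \<otimes> s k i))
        | TypeD \<Rightarrow> \<ominus> (u \<odot> (\<Oplus>k\<in>{1..n} - {i}.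
              (\<one> \<oplus> c k \<otimes> c i) \<otimes> s k i \<oplus> (\<one> \<ominus> c k \<otimes> c i) \<otimes> sbar k i))
        | TypeB \<Rightarrow> \<ominus> (u \<odot> (\<Oplus>k\<in>{1..n} - {i}.
              (\<one> \<oplus> c k \<otimes> c i) \<otimes> s k i \<oplus> (\<one> \<ominus> c k \<otimes> c i) \<otimes> sbar k i))
            \<ominus> (complex_of_real (sqrt 2) * v) \<odot> tau i)
     in
      {(commutator (y j) (x i), offdiagonal i j) | i j. i \<in> {1..n} \<and> j \<in> {1..n} \<and> i \<noteq> j} \<union>
      {(commutator (y i) (x i), diagonal i) | i. i \<in> {1..n}})"

definition hecke_clifford_relations ::
    "weyl_type \<Rightarrow> nat \<Rightarrow> complex \<Rightarrow> complex \<Rightarrow> (nat \<Rightarrow> 'a) \<Rightarrow> (nat \<Rightarrow> 'a) \<Rightarrow> (nat \<Rightarrow> 'a) \<Rightarrow>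
      ((int \<Rightarrow> int) \<Rightarrow> 'a) \<Rightarrow> ('a \<times> 'a) set" where
  "hecke_clifford_relations T n u v x y c g =
     group_relations T n g \<union> clifford_relations n c \<union> commutation_relations n x y c \<union>
     conjugation_relations T n g x \<union> conjugation_relations T n g y \<union>
     conjugation_relations T n g c \<union> bracket_relations T n u v x y c g"

text \<open>\<open>z\<^sub>1\<^bsup>\<alpha> 1\<^esup> \<cdots> z\<^sub>n\<^bsup>\<alpha> n\<^esup>\<close>, with the factors in this order.\<close>

definition ordered_monomial :: "nat \<Rightarrow> (nat \<Rightarrow> 'a) \<Rightarrow> (nat \<Rightarrow> nat) \<Rightarrow> 'a" where
  "ordered_monomial n z \<alpha> = foldr (\<lambda>i a. z i [^] \<alpha> i \<otimes> a) [1..<Suc n] \<one>"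

end


section \<open>The rational double affine Hecke-Clifford algebra\<close>

datatype generator = GenX nat | GenY nat | GenC nat | GenW "int \<Rightarrow> int"

definition hc_generators :: "weyl_type \<Rightarrow> nat \<Rightarrow> generator set" where
  "hc_generators T n =
     GenX ` {1..n} \<union> GenY ` {1..n} \<union> GenC ` {1..n} \<union> GenW ` carrier (weyl_group T n)"

definition hc_relations ::
    "weyl_type \<Rightarrow> nat \<Rightarrow> complex \<Rightarrow> complex \<Rightarrow>
      ((generator list \<Rightarrow>\<^sub>0 complex) \<times> (generator list \<Rightarrow>\<^sub>0 complex)) set" where
  "hc_relations T n u v = hecke_clifford_relations (free_algebra (hc_generators T n)) T n u v
     (\<lambda>i. letter (GenX i)) (\<lambda>i. letter (GenY i)) (\<lambda>i. letter (GenC i)) (\<lambda>w. letter (GenW w))"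

text \<open>The parameter \<open>v\<close> enters the relations of type B only.\<close>

definition hecke_clifford ::
    "weyl_type \<Rightarrow> nat \<Rightarrow> complex \<Rightarrow> complex \<Rightarrow>
      (complex, (generator list \<Rightarrow>\<^sub>0 complex) set) module" where
  "hecke_clifford T n u v = presented_algebra (hc_generators T n) (hc_relations T n u v)"

definition hc_class ::
    "weyl_type \<Rightarrow> nat \<Rightarrow> complex \<Rightarrow> complex \<Rightarrow> (generator list \<Rightarrow>\<^sub>0 complex) \<Rightarrow>
      (generator list \<Rightarrow>\<^sub>0 complex) set" where
  "hc_class T n u v p =
     relation_ideal (hc_generators T n) (hc_relations T n u v)
       +>\<^bsub>free_algebra (hc_generators T n)\<^esub> p"

definition hc_x where "hc_x T n u v i = hc_class T n u v (letter (GenX i))"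
definition hc_y where "hc_y T n u v i = hc_class T n u v (letter (GenY i))"
definition hc_c where "hc_c T n u v i = hc_class T n u v (letter (GenC i))"
definition hc_w where "hc_w T n u v w = hc_class T n u v (letter (GenW w))"

definition x_monomial where
  "x_monomial T n u v = ordered_monomial (hecke_clifford T n u v) n (hc_x T n u v)"
definition y_monomial where
  "y_monomial T n u v = ordered_monomial (hecke_clifford T n u v) n (hc_y T n u v)"
definition c_monomial where
  "c_monomial T n u v = ordered_monomial (hecke_clifford T n u v) n (hc_c T n u v)"


subsection \<open>The subalgebras\<close>

text \<open>
  The polynomial algebra in \<open>n\<close> variables is the monoid algebra of \<open>\<int>\<^sub>+\<^sup>n\<close>, whose elements
  are the functions in \<open>{1..n} \<rightarrow>\<^sub>E UNIV\<close>.
\<close>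

definition polynomial_algebra :: "nat \<Rightarrow> (complex, (nat \<Rightarrow> nat) \<Rightarrow>\<^sub>0 complex) module" where
  "polynomial_algebra n =
     monoid_algebra (product_group {1..n} (\<lambda>_. \<lparr>carrier = UNIV, monoid.mult = (+), one = 0\<rparr>))"

definition clifford_algebra ::
    "nat \<Rightarrow> (complex, (generator list \<Rightarrow>\<^sub>0 complex) set) module" where
  "clifford_algebra n = presented_algebra (GenC ` {1..n})
     (clifford_relations (free_algebra (GenC ` {1..n})) n (\<lambda>i. letter (GenC i)))"

text \<open>
  The canonical maps to the Hecke-Clifford algebra. Those of the polynomial and group algebras are
  the linear extensions of their values on monomials and on group elements; that of the Clifford
  algebra sends the class of a noncommutative polynomial in the \<open>c\<^sub>i\<close> to its class modulo the
  larger ideal.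
\<close>

definition x_embedding where
  "x_embedding T n u v = linear_combination (hecke_clifford T n u v) (x_monomial T n u v)"
definition y_embedding where
  "y_embedding T n u v = linear_combination (hecke_clifford T n u v) (y_monomial T n u v)"
definition w_embedding where
  "w_embedding T n u v = linear_combination (hecke_clifford T n u v) (hc_w T n u v)"
definition c_embedding ::
    "weyl_type \<Rightarrow> nat \<Rightarrow> complex \<Rightarrow> complex \<Rightarrow> (generator list \<Rightarrow>\<^sub>0 complex) set \<Rightarrow>
      (generator list \<Rightarrow>\<^sub>0 complex) set" where
  "c_embedding T n u v B = (\<Union>p\<in>B. hc_class T n u v p)"

end

theory Submission imports Defs
begin

text \<open>
  Reordering shows that the span of the elements \<open>x\<^sup>\<alpha> c\<^sup>\<epsilon> w y\<^sup>\<gamma>\<close> is stable under left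
  multiplication by all generators, hence is everything. For independence, the algebra acts on the
  space with basis \<open>x\<^sup>\<alpha> w c\<^sup>E y\<^sup>\<gamma>\<close>, the \<open>x\<^sub>i\<close> acting by raising \<open>\<alpha>\<close>. An operator is determined by
  its commutation rules with the \<open>x\<^sub>i\<close> and its restriction to \<open>\<alpha> = 0\<close>, and conversely compatible
  data of this kind define an operator. So \<open>y\<^sub>j\<close> can be defined, in the manner of Dunkl operators,
  by the prescribed brackets \<open>[y\<^sub>j, x\<^sub>i]\<close>; the compatibility is
  \<open>[[y\<^sub>j, x\<^sub>i], x\<^sub>k] = [[y\<^sub>j, x\<^sub>k], x\<^sub>i]\<close>. The other relations follow from the same uniqueness
  principle; for \<open>[y\<^sub>i, y\<^sub>j] = 0\<close> this is the identity \<open>[[y\<^sub>i, x\<^sub>k], y\<^sub>j] = [[y\<^sub>j, x\<^sub>k], y\<^sub>i]\<close>. The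
  elements \<open>x\<^sup>\<alpha> c\<^sup>\<epsilon> w y\<^sup>\<gamma>\<close> send the vacuum to distinct basis vectors up to sign. Finally, the
  multiplication map sends a spanning family of pure tensors to this basis, so it is bijective.
\<close>

section \<open>Complex vector spaces\<close>

text \<open>The rule D x_i = x'_i D + R_i determines the functional F D at x_i x^\<alpha> from data
  at x^\<alpha>, with F replaced by F x'_i. This recursion makes sense for every function F on the
  index set, so no finiteness of supports has to be carried along, and no closed formula with
  divided differences enters, although x and c do not commute. The two identities on which y rests
  come down to one computation each. In Q_{ab} = \<kappa>_{ab} (1 + c_b c_a) s_{ab} the reflection
  exchanges z_a and z_b. If z commutes with c, as y does, Q_{ab} commutes with z_a + z_b. But x_a
  anticommutes with c_a and turns 1 + c_b c_a into 1 - c_b c_a, which is the factor of Q_{ba}; hence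
  [Q_{ab}, x_b] + [Q_{ba}, x_a] = 0. Apart from the sign change term, the diagonal bracket at a is
  minus the sum of all Q_{ak}, and only k = d and k = -d contribute to its commutator with z_d for d
  different from a and -a. This balances it against the off-diagonal brackets. Signed indices make
  the argument the same for all three types.\<close>

locale complex_space = abelian_group V for V :: "(complex, 'a) module" (structure) +
  assumes smult_closed [simp, intro]: "x \<in> carrier V \<Longrightarrow> a \<odot> x \<in> carrier V"
    and smult_l_distr: "x \<in> carrier V \<Longrightarrow> (a + b) \<odot> x = a \<odot> x \<oplus> b \<odot> x"
    and smult_r_distr: "x \<in> carrier V \<Longrightarrow> y \<in> carrier V \<Longrightarrow> a \<odot> (x \<oplus> y) = a \<odot> x \<oplus> a \<odot> y"
    and smult_assoc1: "x \<in> carrier V \<Longrightarrow> (a * b) \<odot> x = a \<odot> (b \<odot> x)"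
    and smult_one [simp]: "x \<in> carrier V \<Longrightarrow> 1 \<odot> x = x"
begin

lemma smult_0 [simp]: "x \<in> carrier V \<Longrightarrow> 0 \<odot> x = \<zero>"
  using smult_l_distr[of x 0 0] by (metis add.r_cancel_one' add_0 smult_closed)

lemma smult_zero [simp]: "a \<odot> \<zero> = \<zero>"
  using smult_r_distr[of \<zero> \<zero> a] by (metis add.r_cancel_one' r_zero smult_closed zero_closed)

lemma smult_minus_one: "x \<in> carrier V \<Longrightarrow> (- 1) \<odot> x = \<ominus> x"
  using smult_l_distr[of x "- 1" 1] by (metis add.inv_comm add.inv_equality add.left_inverse smult_0 smult_closed smult_one)

lemma diff_eq_zero_iff: "x \<in> carrier V \<Longrightarrow> y \<in> carrier V \<Longrightarrow> x \<ominus> y = \<zero> \<longleftrightarrow> x = y"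
  by (metis a_minus_def add.inv_closed add.inv_equality add.inv_inv add.r_inv)

end

definition complex_subspace :: "(complex, 'a) module \<Rightarrow> 'a set \<Rightarrow> bool" where
  "complex_subspace V N \<longleftrightarrow> N \<subseteq> carrier V \<and> \<zero>\<^bsub>V\<^esub> \<in> N \<and>
     (\<forall>x\<in>N. \<forall>y\<in>N. x \<oplus>\<^bsub>V\<^esub> y \<in> N) \<and> (\<forall>a. \<forall>x\<in>N. a \<odot>\<^bsub>V\<^esub> x \<in> N)"

definition linear_map :: "(complex, 'a) module \<Rightarrow> (complex, 'b) module \<Rightarrow> ('a \<Rightarrow> 'b) \<Rightarrow> bool" where
  "linear_map V U f \<longleftrightarrow> f \<in> carrier V \<rightarrow> carrier U \<and>
     (\<forall>x\<in>carrier V. \<forall>y\<in>carrier V. f (x \<oplus>\<^bsub>V\<^esub> y) = f x \<oplus>\<^bsub>U\<^esub> f y) \<and>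
     (\<forall>a. \<forall>x\<in>carrier V. f (a \<odot>\<^bsub>V\<^esub> x) = a \<odot>\<^bsub>U\<^esub> f x)"

text \<open>Minimality among subspaces replaces explicit combinations: to reach all vectors it is
  enough that the desired property cuts out a subspace and holds on S.\<close>

definition spanning :: "(complex, 'a) module \<Rightarrow> 'a set \<Rightarrow> bool" where
  "spanning V S \<longleftrightarrow> S \<subseteq> carrier V \<and> (\<forall>N. complex_subspace V N \<and> S \<subseteq> N \<longrightarrow> carrier V \<subseteq> N)"

lemma complex_subspaceD:
  assumes "complex_subspace V N"
  shows "x \<in> N \<Longrightarrow> x \<in> carrier V" "\<zero>\<^bsub>V\<^esub> \<in> N" "x \<in> N \<Longrightarrow> y \<in> N \<Longrightarrow> x \<oplus>\<^bsub>V\<^esub> y \<in> N"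
    "x \<in> N \<Longrightarrow> a \<odot>\<^bsub>V\<^esub> x \<in> N"
  using assms unfolding complex_subspace_def by auto

lemma spanningD: "spanning V S \<Longrightarrow> complex_subspace V N \<Longrightarrow> S \<subseteq> N \<Longrightarrow> v \<in> carrier V \<Longrightarrow> v \<in> N"
  unfolding spanning_def by blast

lemma linear_mapD:
  assumes "linear_map V U f"
  shows "x \<in> carrier V \<Longrightarrow> f x \<in> carrier U"
    "x \<in> carrier V \<Longrightarrow> y \<in> carrier V \<Longrightarrow> f (x \<oplus>\<^bsub>V\<^esub> y) = f x \<oplus>\<^bsub>U\<^esub> f y"
    "x \<in> carrier V \<Longrightarrow> f (a \<odot>\<^bsub>V\<^esub> x) = a \<odot>\<^bsub>U\<^esub> f x"
  using assms unfolding linear_map_def by auto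

lemma linear_map_zero:
  assumes "complex_space V" "complex_space U" "linear_map V U f"
  shows "f \<zero>\<^bsub>V\<^esub> = \<zero>\<^bsub>U\<^esub>"
proof -
  interpret V: complex_space V by fact
  interpret U: complex_space U by fact
  show ?thesis using linear_mapD[OF assms(3)] by (metis U.smult_0 V.smult_0 V.zero_closed)
qed

lemma linear_map_minus:
  assumes "complex_space V" "complex_space U" "linear_map V U f" "x \<in> carrier V"
  shows "f (\<ominus>\<^bsub>V\<^esub> x) = \<ominus>\<^bsub>U\<^esub> f x"
proof -
  interpret V: complex_space V by fact
  interpret U: complex_space U by fact
  show ?thesis using linear_mapD[OF assms(3)] assms(4) by (metis U.smult_minus_one V.smult_minus_one)
qed

lemma linear_map_diff:
  assumes "complex_space V" "complex_space U" "linear_map V U f" "x \<in> carrier V" "y \<in> carrier V"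
  shows "f (x \<ominus>\<^bsub>V\<^esub> y) = f x \<ominus>\<^bsub>U\<^esub> f y"
proof -
  interpret V: complex_space V by fact
  interpret U: complex_space U by fact
  show ?thesis using linear_mapD[OF assms(3)] linear_map_minus[OF assms(1-3)] assms(4,5)
    by (simp add: a_minus_def)
qed

lemma linear_map_finsum:
  assumes "complex_space V" "complex_space U" "linear_map V U f" "finite S" "x \<in> S \<rightarrow> carrier V"
  shows "f (\<Oplus>\<^bsub>V\<^esub>k\<in>S. x k) = (\<Oplus>\<^bsub>U\<^esub>k\<in>S. f (x k))"
  using assms(4,5)
proof (induction S rule: finite_induct)
  interpret V: complex_space V by fact
  interpret U: complex_space U by fact
  {
    case empty
    show ?case using linear_map_zero[OF assms(1-3)] by simp
  next
    case (insert k S)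
    then have 1: "x k \<in> carrier V" "x \<in> S \<rightarrow> carrier V" by auto
    have "(\<lambda>k. f (x k)) \<in> insert k S \<rightarrow> carrier U"
      using insert.prems linear_mapD(1)[OF assms(3)] by auto
    then show ?case
      using insert 1 linear_mapD[OF assms(3)] by (simp add: V.finsum_insert U.finsum_insert Pi_def)
  }
qed

lemma linear_map_comp: "linear_map V U f \<Longrightarrow> linear_map U W g \<Longrightarrow> linear_map V W (\<lambda>x. g (f x))"
  unfolding linear_map_def by (auto simp: Pi_def)

lemma complex_subspace_image:
  assumes "complex_space V" "complex_space U" "linear_map V U f"
  shows "complex_subspace U (f ` carrier V)"
proof -
  interpret V: complex_space V by fact
  interpret U: complex_space U by fact
  note f = linear_mapD[OF assms(3)]
  show ?thesis unfolding complex_subspace_def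
  proof (intro conjI ballI allI subsetI)
    show "\<zero>\<^bsub>U\<^esub> \<in> f ` carrier V" using linear_map_zero[OF assms] by (metis V.zero_closed imageI)
  next
    fix x y assume "x \<in> f ` carrier V" "y \<in> f ` carrier V"
    then show "x \<oplus>\<^bsub>U\<^esub> y \<in> f ` carrier V" by (auto simp: f(2)[symmetric])
  next
    fix a x assume "x \<in> f ` carrier V"
    then show "a \<odot>\<^bsub>U\<^esub> x \<in> f ` carrier V" by (auto simp: f(3)[symmetric])
  qed (auto intro: f(1))
qed

lemma complex_subspace_preimage:
  assumes "complex_space V" "complex_space U" "linear_map V U f" "complex_subspace U N"
  shows "complex_subspace V {x \<in> carrier V. f x \<in> N}"
proof -
  interpret V: complex_space V by fact
  show ?thesis
    using linear_mapD[OF assms(3)] linear_map_zero[OF assms(1-3)] complex_subspaceD[OF assms(4)]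
    unfolding complex_subspace_def by auto
qed

lemma complex_subspace_zero: "complex_space U \<Longrightarrow> complex_subspace U {\<zero>\<^bsub>U\<^esub>}"
proof -
  assume "complex_space U"
  then interpret complex_space U .
  show ?thesis by (auto simp: complex_subspace_def)
qed

text \<open>The equalizer of two linear maps is a subspace. Multilinear identities below are checked
  on generators by applying this to one argument at a time.\<close>

lemma linear_map_eq_on_spanning:
  assumes "complex_space V" "complex_space U" "linear_map V U f" "linear_map V U g"
    and "spanning V S" "\<And>x. x \<in> S \<Longrightarrow> f x = g x" "v \<in> carrier V"
  shows "f v = g v"
proof -
  interpret V: complex_space V by fact
  note f = linear_mapD[OF assms(3)] linear_map_zero[OF assms(1,2,3)]
  note g = linear_mapD[OF assms(4)] linear_map_zero[OF assms(1,2,4)]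
  have "complex_subspace V {x \<in> carrier V. f x = g x}"
    unfolding complex_subspace_def by (auto simp: f g)
  moreover have "S \<subseteq> {x \<in> carrier V. f x = g x}" using assms(5,6) unfolding spanning_def by auto
  ultimately show ?thesis using spanningD[OF assms(5)] assms(7) by blast
qed

text \<open>\<open>linear_span\<close> is an intersection of submodules over the ring record of
  complex numbers; this bridge lets all later arguments work with scalars of type complex. Additive
  inverses come from the scalar -1.\<close>

lemma complex_subspace_iff_submodule:
  assumes "complex_space V"
  shows "submodule N ring_of_type_algebra V \<longleftrightarrow> complex_subspace V N"
proof -
  interpret complex_space V by fact
  show ?thesis
  proof
    assume N: "submodule N ring_of_type_algebra V"
    then have 1: "subgroup N (add_monoid V)" by (rule submodule.axioms)
    show "complex_subspace V N"
      using subgroup.subset[OF 1] subgroup.one_closed[OF 1] subgroup.m_closed[OF 1]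
        submodule.smult_closed[OF N]
      by (auto simp: complex_subspace_def ring_of_type_algebra_def)
  next
    assume N: "complex_subspace V N"
    have "\<ominus>\<^bsub>V\<^esub> x \<in> N" if "x \<in> N" for x
      using complex_subspaceD(1,4)[OF N] that by (metis smult_minus_one)
    then have "subgroup N (add_monoid V)"
      using N by (intro add.subgroupI) (auto simp: complex_subspace_def a_inv_def)
    then show "submodule N ring_of_type_algebra V"
      using complex_subspaceD(4)[OF N] by (auto intro!: submodule.intro submodule_axioms.intro)
  qed
qed

lemma complex_subspace_additive_subgroup:
  assumes "complex_space V" "complex_subspace V N"
  shows "abelian_subgroup N V"
proof -
  interpret complex_space V by fact
  have "submodule N ring_of_type_algebra V" using complex_subspace_iff_submodule assms by blast
  then show ?thesis
    by (intro abelian_subgroupI3 additive_subgroup.intro abelian_group_axioms submodule.axioms(1))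
qed

lemma linear_span_least:
  assumes "complex_space V" "complex_subspace V N" "S \<subseteq> N"
  shows "linear_span V S \<subseteq> N"
  using assms by (auto simp: linear_span_def complex_subspace_iff_submodule)

lemma linear_span_superset: "S \<subseteq> linear_span V S"
  by (auto simp: linear_span_def)

lemma complex_subspace_linear_span:
  assumes "complex_space V" "S \<subseteq> carrier V"
  shows "complex_subspace V (linear_span V S)"
proof -
  interpret complex_space V by fact
  have "complex_subspace V (carrier V)" by (auto simp: complex_subspace_def)
  then have "linear_span V S \<subseteq> carrier V" using linear_span_least assms by blast
  then show ?thesis
    unfolding complex_subspace_def linear_span_def complex_subspace_iff_submodule[OF assms(1)]
    by (auto dest: complex_subspaceD)
qed

subsection \<open>Quotients\<close>

lemma quotient_simps:
  "carrier (quotient V N) = a_rcosets\<^bsub>V\<^esub> N"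
  "\<zero>\<^bsub>quotient V N\<^esub> = N"
  "A \<oplus>\<^bsub>quotient V N\<^esub> B = A <+>\<^bsub>V\<^esub> B"
  "a \<odot>\<^bsub>quotient V N\<^esub> B = (\<Union>x\<in>B. N +>\<^bsub>V\<^esub> (a \<odot>\<^bsub>V\<^esub> x))"
  "A \<otimes>\<^bsub>quotient V N\<^esub> B = rcoset_mult V N A B"
  "\<one>\<^bsub>quotient V N\<^esub> = N +>\<^bsub>V\<^esub> \<one>\<^bsub>V\<^esub>"
  by (simp_all add: quotient_def FactRing_def ring.defs module.defs)

lemma
  assumes V: "complex_space V" and N: "complex_subspace V N"
  shows complex_space_quotient: "complex_space (quotient V N)"
    and linear_map_quotient: "linear_map V (quotient V N) ((+>\<^bsub>V\<^esub>) N)"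
    and quotient_cases: "B \<in> carrier (quotient V N) \<Longrightarrow> \<exists>x\<in>carrier V. B = N +>\<^bsub>V\<^esub> x"
    and coset_eq_iff: "x \<in> carrier V \<Longrightarrow> y \<in> carrier V \<Longrightarrow>
      N +>\<^bsub>V\<^esub> x = N +>\<^bsub>V\<^esub> y \<longleftrightarrow> x \<ominus>\<^bsub>V\<^esub> y \<in> N"
proof -
  interpret V: complex_space V by fact
  interpret N: abelian_subgroup N V by (rule complex_subspace_additive_subgroup) fact+
  have carr: "carrier (quotient V N) = {N +>\<^bsub>V\<^esub> x | x. x \<in> carrier V}"
    by (auto simp: quotient_simps A_RCOSETS_def RCOSETS_def a_r_coset_def)
  show cases: "\<exists>x\<in>carrier V. B = N +>\<^bsub>V\<^esub> x" if "B \<in> carrier (quotient V N)" for B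
    using that by (auto simp: carr)
  have mem: "x \<in> N +>\<^bsub>V\<^esub> y \<longleftrightarrow> x \<ominus>\<^bsub>V\<^esub> y \<in> N" if "x \<in> carrier V" "y \<in> carrier V" for x y
    unfolding a_minus_def by (rule N.a_rcos_module[OF that(2,1)])
  show eq: "N +>\<^bsub>V\<^esub> x = N +>\<^bsub>V\<^esub> y \<longleftrightarrow> x \<ominus>\<^bsub>V\<^esub> y \<in> N" if "x \<in> carrier V" "y \<in> carrier V" for x y
    unfolding mem[OF that, symmetric]
    using N.a_repr_independence'[of x y] N.a_rcos_self[of x] that by blast
  have add: "(N +>\<^bsub>V\<^esub> x) \<oplus>\<^bsub>quotient V N\<^esub> (N +>\<^bsub>V\<^esub> y) = N +>\<^bsub>V\<^esub> (x \<oplus>\<^bsub>V\<^esub> y)"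
    if "x \<in> carrier V" "y \<in> carrier V" for x y
    using that by (simp add: quotient_simps N.a_rcos_sum)
  \<comment> \<open>In the quotient, scalar multiplication is a union over all representatives. The
    cosets united are all equal, because a multiple of an element of N stays in N.\<close>
  have smult: "a \<odot>\<^bsub>quotient V N\<^esub> (N +>\<^bsub>V\<^esub> x) = N +>\<^bsub>V\<^esub> (a \<odot>\<^bsub>V\<^esub> x)" if x: "x \<in> carrier V" for a x
  proof -
    have "N +>\<^bsub>V\<^esub> (a \<odot>\<^bsub>V\<^esub> y) = N +>\<^bsub>V\<^esub> (a \<odot>\<^bsub>V\<^esub> x)" if y: "y \<in> N +>\<^bsub>V\<^esub> x" for y
    proof -
      have yc: "y \<in> carrier V" using y x N.a_elemrcos_carrier by blast
      then have "y \<ominus>\<^bsub>V\<^esub> x \<in> N" using mem x y by blast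
      then have "a \<odot>\<^bsub>V\<^esub> (y \<ominus>\<^bsub>V\<^esub> x) \<in> N" using complex_subspaceD(4)[OF N] by blast
      moreover have "a \<odot>\<^bsub>V\<^esub> (y \<ominus>\<^bsub>V\<^esub> x) = a \<odot>\<^bsub>V\<^esub> y \<ominus>\<^bsub>V\<^esub> a \<odot>\<^bsub>V\<^esub> x"
        using x yc by (simp add: a_minus_def V.smult_r_distr V.smult_minus_one[symmetric] V.smult_assoc1[symmetric])
      ultimately show ?thesis using eq x yc by simp
    qed
    moreover have "x \<in> N +>\<^bsub>V\<^esub> x" using x by (rule N.a_rcos_self)
    ultimately show ?thesis unfolding quotient_simps by blast
  qed
  have grp: "abelian_group (quotient V N)"
  proof (rule abelian_groupI)
    have N0: "N = N +>\<^bsub>V\<^esub> \<zero>\<^bsub>V\<^esub>" using N by (simp add: complex_subspace_def V.a_coset_add_zero)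
    then have zero: "\<zero>\<^bsub>quotient V N\<^esub> = N +>\<^bsub>V\<^esub> \<zero>\<^bsub>V\<^esub>" by (simp add: quotient_simps)
    show "\<zero>\<^bsub>quotient V N\<^esub> \<in> carrier (quotient V N)" by (auto simp: carr zero)
    fix A
    assume "A \<in> carrier (quotient V N)"
    then obtain x where x: "x \<in> carrier V" "A = N +>\<^bsub>V\<^esub> x" using cases by blast
    show "\<zero>\<^bsub>quotient V N\<^esub> \<oplus>\<^bsub>quotient V N\<^esub> A = A" using x by (simp add: zero add)
    have "(N +>\<^bsub>V\<^esub> \<ominus>\<^bsub>V\<^esub> x) \<oplus>\<^bsub>quotient V N\<^esub> A = \<zero>\<^bsub>quotient V N\<^esub>"
      using x by (simp add: zero add V.l_neg)
    moreover have "N +>\<^bsub>V\<^esub> \<ominus>\<^bsub>V\<^esub> x \<in> carrier (quotient V N)" using x by (auto simp: carr)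
    ultimately show "\<exists>B\<in>carrier (quotient V N). B \<oplus>\<^bsub>quotient V N\<^esub> A = \<zero>\<^bsub>quotient V N\<^esub>" by blast
    fix B
    assume "B \<in> carrier (quotient V N)"
    then obtain y where y: "y \<in> carrier V" "B = N +>\<^bsub>V\<^esub> y" using cases by blast
    show "A \<oplus>\<^bsub>quotient V N\<^esub> B \<in> carrier (quotient V N)" using x y by (auto simp: carr add)
    show "A \<oplus>\<^bsub>quotient V N\<^esub> B = B \<oplus>\<^bsub>quotient V N\<^esub> A" using x y by (simp add: add V.a_comm)
    fix C
    assume "C \<in> carrier (quotient V N)"
    then obtain z where "z \<in> carrier V" "C = N +>\<^bsub>V\<^esub> z" using cases by blast
    then show "A \<oplus>\<^bsub>quotient V N\<^esub> B \<oplus>\<^bsub>quotient V N\<^esub> C = A \<oplus>\<^bsub>quotient V N\<^esub> (B \<oplus>\<^bsub>quotient V N\<^esub> C)"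
      using x y by (simp add: add V.a_assoc)
  qed
  then interpret Q: abelian_group "quotient V N" .
  show "complex_space (quotient V N)"
  proof (unfold_locales)
    fix A a b
    assume "A \<in> carrier (quotient V N)"
    then obtain x where x: "x \<in> carrier V" "A = N +>\<^bsub>V\<^esub> x" using cases by blast
    show "a \<odot>\<^bsub>quotient V N\<^esub> A \<in> carrier (quotient V N)" using x by (auto simp: carr smult)
    show "(a + b) \<odot>\<^bsub>quotient V N\<^esub> A = a \<odot>\<^bsub>quotient V N\<^esub> A \<oplus>\<^bsub>quotient V N\<^esub> b \<odot>\<^bsub>quotient V N\<^esub> A"
      using x by (simp add: smult add V.smult_l_distr)
    show "a * b \<odot>\<^bsub>quotient V N\<^esub> A = a \<odot>\<^bsub>quotient V N\<^esub> (b \<odot>\<^bsub>quotient V N\<^esub> A)"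
      using x by (simp add: smult V.smult_assoc1)
    show "1 \<odot>\<^bsub>quotient V N\<^esub> A = A" using x by (simp add: smult)
    fix B
    assume "B \<in> carrier (quotient V N)"
    then obtain y where "y \<in> carrier V" "B = N +>\<^bsub>V\<^esub> y" using cases by blast
    then show "a \<odot>\<^bsub>quotient V N\<^esub> (A \<oplus>\<^bsub>quotient V N\<^esub> B) =
        a \<odot>\<^bsub>quotient V N\<^esub> A \<oplus>\<^bsub>quotient V N\<^esub> a \<odot>\<^bsub>quotient V N\<^esub> B"
      using x by (simp add: smult add V.smult_r_distr)
  qed
  show "linear_map V (quotient V N) ((+>\<^bsub>V\<^esub>) N)"
    unfolding linear_map_def by (auto simp: add smult carr)
qed

lemma quotient_lift:
  assumes V: "complex_space V" and U: "complex_space U" and N: "complex_subspace V N"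
    and f: "linear_map V U f" and ker: "\<And>x. x \<in> N \<Longrightarrow> f x = \<zero>\<^bsub>U\<^esub>"
  shows "\<exists>g. linear_map (quotient V N) U g \<and> (\<forall>x\<in>carrier V. g (N +>\<^bsub>V\<^esub> x) = f x)"
proof -
  interpret V: complex_space V by fact
  interpret U: complex_space U by fact
  \<comment> \<open>Any representative may be chosen: two of them differ by an element of N, which f
    annihilates.\<close>
  define g where "g B = f (SOME x. x \<in> carrier V \<and> B = N +>\<^bsub>V\<^esub> x)" for B
  have g: "g (N +>\<^bsub>V\<^esub> x) = f x" if x: "x \<in> carrier V" for x
  proof -
    define y where "y = (SOME y. y \<in> carrier V \<and> N +>\<^bsub>V\<^esub> x = N +>\<^bsub>V\<^esub> y)"
    have y: "y \<in> carrier V \<and> N +>\<^bsub>V\<^esub> x = N +>\<^bsub>V\<^esub> y"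
      unfolding y_def by (rule someI[of _ x]) (use x in simp)
    then have "f (x \<ominus>\<^bsub>V\<^esub> y) = \<zero>\<^bsub>U\<^esub>" using coset_eq_iff[OF V N, of x y] x ker by blast
    then have "f x \<ominus>\<^bsub>U\<^esub> f y = \<zero>\<^bsub>U\<^esub>" using linear_map_diff[OF V U f] x y by simp
    then have "f x = f y" using linear_mapD(1)[OF f] x y by (simp add: U.diff_eq_zero_iff)
    then show ?thesis by (simp add: g_def y_def)
  qed
  have "linear_map (quotient V N) U g"
    unfolding linear_map_def
  proof (intro conjI ballI allI funcsetI)
    note q = linear_mapD[OF linear_map_quotient[OF V N]]
    fix A assume "A \<in> carrier (quotient V N)"
    then obtain x where x: "x \<in> carrier V" "A = N +>\<^bsub>V\<^esub> x" using quotient_cases[OF V N] by blast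
    show "g A \<in> carrier U" using x g linear_mapD(1)[OF f] by simp
    show "g (a \<odot>\<^bsub>quotient V N\<^esub> A) = a \<odot>\<^bsub>U\<^esub> g A" for a
      using x linear_mapD(3)[OF f, of x a] g[of "a \<odot>\<^bsub>V\<^esub> x"] by (simp add: q(3)[symmetric] g)
    fix B assume "B \<in> carrier (quotient V N)"
    then obtain y where y: "y \<in> carrier V" "B = N +>\<^bsub>V\<^esub> y" using quotient_cases[OF V N] by blast
    show "g (A \<oplus>\<^bsub>quotient V N\<^esub> B) = g A \<oplus>\<^bsub>U\<^esub> g B"
      using x y linear_mapD(2)[OF f, of x y] g[of "x \<oplus>\<^bsub>V\<^esub> y"] by (simp add: q(2)[symmetric] g)
  qed
  with g show ?thesis by blast
qed

subsection \<open>Free spaces and linear combinations\<close>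

lemma free_space_simps:
  "carrier (free_space K) = {p. Poly_Mapping.keys p \<subseteq> K}"
  "\<zero>\<^bsub>free_space K\<^esub> = 0" "p \<oplus>\<^bsub>free_space K\<^esub> q = p + q"
  "a \<odot>\<^bsub>free_space K\<^esub> p = Poly_Mapping.map ((*) a) p"
  by (simp_all add: free_space_def)

lemma lookup_map_times [simp]:
  "Poly_Mapping.lookup (Poly_Mapping.map ((*) (a :: complex)) p) k = a * Poly_Mapping.lookup p k"
  by (simp add: Poly_Mapping.map.rep_eq when_def)

lemma keys_map_times: "Poly_Mapping.keys (Poly_Mapping.map ((*) (a :: complex)) p) \<subseteq> Poly_Mapping.keys p"
  by (auto simp: in_keys_iff)

lemma complex_space_free_space: "complex_space (free_space K)"
proof -
  have "abelian_group (free_space K)"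
  proof (rule abelian_groupI, goal_cases)
    case (6 p)
    then have "- p \<in> carrier (free_space K)" "- p \<oplus>\<^bsub>free_space K\<^esub> p = \<zero>\<^bsub>free_space K\<^esub>"
      by (auto simp: free_space_simps in_keys_iff)
    then show ?case by blast
  qed (use Poly_Mapping.keys_add in \<open>fastforce simp: free_space_simps algebra_simps\<close>)+
  then interpret abelian_group "free_space K" .
  show ?thesis
    by unfold_locales
      (auto simp: free_space_simps lookup_add algebra_simps in_keys_iff intro!: poly_mapping_eqI)
qed

lemma free_space_minus:
  assumes "p \<in> carrier (free_space K)" "q \<in> carrier (free_space K)"
  shows "p \<ominus>\<^bsub>free_space K\<^esub> q = p - q"
proof -
  interpret complex_space "free_space K" by (rule complex_space_free_space)
  have "\<ominus>\<^bsub>free_space K\<^esub> q = - q"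
    using smult_minus_one[OF assms(2)]
    by (metis (mono_tags, lifting) free_space_simps(4) lookup_map_times lookup_uminus minus_mult_left mult_1 poly_mapping_eqI)
  then show ?thesis by (simp add: a_minus_def free_space_simps)
qed

lemma single_in_free_space: "k \<in> K \<Longrightarrow> Poly_Mapping.single k a \<in> carrier (free_space K)"
  by (simp add: free_space_simps)

lemma spanning_free_space:
  "spanning (free_space K) ((\<lambda>k. Poly_Mapping.single k 1) ` K)"
  unfolding spanning_def
proof (intro conjI allI impI subsetI; (elim conjE)?)
  fix N p
  assume N: "complex_subspace (free_space K) N" and S: "(\<lambda>k. Poly_Mapping.single k 1) ` K \<subseteq> N"
    and p: "p \<in> carrier (free_space K)"
  have single: "Poly_Mapping.single k a \<in> N" if "k \<in> K" for k a
    using complex_subspaceD(4)[OF N, of "Poly_Mapping.single k 1" a] S that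
    by (auto simp: free_space_simps)
  have "sum (\<lambda>k. Poly_Mapping.single k (Poly_Mapping.lookup p k)) A \<in> N" if "finite A" "A \<subseteq> K" for A
    using that
    by (induction A rule: finite_induct) (use complex_subspaceD(2,3)[OF N] single in \<open>auto simp: free_space_simps\<close>)
  then have "sum (\<lambda>k. Poly_Mapping.single k (Poly_Mapping.lookup p k)) (Poly_Mapping.keys p) \<in> N"
    using p by (simp add: free_space_simps)
  moreover have "sum (\<lambda>k. Poly_Mapping.single k (Poly_Mapping.lookup p k)) (Poly_Mapping.keys p) = p"
    by (rule poly_mapping_eqI) (auto simp: lookup_sum lookup_single when_def in_keys_iff sum.delta)
  ultimately show "p \<in> N" by simp
qed (auto simp: free_space_simps)

text \<open>Combinations with different supports can be compared and added only over a common index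
  set; the coefficients outside the support are 0.\<close>

lemma linear_combination_superset:
  assumes "complex_space V" "b \<in> S \<rightarrow> carrier V" "finite S" "Poly_Mapping.keys p \<subseteq> S"
  shows "linear_combination V b p = (\<Oplus>\<^bsub>V\<^esub>k\<in>S. Poly_Mapping.lookup p k \<odot>\<^bsub>V\<^esub> b k)"
proof -
  interpret complex_space V by fact
  show ?thesis unfolding linear_combination_def
    by (rule add.finprod_mono_neutral_cong_left) (use assms in \<open>auto simp: in_keys_iff Pi_def\<close>)
qed

lemma linear_map_linear_combination:
  assumes "complex_space V" and b: "b \<in> K \<rightarrow> carrier V"
  shows "linear_map (free_space K) V (linear_combination V b)"
  unfolding linear_map_def
proof (intro conjI ballI allI funcsetI)
  interpret complex_space V by fact
  fix p assume "p \<in> carrier (free_space K)"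
  then have p: "Poly_Mapping.keys p \<subseteq> K" by (simp add: free_space_simps)
  show "linear_combination V b p \<in> carrier V"
    unfolding linear_combination_def by (rule finsum_closed) (use b p in auto)
  show "linear_combination V b (a \<odot>\<^bsub>free_space K\<^esub> p) = a \<odot>\<^bsub>V\<^esub> linear_combination V b p" for a
  proof -
    have bp: "b \<in> Poly_Mapping.keys p \<rightarrow> carrier V" using b p by auto
    have smult: "linear_map V V (\<lambda>x. a \<odot>\<^bsub>V\<^esub> x)"
      unfolding linear_map_def by (auto simp: smult_r_distr smult_assoc1[symmetric] mult.commute)
    have "linear_combination V b (a \<odot>\<^bsub>free_space K\<^esub> p) =
        (\<Oplus>\<^bsub>V\<^esub>k\<in>Poly_Mapping.keys p. (a * Poly_Mapping.lookup p k) \<odot>\<^bsub>V\<^esub> b k)"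
      using linear_combination_superset[OF assms(1) bp finite_keys keys_map_times]
      by (simp add: free_space_simps)
    also have "\<dots> = (\<Oplus>\<^bsub>V\<^esub>k\<in>Poly_Mapping.keys p. a \<odot>\<^bsub>V\<^esub> (Poly_Mapping.lookup p k \<odot>\<^bsub>V\<^esub> b k))"
      by (rule finsum_cong') (use bp in \<open>auto simp: smult_assoc1 Pi_def\<close>)
    also have "\<dots> = a \<odot>\<^bsub>V\<^esub> linear_combination V b p"
      unfolding linear_combination_def
      by (rule linear_map_finsum[OF assms(1) assms(1) smult, symmetric]) (use bp in auto)
    finally show ?thesis .
  qed
  fix q assume "q \<in> carrier (free_space K)"
  then have q: "Poly_Mapping.keys q \<subseteq> K" by (simp add: free_space_simps)
  let ?S = "Poly_Mapping.keys p \<union> Poly_Mapping.keys q"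
  have bS: "b \<in> ?S \<rightarrow> carrier V" using b p q by auto
  have pq: "Poly_Mapping.keys (p + q) \<subseteq> ?S" by (rule Poly_Mapping.keys_add)
  note S = linear_combination_superset[OF assms(1) bS]
  have "linear_combination V b (p \<oplus>\<^bsub>free_space K\<^esub> q) =
      (\<Oplus>\<^bsub>V\<^esub>k\<in>?S. Poly_Mapping.lookup p k \<odot>\<^bsub>V\<^esub> b k \<oplus>\<^bsub>V\<^esub> Poly_Mapping.lookup q k \<odot>\<^bsub>V\<^esub> b k)"
    unfolding free_space_simps S[OF _ pq, simplified]
    by (rule finsum_cong') (use bS in \<open>auto simp: lookup_add smult_l_distr Pi_def\<close>)
  also have "\<dots> = linear_combination V b p \<oplus>\<^bsub>V\<^esub> linear_combination V b q"
    using bS by (subst finsum_addf) (auto simp: S Pi_def)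
  finally show "linear_combination V b (p \<oplus>\<^bsub>free_space K\<^esub> q) =
      linear_combination V b p \<oplus>\<^bsub>V\<^esub> linear_combination V b q" .
qed

lemma linear_combination_single:
  assumes "complex_space V" "b k \<in> carrier V"
  shows "linear_combination V b (Poly_Mapping.single k a) = a \<odot>\<^bsub>V\<^esub> b k"
proof -
  interpret complex_space V by fact
  show ?thesis
    using linear_combination_superset[OF assms(1), of b "{k}" "Poly_Mapping.single k a"] assms(2)
    by simp
qed

text \<open>The combinations form the image of a linear map, hence a subspace, and it contains every
  \<open>b k\<close>.\<close>

lemma spanning_imp_linear_combination:
  assumes V: "complex_space V" and b: "b \<in> K \<rightarrow> carrier V" and S: "spanning V (b ` K)" and v: "v \<in> carrier V"
  shows "\<exists>p. Poly_Mapping.keys p \<subseteq> K \<and> v = linear_combination V b p"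
proof -
  interpret complex_space V by fact
  have "complex_subspace V (linear_combination V b ` carrier (free_space K))"
    by (rule complex_subspace_image[OF complex_space_free_space V linear_map_linear_combination[OF V b]])
  moreover have "b ` K \<subseteq> linear_combination V b ` carrier (free_space K)"
  proof (rule image_subsetI)
    fix k assume k: "k \<in> K"
    then have "b k = linear_combination V b (Poly_Mapping.single k 1)"
      using b by (subst linear_combination_single[OF V]) (auto simp: Pi_def)
    then show "b k \<in> linear_combination V b ` carrier (free_space K)"
      using single_in_free_space[OF k] by blast
  qed
  ultimately have "v \<in> linear_combination V b ` carrier (free_space K)"
    using v by (rule spanningD[OF S])
  then show ?thesis by (auto simp: free_space_simps)
qed

text \<open>If f kills a combination of the t k, the same coefficients give a relation between the
  basis vectors b k, so all of them vanish. Independence of the family t is thus a consequence of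
  that of b. This is what allows the tensor factors, the Clifford algebra among them, to be known by
  spanning sets alone.\<close>

lemma linear_isoI:
  assumes V: "complex_space V" and U: "complex_space U" and f: "linear_map V U f"
    and t: "t \<in> K \<rightarrow> carrier V" "spanning V (t ` K)"
    and b: "linear_basis U K b" and ft: "\<And>k. k \<in> K \<Longrightarrow> f (t k) = b k"
  shows "f \<in> linear_iso V U"
proof -
  interpret V: complex_space V by fact
  interpret U: complex_space U by fact
  have bU: "b \<in> K \<rightarrow> carrier U" using b by (simp add: linear_basis_def)
  have comb: "f (linear_combination V t p) = linear_combination U b p" if "p \<in> carrier (free_space K)" for p
    by (rule linear_map_eq_on_spanning[OF complex_space_free_space U
          linear_map_comp[OF linear_map_linear_combination[OF V t(1)] f]
          linear_map_linear_combination[OF U bU] spanning_free_space _ that])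
      (use t bU ft in \<open>auto simp: linear_combination_single[OF V] linear_combination_single[OF U] Pi_def\<close>)
  have inj: "x = \<zero>\<^bsub>V\<^esub>" if x: "x \<in> carrier V" "f x = \<zero>\<^bsub>U\<^esub>" for x
  proof -
    obtain p where p: "Poly_Mapping.keys p \<subseteq> K" "x = linear_combination V t p"
      using spanning_imp_linear_combination[OF V t x(1)] by blast
    then have "linear_combination U b p = \<zero>\<^bsub>U\<^esub>" using comb x by (simp add: free_space_simps)
    then have "p = 0" using b p by (simp add: linear_basis_def)
    then show ?thesis using p by (simp add: linear_combination_def)
  qed
  have "inj_on f (carrier V)"
  proof (rule inj_onI)
    fix x y assume xy: "x \<in> carrier V" "y \<in> carrier V" "f x = f y"
    then have "f (x \<ominus>\<^bsub>V\<^esub> y) = \<zero>\<^bsub>U\<^esub>"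
      using linear_map_diff[OF V U f] linear_mapD(1)[OF f] U.diff_eq_zero_iff by simp
    then show "x = y" using inj[of "x \<ominus>\<^bsub>V\<^esub> y"] xy V.diff_eq_zero_iff by simp
  qed
  moreover have "f ` carrier V = carrier U"
  proof (intro equalityI subsetI)
    fix u assume "u \<in> carrier U"
    then obtain p where p: "Poly_Mapping.keys p \<subseteq> K" "u = linear_combination U b p"
      using b unfolding linear_basis_def by blast
    then have pc: "p \<in> carrier (free_space K)" by (simp add: free_space_simps)
    show "u \<in> f ` carrier V"
      using comb[OF pc] p linear_mapD(1)[OF linear_map_linear_combination[OF V t(1)] pc] by force
  qed (use linear_mapD(1)[OF f] in auto)
  ultimately show ?thesis
    using linear_mapD[OF f] by (auto simp: linear_iso_def iso_def hom_def bij_betw_def)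
qed


subsection \<open>Tensor products\<close>

lemma tensor_relations_subset: 
  assumes "complex_space V" "complex_space W"
  shows "tensor_relations V W \<subseteq> carrier (free_space (carrier V \<times> carrier W))"
proof -
  interpret V: complex_space V by fact
  interpret W: complex_space W by fact
  interpret F: complex_space "free_space (carrier V \<times> carrier W)" by (rule complex_space_free_space)
  let ?F = "free_space (carrier V \<times> carrier W)"
  have 1: "p - q \<in> carrier ?F" if "p \<in> carrier ?F" "q \<in> carrier ?F" for p q
    using F.minus_closed[OF that] free_space_minus[OF that] by simp
  have 2: "p + q \<in> carrier ?F" if "p \<in> carrier ?F" "q \<in> carrier ?F" for p q
    using F.a_closed[OF that] by (simp add: free_space_simps)
  have 3: "Poly_Mapping.map ((*) a) p \<in> carrier ?F" if "p \<in> carrier ?F" for p a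
    using F.smult_closed[OF that] by (simp add: free_space_simps)
  show ?thesis unfolding tensor_relations_def Let_def
    by (auto intro!: 1 2 3 single_in_free_space simp del: map_single)
qed

lemma
  assumes V: "complex_space V" and W: "complex_space W"
  shows complex_space_tensor: "complex_space (tensor_product V W)"
    and pure_tensor_closed: "v \<in> carrier V \<Longrightarrow> w \<in> carrier W \<Longrightarrow>
      pure_tensor V W v w \<in> carrier (tensor_product V W)"
    and linear_map_pure_tensor_left: "w \<in> carrier W \<Longrightarrow> linear_map V (tensor_product V W) (\<lambda>v. pure_tensor V W v w)"
    and linear_map_pure_tensor_right: "v \<in> carrier V \<Longrightarrow> linear_map W (tensor_product V W) (pure_tensor V W v)"
    and spanning_pure_tensors: "spanning (tensor_product V W)
      ((\<lambda>(v, w). pure_tensor V W v w) ` (carrier V \<times> carrier W))"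
proof -
  interpret V: complex_space V by fact
  interpret W: complex_space W by fact
  let ?F = "free_space (carrier V \<times> carrier W)" and ?N = "tensor_kernel V W"
  interpret F: complex_space ?F by (rule complex_space_free_space)
  note F = complex_space_free_space[of "carrier V \<times> carrier W"]
  have N: "complex_subspace ?F ?N" unfolding tensor_kernel_def
    by (rule complex_subspace_linear_span[OF F tensor_relations_subset[OF V W]])
  have R: "tensor_relations V W \<subseteq> ?N" unfolding tensor_kernel_def by (rule linear_span_superset)
  note q = linear_mapD[OF linear_map_quotient[OF F N]]
  show "complex_space (tensor_product V W)"
    unfolding tensor_product_def by (rule complex_space_quotient[OF F N])
  show closed: "pure_tensor V W v w \<in> carrier (tensor_product V W)"
    if "v \<in> carrier V" "w \<in> carrier W" for v w
    unfolding tensor_product_def pure_tensor_def by (rule q(1)) (use that in \<open>simp add: single_in_free_space\<close>)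
  have eq: "?N +>\<^bsub>?F\<^esub> p = ?N +>\<^bsub>?F\<^esub> p'" if "p - p' \<in> tensor_relations V W" "p \<in> carrier ?F" "p' \<in> carrier ?F" for p p'
    using coset_eq_iff[OF F N that(2,3)] free_space_minus[OF that(2,3)] that(1) R by auto
  let ?e = "\<lambda>v w. Poly_Mapping.single (v, w) (1 :: complex)"
  have e: "?e v w \<in> carrier ?F" if "v \<in> carrier V" "w \<in> carrier W" for v w
    using that by (simp add: single_in_free_space)
  have add: "(?N +>\<^bsub>?F\<^esub> p) \<oplus>\<^bsub>tensor_product V W\<^esub> (?N +>\<^bsub>?F\<^esub> p') = ?N +>\<^bsub>?F\<^esub> (p + p')"
    if "p \<in> carrier ?F" "p' \<in> carrier ?F" for p p'
    using q(2)[OF that] by (simp add: tensor_product_def free_space_simps)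
  have smult: "a \<odot>\<^bsub>tensor_product V W\<^esub> (?N +>\<^bsub>?F\<^esub> p) = ?N +>\<^bsub>?F\<^esub> Poly_Mapping.map ((*) a) p"
    if "p \<in> carrier ?F" for p a
    using q(3)[OF that] by (simp add: tensor_product_def free_space_simps)
  have addF: "p + p' \<in> carrier ?F" if "p \<in> carrier ?F" "p' \<in> carrier ?F" for p p'
    using F.a_closed[OF that] by (simp add: free_space_simps)
  have smultF: "Poly_Mapping.map ((*) a) p \<in> carrier ?F" if "p \<in> carrier ?F" for p a
    using F.smult_closed[OF that] by (simp add: free_space_simps)
  show "linear_map V (tensor_product V W) (\<lambda>v. pure_tensor V W v w)" if w: "w \<in> carrier W" for w
    unfolding linear_map_def
  proof (intro conjI ballI allI funcsetI)
    fix v assume v: "v \<in> carrier V"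
    show "pure_tensor V W v w \<in> carrier (tensor_product V W)" using v w by (rule closed)
    have "?e (a \<odot>\<^bsub>V\<^esub> v) w - Poly_Mapping.map ((*) a) (?e v w) \<in> tensor_relations V W" for a
      unfolding tensor_relations_def Let_def using v w by blast
    from eq[OF this] show "pure_tensor V W (a \<odot>\<^bsub>V\<^esub> v) w = a \<odot>\<^bsub>tensor_product V W\<^esub> pure_tensor V W v w" for a
      unfolding pure_tensor_def using v w by (simp only: smult e smultF V.smult_closed)
    fix v' assume v': "v' \<in> carrier V"
    have "?e (v \<oplus>\<^bsub>V\<^esub> v') w - (?e v w + ?e v' w) \<in> tensor_relations V W"
      unfolding tensor_relations_def Let_def using v v' w by blast
    from eq[OF this] show "pure_tensor V W (v \<oplus>\<^bsub>V\<^esub> v') w =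
        pure_tensor V W v w \<oplus>\<^bsub>tensor_product V W\<^esub> pure_tensor V W v' w"
      unfolding pure_tensor_def using v v' w by (simp only: add e addF V.a_closed)
  qed
  show "linear_map W (tensor_product V W) (pure_tensor V W v)" if v: "v \<in> carrier V" for v
    unfolding linear_map_def
  proof (intro conjI ballI allI funcsetI)
    fix w assume w: "w \<in> carrier W"
    show "pure_tensor V W v w \<in> carrier (tensor_product V W)" using v w by (rule closed)
    have "?e v (a \<odot>\<^bsub>W\<^esub> w) - Poly_Mapping.map ((*) a) (?e v w) \<in> tensor_relations V W" for a
      unfolding tensor_relations_def Let_def using v w by blast
    from eq[OF this] show "pure_tensor V W v (a \<odot>\<^bsub>W\<^esub> w) = a \<odot>\<^bsub>tensor_product V W\<^esub> pure_tensor V W v w" for a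
      unfolding pure_tensor_def using v w by (simp only: smult e smultF W.smult_closed)
    fix w' assume w': "w' \<in> carrier W"
    have "?e v (w \<oplus>\<^bsub>W\<^esub> w') - (?e v w + ?e v w') \<in> tensor_relations V W"
      unfolding tensor_relations_def Let_def using v w' w by blast
    from eq[OF this] show "pure_tensor V W v (w \<oplus>\<^bsub>W\<^esub> w') =
        pure_tensor V W v w \<oplus>\<^bsub>tensor_product V W\<^esub> pure_tensor V W v w'"
      unfolding pure_tensor_def using v w' w by (simp only: add e addF W.a_closed)
  qed
  show "spanning (tensor_product V W) ((\<lambda>(v, w). pure_tensor V W v w) ` (carrier V \<times> carrier W))"
    unfolding spanning_def
  proof (intro conjI allI impI subsetI; (elim conjE)?)
    fix M t
    assume M: "complex_subspace (tensor_product V W) M"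
      "(\<lambda>(v, w). pure_tensor V W v w) ` (carrier V \<times> carrier W) \<subseteq> M" and t: "t \<in> carrier (tensor_product V W)"
    obtain p where p: "p \<in> carrier ?F" "t = ?N +>\<^bsub>?F\<^esub> p"
      using t quotient_cases[OF F N] unfolding tensor_product_def by blast
    have "complex_subspace ?F {p \<in> carrier ?F. ?N +>\<^bsub>?F\<^esub> p \<in> M}"
      using complex_subspace_preimage[OF F complex_space_quotient[OF F N] linear_map_quotient[OF F N]] M(1)
      unfolding tensor_product_def by blast
    moreover have "(\<lambda>k. Poly_Mapping.single k 1) ` (carrier V \<times> carrier W) \<subseteq> {p \<in> carrier ?F. ?N +>\<^bsub>?F\<^esub> p \<in> M}"
      using M(2) e by (auto simp: pure_tensor_def)
    ultimately show "t \<in> M" using spanningD[OF spanning_free_space] p by blast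
  qed (use closed in auto)
qed

text \<open>For a fixed argument the pure tensor is linear in the other one, so membership in a
  subspace spreads first from S to V with the right factor in T, and then from T to W.\<close>

lemma spanning_tensor:
  assumes V: "complex_space V" and W: "complex_space W" and S: "spanning V S" and T: "spanning W T"
  shows "spanning (tensor_product V W) ((\<lambda>(v, w). pure_tensor V W v w) ` (S \<times> T))"
  unfolding spanning_def
proof (intro conjI allI impI; (elim conjE)?)
  have ST: "S \<subseteq> carrier V" "T \<subseteq> carrier W" using S T by (auto simp: spanning_def)
  then show "(\<lambda>(v, w). pure_tensor V W v w) ` (S \<times> T) \<subseteq> carrier (tensor_product V W)"
    using pure_tensor_closed[OF V W] by auto
  fix M assume M: "complex_subspace (tensor_product V W) M" "(\<lambda>(v, w). pure_tensor V W v w) ` (S \<times> T) \<subseteq> M"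
  note TT = complex_space_tensor[OF V W]
  have 1: "pure_tensor V W v w \<in> M" if "v \<in> carrier V" "w \<in> T" for v w
  proof -
    have "complex_subspace V {v \<in> carrier V. pure_tensor V W v w \<in> M}"
      using complex_subspace_preimage[OF V TT linear_map_pure_tensor_left[OF V W]] M(1) that ST by blast
    moreover have "S \<subseteq> {v \<in> carrier V. pure_tensor V W v w \<in> M}" using ST M(2) that by auto
    ultimately show ?thesis using spanningD[OF S] that by blast
  qed
  have 2: "pure_tensor V W v w \<in> M" if "v \<in> carrier V" "w \<in> carrier W" for v w
  proof -
    have "complex_subspace W {w \<in> carrier W. pure_tensor V W v w \<in> M}"
      using complex_subspace_preimage[OF W TT linear_map_pure_tensor_right[OF V W]] M(1) that by blast
    moreover have "T \<subseteq> {w \<in> carrier W. pure_tensor V W v w \<in> M}" using ST 1 that by auto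
    ultimately show ?thesis using spanningD[OF T] that by blast
  qed
  then have "(\<lambda>(v, w). pure_tensor V W v w) ` (carrier V \<times> carrier W) \<subseteq> M" by auto
  then show "carrier (tensor_product V W) \<subseteq> M"
    using spanningD[OF spanning_pure_tensors[OF V W] M(1)] by blast
qed

text \<open>Universal property: the linear extension of \<beta> to formal combinations of pairs
  sends each of the four kinds of tensor relations to zero by bilinearity, hence also the subspace
  spanned by them.\<close>

lemma tensor_lift:
  assumes V: "complex_space V" and W: "complex_space W" and U: "complex_space U"
    and left: "\<And>w. w \<in> carrier W \<Longrightarrow> linear_map V U (\<lambda>v. \<beta> v w)"
    and right: "\<And>v. v \<in> carrier V \<Longrightarrow> linear_map W U (\<beta> v)"
  shows "\<exists>\<phi>. linear_map (tensor_product V W) U \<phi> \<and>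
    (\<forall>v\<in>carrier V. \<forall>w\<in>carrier W. \<phi> (pure_tensor V W v w) = \<beta> v w)"
proof -
  interpret V: complex_space V by fact
  interpret W: complex_space W by fact
  interpret U: complex_space U by fact
  let ?F = "free_space (carrier V \<times> carrier W)" and ?N = "tensor_kernel V W"
  note F = complex_space_free_space[of "carrier V \<times> carrier W"]
  interpret F: complex_space ?F by (rule F)
  define \<Phi> where "\<Phi> = linear_combination U (\<lambda>(v, w). \<beta> v w)"
  have \<beta>: "(\<lambda>(v, w). \<beta> v w) \<in> carrier V \<times> carrier W \<rightarrow> carrier U"
    using linear_mapD(1)[OF right] by auto
  have \<Phi>: "linear_map ?F U \<Phi>" unfolding \<Phi>_def by (rule linear_map_linear_combination[OF U \<beta>])
  have N: "complex_subspace ?F ?N" unfolding tensor_kernel_def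
    by (rule complex_subspace_linear_span[OF F tensor_relations_subset[OF V W]])
  let ?e = "\<lambda>v w. Poly_Mapping.single (v, w) (1 :: complex)"
  have e: "?e v w \<in> carrier ?F" if "v \<in> carrier V" "w \<in> carrier W" for v w
    using that by (simp add: single_in_free_space)
  have \<Phi>e: "\<Phi> (?e v w) = \<beta> v w" if "v \<in> carrier V" "w \<in> carrier W" for v w
    using that linear_mapD(1)[OF right] unfolding \<Phi>_def by (subst linear_combination_single[OF U]) auto
  have add: "\<Phi> (p + q) = \<Phi> p \<oplus>\<^bsub>U\<^esub> \<Phi> q" and addF: "p + q \<in> carrier ?F"
    if "p \<in> carrier ?F" "q \<in> carrier ?F" for p q
    using linear_mapD(2)[OF \<Phi> that] F.a_closed[OF that] by (simp_all add: free_space_simps)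
  have smult: "\<Phi> (Poly_Mapping.map ((*) a) p) = a \<odot>\<^bsub>U\<^esub> \<Phi> p"
    and smultF: "Poly_Mapping.map ((*) a) p \<in> carrier ?F" if "p \<in> carrier ?F" for p a
    using linear_mapD(3)[OF \<Phi> that, of a] F.smult_closed[OF that, of a] by (simp_all add: free_space_simps)
  have zero: "\<Phi> (p - q) = \<zero>\<^bsub>U\<^esub>" if "p \<in> carrier ?F" "q \<in> carrier ?F" "\<Phi> p = \<Phi> q" for p q
    using linear_map_diff[OF F U \<Phi> that(1,2)] free_space_minus[OF that(1,2)] that(3)
      linear_mapD(1)[OF \<Phi> that(2)] U.diff_eq_zero_iff by simp
  have "tensor_relations V W \<subseteq> {p \<in> carrier ?F. \<Phi> p \<in> {\<zero>\<^bsub>U\<^esub>}}"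
  proof
    fix p assume p: "p \<in> tensor_relations V W"
    note l = linear_mapD(2,3)[OF left] and r = linear_mapD(2,3)[OF right]
    have "\<Phi> p = \<zero>\<^bsub>U\<^esub>"
      using p unfolding tensor_relations_def Let_def Un_iff mem_Collect_eq
    proof (elim disjE exE conjE; hypsubst)
      fix v v' w assume "v \<in> carrier V" "v' \<in> carrier V" "w \<in> carrier W"
      then show "\<Phi> (?e (v \<oplus>\<^bsub>V\<^esub> v') w - (?e v w + ?e v' w)) = \<zero>\<^bsub>U\<^esub>"
        by (intro zero e addF V.a_closed) (simp_all only: add e \<Phi>e V.a_closed l)
    next
      fix v w w' assume "v \<in> carrier V" "w \<in> carrier W" "w' \<in> carrier W"
      then show "\<Phi> (?e v (w \<oplus>\<^bsub>W\<^esub> w') - (?e v w + ?e v w')) = \<zero>\<^bsub>U\<^esub>"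
        by (intro zero e addF W.a_closed) (simp_all only: add e \<Phi>e W.a_closed r)
    next
      fix a v w assume "v \<in> carrier V" "w \<in> carrier W"
      then show "\<Phi> (?e (a \<odot>\<^bsub>V\<^esub> v) w - Poly_Mapping.map ((*) a) (?e v w)) = \<zero>\<^bsub>U\<^esub>"
        by (intro zero e smultF V.smult_closed) (simp_all only: smult e \<Phi>e V.smult_closed l)
    next
      fix a v w assume "v \<in> carrier V" "w \<in> carrier W"
      then show "\<Phi> (?e v (a \<odot>\<^bsub>W\<^esub> w) - Poly_Mapping.map ((*) a) (?e v w)) = \<zero>\<^bsub>U\<^esub>"
        by (intro zero e smultF W.smult_closed) (simp_all only: smult e \<Phi>e W.smult_closed r)
    qed
    then show "p \<in> {p \<in> carrier ?F. \<Phi> p \<in> {\<zero>\<^bsub>U\<^esub>}}"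
      using p tensor_relations_subset[OF V W] by blast
  qed
  then have "?N \<subseteq> {p \<in> carrier ?F. \<Phi> p \<in> {\<zero>\<^bsub>U\<^esub>}}"
    unfolding tensor_kernel_def
    by (intro linear_span_least[OF F] complex_subspace_preimage[OF F U \<Phi>] complex_subspace_zero[OF U])
  then obtain \<phi> where "linear_map (quotient ?F ?N) U \<phi>" "\<And>x. x \<in> carrier ?F \<Longrightarrow> \<phi> (?N +>\<^bsub>?F\<^esub> x) = \<Phi> x"
    using quotient_lift[OF F U N \<Phi>] by blast
  then show ?thesis
    unfolding tensor_product_def pure_tensor_def using e \<Phi>e by (intro exI[of _ \<phi>]) simp
qed

section \<open>Complex algebras\<close>

locale complex_algebra = ring A + complex_space A for A :: "(complex, 'a) module" (structure) +
  assumes smult_assoc2: "x \<in> carrier A \<Longrightarrow> y \<in> carrier A \<Longrightarrow> (a \<odot> x) \<otimes> y = a \<odot> (x \<otimes> y)"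
    and smult_assoc3: "x \<in> carrier A \<Longrightarrow> y \<in> carrier A \<Longrightarrow> x \<otimes> (a \<odot> y) = a \<odot> (x \<otimes> y)"
begin

lemma complex_space_axioms': "complex_space A" ..

lemma linear_map_mult_left: "x \<in> carrier A \<Longrightarrow> linear_map A A (\<lambda>y. x \<otimes> y)"
  unfolding linear_map_def by (auto simp: r_distr smult_assoc3)

lemma linear_map_mult_right: "y \<in> carrier A \<Longrightarrow> linear_map A A (\<lambda>x. x \<otimes> y)"
  unfolding linear_map_def by (auto simp: l_distr smult_assoc2)

end

definition algebra_hom :: "(complex, 'a) module \<Rightarrow> (complex, 'b) module \<Rightarrow> ('a \<Rightarrow> 'b) \<Rightarrow> bool" where
  "algebra_hom A B h \<longleftrightarrow> linear_map A B h \<and> h \<one>\<^bsub>A\<^esub> = \<one>\<^bsub>B\<^esub> \<and>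
     (\<forall>x\<in>carrier A. \<forall>y\<in>carrier A. h (x \<otimes>\<^bsub>A\<^esub> y) = h x \<otimes>\<^bsub>B\<^esub> h y)"

lemma algebra_homD:
  assumes "algebra_hom A B h"
  shows "linear_map A B h" "h \<one>\<^bsub>A\<^esub> = \<one>\<^bsub>B\<^esub>"
    "x \<in> carrier A \<Longrightarrow> y \<in> carrier A \<Longrightarrow> h (x \<otimes>\<^bsub>A\<^esub> y) = h x \<otimes>\<^bsub>B\<^esub> h y"
  using assms unfolding algebra_hom_def by auto

text \<open>A monoid algebra and the free space on its monoid are different records that agree in
  their linear structure; this transfers the vector space laws.\<close>

lemma complex_space_cong:
  assumes "complex_space V"
    and eq: "carrier V' = carrier V" "\<And>x y. x \<oplus>\<^bsub>V'\<^esub> y = x \<oplus>\<^bsub>V\<^esub> y" "\<zero>\<^bsub>V'\<^esub> = \<zero>\<^bsub>V\<^esub>"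
      "\<And>a x. a \<odot>\<^bsub>V'\<^esub> x = a \<odot>\<^bsub>V\<^esub> x"
  shows "complex_space V'"
proof -
  interpret V: complex_space V by fact
  have "abelian_group V'"
  proof (rule abelian_groupI, unfold eq)
    show "\<exists>y\<in>carrier V. y \<oplus>\<^bsub>V\<^esub> x = \<zero>\<^bsub>V\<^esub>" if "x \<in> carrier V" for x
      using that V.l_neg V.a_inv_closed by blast
  qed (auto simp: V.a_ac)
  then interpret V': abelian_group V' .
  show ?thesis
    by (unfold_locales, unfold eq)
      (auto simp: V.smult_l_distr V.smult_r_distr V.smult_assoc1)
qed


subsection \<open>Monoid algebras\<close>

lemma monoid_algebra_simps:
  "carrier (monoid_algebra M) = carrier (free_space (carrier M))"
  "x \<oplus>\<^bsub>monoid_algebra M\<^esub> y = x \<oplus>\<^bsub>free_space (carrier M)\<^esub> y"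
  "\<zero>\<^bsub>monoid_algebra M\<^esub> = \<zero>\<^bsub>free_space (carrier M)\<^esub>"
  "a \<odot>\<^bsub>monoid_algebra M\<^esub> x = a \<odot>\<^bsub>free_space (carrier M)\<^esub> x"
  "\<one>\<^bsub>monoid_algebra M\<^esub> = Poly_Mapping.single \<one>\<^bsub>M\<^esub> 1"
  by (simp_all add: monoid_algebra_def)

lemma linear_map_monoid_algebra:
  "linear_map (monoid_algebra M) U f \<longleftrightarrow> linear_map (free_space (carrier M)) U f"
  "linear_map U (monoid_algebra M) g \<longleftrightarrow> linear_map U (free_space (carrier M)) g"
  by (simp_all add: linear_map_def monoid_algebra_simps)

lemma spanning_monoid_algebra:
  "spanning (monoid_algebra M) ((\<lambda>k. Poly_Mapping.single k 1) ` carrier M)"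
  using spanning_free_space[of "carrier M"]
  by (simp add: spanning_def complex_subspace_def monoid_algebra_simps)

lemma complex_space_monoid_algebra: "complex_space (monoid_algebra M)"
  by (rule complex_space_cong[OF complex_space_free_space[of "carrier M"]])
    (simp_all add: monoid_algebra_simps)

text \<open>With index sets larger than the supports, two products with different supports become
  sums over the same indices, from which bilinearity is read off.\<close>

lemma monoid_algebra_mult:
  assumes "finite S" "finite T" "Poly_Mapping.keys p \<subseteq> S" "Poly_Mapping.keys q \<subseteq> T"
  shows "p \<otimes>\<^bsub>monoid_algebra M\<^esub> q = (\<Sum>a\<in>S. \<Sum>b\<in>T.
    Poly_Mapping.single (a \<otimes>\<^bsub>M\<^esub> b) (Poly_Mapping.lookup p a * Poly_Mapping.lookup q b))"
proof -
  have "p \<otimes>\<^bsub>monoid_algebra M\<^esub> q = (\<Sum>a\<in>Poly_Mapping.keys p. \<Sum>b\<in>Poly_Mapping.keys q.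
    Poly_Mapping.single (a \<otimes>\<^bsub>M\<^esub> b) (Poly_Mapping.lookup p a * Poly_Mapping.lookup q b))"
    by (simp add: monoid_algebra_def)
  also have "\<dots> = (\<Sum>a\<in>Poly_Mapping.keys p. \<Sum>b\<in>T.
    Poly_Mapping.single (a \<otimes>\<^bsub>M\<^esub> b) (Poly_Mapping.lookup p a * Poly_Mapping.lookup q b))"
    by (intro sum.cong refl sum.mono_neutral_left) (use assms in \<open>auto simp: in_keys_iff\<close>)
  also have "\<dots> = (\<Sum>a\<in>S. \<Sum>b\<in>T.
    Poly_Mapping.single (a \<otimes>\<^bsub>M\<^esub> b) (Poly_Mapping.lookup p a * Poly_Mapping.lookup q b))"
    by (rule sum.mono_neutral_left) (use assms in \<open>auto simp: in_keys_iff\<close>)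
  finally show ?thesis .
qed

lemma monoid_algebra_mult_single:
  "Poly_Mapping.single a x \<otimes>\<^bsub>monoid_algebra M\<^esub> Poly_Mapping.single b y =
    Poly_Mapping.single (a \<otimes>\<^bsub>M\<^esub> b) (x * y)"
  by (simp add: monoid_algebra_mult[of "{a}" "{b}"])

lemma map_times_sum:
  "finite A \<Longrightarrow> Poly_Mapping.map ((*) (a::complex)) (sum f A) = (\<Sum>k\<in>A. Poly_Mapping.map ((*) a) (f k))"
  by (rule poly_mapping_eqI) (simp add: lookup_sum sum_distrib_left)

lemma complex_algebra_monoid_algebra:
  fixes M (structure)
  assumes "Group.monoid M"
  shows "complex_algebra (monoid_algebra M)"
proof -
  interpret M: Group.monoid M by fact
  let ?A = "monoid_algebra M"
  interpret A: complex_space ?A by (rule complex_space_monoid_algebra)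
  note A = complex_space_monoid_algebra[of M]
  have carr: "p \<in> carrier ?A \<longleftrightarrow> Poly_Mapping.keys p \<subseteq> carrier M" for p
    by (simp add: monoid_algebra_simps free_space_simps)
  have closed: "p \<otimes>\<^bsub>?A\<^esub> q \<in> carrier ?A" if "p \<in> carrier ?A" "q \<in> carrier ?A" for p q
  proof -
    have sumc: "sum f S \<in> carrier ?A" if "finite S" "\<And>k. k \<in> S \<Longrightarrow> f k \<in> carrier ?A" for f and S :: "'a set"
      using that A.a_closed A.zero_closed
      by (induction S rule: finite_induct) (auto simp: monoid_algebra_simps free_space_simps)
    have sing: "Poly_Mapping.single (a \<otimes> b) x \<in> carrier ?A" if "a \<in> carrier M" "b \<in> carrier M" for a b x
      using that by (simp add: carr)
    have "Poly_Mapping.keys p \<subseteq> carrier M" "Poly_Mapping.keys q \<subseteq> carrier M"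
      using that by (simp_all add: carr)
    then show ?thesis
      unfolding monoid_algebra_mult[OF finite_keys finite_keys order_refl order_refl]
      by (intro sumc sing finite_keys) auto
  qed
  have right: "linear_map ?A ?A (\<lambda>p. p \<otimes>\<^bsub>?A\<^esub> q)" if q: "q \<in> carrier ?A" for q
    unfolding linear_map_def
  proof (intro conjI ballI allI funcsetI closed q)
    fix p assume p: "p \<in> carrier ?A"
    show "(a \<odot>\<^bsub>?A\<^esub> p) \<otimes>\<^bsub>?A\<^esub> q = a \<odot>\<^bsub>?A\<^esub> (p \<otimes>\<^bsub>?A\<^esub> q)" for a
      by (simp add: monoid_algebra_simps free_space_simps monoid_algebra_mult[OF finite_keys[of p] finite_keys[of q]]
          keys_map_times map_times_sum mult.assoc)
    fix p' assume "p' \<in> carrier ?A"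
    let ?S = "Poly_Mapping.keys p \<union> Poly_Mapping.keys p'"
    show "(p \<oplus>\<^bsub>?A\<^esub> p') \<otimes>\<^bsub>?A\<^esub> q = p \<otimes>\<^bsub>?A\<^esub> q \<oplus>\<^bsub>?A\<^esub> p' \<otimes>\<^bsub>?A\<^esub> q"
      by (simp add: monoid_algebra_simps free_space_simps monoid_algebra_mult[of ?S "Poly_Mapping.keys q"]
          Poly_Mapping.keys_add lookup_add distrib_right single_add sum.distrib)
  qed
  have left: "linear_map ?A ?A (\<lambda>p. q \<otimes>\<^bsub>?A\<^esub> p)" if q: "q \<in> carrier ?A" for q
    unfolding linear_map_def
  proof (intro conjI ballI allI funcsetI closed q)
    fix p assume p: "p \<in> carrier ?A"
    show "q \<otimes>\<^bsub>?A\<^esub> (a \<odot>\<^bsub>?A\<^esub> p) = a \<odot>\<^bsub>?A\<^esub> (q \<otimes>\<^bsub>?A\<^esub> p)" for a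
      by (simp add: monoid_algebra_simps free_space_simps monoid_algebra_mult[OF finite_keys[of q] finite_keys[of p]]
          keys_map_times map_times_sum mult.left_commute)
    fix p' assume "p' \<in> carrier ?A"
    let ?S = "Poly_Mapping.keys p \<union> Poly_Mapping.keys p'"
    show "q \<otimes>\<^bsub>?A\<^esub> (p \<oplus>\<^bsub>?A\<^esub> p') = q \<otimes>\<^bsub>?A\<^esub> p \<oplus>\<^bsub>?A\<^esub> q \<otimes>\<^bsub>?A\<^esub> p'"
      by (simp add: monoid_algebra_simps free_space_simps monoid_algebra_mult[of "Poly_Mapping.keys q" ?S]
          Poly_Mapping.keys_add lookup_add distrib_left single_add sum.distrib)
  qed
  note ext = linear_map_eq_on_spanning[OF A A _ _ spanning_monoid_algebra]
  have one: "\<one>\<^bsub>?A\<^esub> \<in> carrier ?A" by (simp add: monoid_algebra_simps single_in_free_space)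
  have id: "linear_map ?A ?A (\<lambda>p. p)" by (simp add: linear_map_def)
  have sc: "Poly_Mapping.single a 1 \<in> carrier ?A" if "a \<in> carrier M" for a using that by (simp add: carr)
  \<comment> \<open>Both sides are linear in each argument, so it suffices to treat single monoid
    elements, one argument after the other.\<close>
  have assoc: "(p \<otimes>\<^bsub>?A\<^esub> q) \<otimes>\<^bsub>?A\<^esub> r = p \<otimes>\<^bsub>?A\<^esub> (q \<otimes>\<^bsub>?A\<^esub> r)"
    if p: "p \<in> carrier ?A" and q: "q \<in> carrier ?A" and r: "r \<in> carrier ?A" for p q r
  proof (rule ext[OF linear_map_comp[OF right[OF q] right[OF r]] right[OF closed[OF q r]] _ p], clarify)
    fix a assume a: "a \<in> carrier M"
    let ?s = "\<lambda>a. Poly_Mapping.single a (1::complex)"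
    show "(?s a \<otimes>\<^bsub>?A\<^esub> q) \<otimes>\<^bsub>?A\<^esub> r = ?s a \<otimes>\<^bsub>?A\<^esub> (q \<otimes>\<^bsub>?A\<^esub> r)"
    proof (rule ext[OF linear_map_comp[OF left[OF sc[OF a]] right[OF r]]
            linear_map_comp[OF right[OF r] left[OF sc[OF a]]] _ q], clarify)
      fix b assume b: "b \<in> carrier M"
      show "(?s a \<otimes>\<^bsub>?A\<^esub> ?s b) \<otimes>\<^bsub>?A\<^esub> r = ?s a \<otimes>\<^bsub>?A\<^esub> (?s b \<otimes>\<^bsub>?A\<^esub> r)"
        by (rule ext[OF left[OF closed[OF sc[OF a] sc[OF b]]]
              linear_map_comp[OF left[OF sc[OF b]] left[OF sc[OF a]]] _ r])
          (use a b in \<open>auto simp: monoid_algebra_mult_single M.m_assoc\<close>)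
    qed
  qed
  have "Group.monoid ?A"
  proof (rule monoidI)
    fix p assume p: "p \<in> carrier ?A"
    show "\<one>\<^bsub>?A\<^esub> \<otimes>\<^bsub>?A\<^esub> p = p"
      by (rule ext[OF left[OF one] id _ p]) (auto simp: monoid_algebra_mult_single monoid_algebra_simps(5))
    show "p \<otimes>\<^bsub>?A\<^esub> \<one>\<^bsub>?A\<^esub> = p"
      by (rule ext[OF right[OF one] id _ p]) (auto simp: monoid_algebra_mult_single monoid_algebra_simps(5))
  qed (auto intro: closed assoc one)
  then have "ring ?A"
    by (intro ringI A.abelian_group_axioms linear_mapD(2)[OF right] linear_mapD(2)[OF left])
  then interpret ring ?A .
  show ?thesis
    by unfold_locales (intro linear_mapD(3)[OF right] linear_mapD(3)[OF left]; assumption)+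
qed


subsection \<open>Quotient algebras\<close>

lemma
  assumes A: "complex_algebra A" and I: "ideal I A"
  shows complex_subspace_ideal: "complex_subspace A I"
    and complex_algebra_quotient: "complex_algebra (quotient A I)"
    and algebra_hom_quotient: "algebra_hom A (quotient A I) ((+>\<^bsub>A\<^esub>) I)"
proof -
  interpret A: complex_algebra A by fact
  interpret I: ideal I A by fact
  show sub: "complex_subspace A I"
    unfolding complex_subspace_def
  proof (intro conjI ballI allI)
    fix a x assume x: "x \<in> I"
    \<comment> \<open>A scalar a acts as multiplication by the algebra element a 1, so a ring ideal
      is automatically a subspace.\<close>
    then have "(a \<odot>\<^bsub>A\<^esub> \<one>\<^bsub>A\<^esub>) \<otimes>\<^bsub>A\<^esub> x \<in> I" by (intro I.I_l_closed) auto
    then show "a \<odot>\<^bsub>A\<^esub> x \<in> I" using I.Icarr[OF x] by (simp add: A.smult_assoc2)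
  qed (auto simp: I.Icarr)
  note q = linear_mapD[OF linear_map_quotient[OF A.complex_space_axioms' sub]]
  note cases = quotient_cases[OF A.complex_space_axioms' sub]
  interpret Q: complex_space "quotient A I" by (rule complex_space_quotient[OF A.complex_space_axioms' sub])
  have mult: "(I +>\<^bsub>A\<^esub> x) \<otimes>\<^bsub>quotient A I\<^esub> (I +>\<^bsub>A\<^esub> y) = I +>\<^bsub>A\<^esub> (x \<otimes>\<^bsub>A\<^esub> y)"
    if "x \<in> carrier A" "y \<in> carrier A" for x y
    using that by (simp add: quotient_simps I.rcoset_mult_add)
  have one: "\<one>\<^bsub>quotient A I\<^esub> = I +>\<^bsub>A\<^esub> \<one>\<^bsub>A\<^esub>" by (simp add: quotient_simps)
  show "algebra_hom A (quotient A I) ((+>\<^bsub>A\<^esub>) I)"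
    unfolding algebra_hom_def using linear_map_quotient[OF A.complex_space_axioms' sub] by (simp add: mult one)
  note add = q(2)[symmetric] and smult = q(3)[symmetric]
  show "complex_algebra (quotient A I)"
  proof unfold_locales
    show "\<one>\<^bsub>quotient A I\<^esub> \<in> carrier (quotient A I)" using q(1) by (simp add: one)
    fix B\<^sub>1 assume "B\<^sub>1 \<in> carrier (quotient A I)"
    then obtain x where x: "x \<in> carrier A" "B\<^sub>1 = I +>\<^bsub>A\<^esub> x" using cases by blast
    show "\<one>\<^bsub>quotient A I\<^esub> \<otimes>\<^bsub>quotient A I\<^esub> B\<^sub>1 = B\<^sub>1" using x by (simp add: mult one)
    show "B\<^sub>1 \<otimes>\<^bsub>quotient A I\<^esub> \<one>\<^bsub>quotient A I\<^esub> = B\<^sub>1" using x by (simp add: mult one)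
    fix B\<^sub>2 assume "B\<^sub>2 \<in> carrier (quotient A I)"
    then obtain y where y: "y \<in> carrier A" "B\<^sub>2 = I +>\<^bsub>A\<^esub> y" using cases by blast
    show "B\<^sub>1 \<otimes>\<^bsub>quotient A I\<^esub> B\<^sub>2 \<in> carrier (quotient A I)" using x y by (simp add: mult q(1))
    show "(a \<odot>\<^bsub>quotient A I\<^esub> B\<^sub>1) \<otimes>\<^bsub>quotient A I\<^esub> B\<^sub>2 = a \<odot>\<^bsub>quotient A I\<^esub> (B\<^sub>1 \<otimes>\<^bsub>quotient A I\<^esub> B\<^sub>2)" for a
      using x y by (simp add: mult smult A.smult_assoc2)
    show "B\<^sub>1 \<otimes>\<^bsub>quotient A I\<^esub> (a \<odot>\<^bsub>quotient A I\<^esub> B\<^sub>2) = a \<odot>\<^bsub>quotient A I\<^esub> (B\<^sub>1 \<otimes>\<^bsub>quotient A I\<^esub> B\<^sub>2)" for a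
      using x y by (simp add: mult smult A.smult_assoc3)
    fix B\<^sub>3 assume "B\<^sub>3 \<in> carrier (quotient A I)"
    then obtain z where z: "z \<in> carrier A" "B\<^sub>3 = I +>\<^bsub>A\<^esub> z" using cases by blast
    show "B\<^sub>1 \<otimes>\<^bsub>quotient A I\<^esub> B\<^sub>2 \<otimes>\<^bsub>quotient A I\<^esub> B\<^sub>3 = B\<^sub>1 \<otimes>\<^bsub>quotient A I\<^esub> (B\<^sub>2 \<otimes>\<^bsub>quotient A I\<^esub> B\<^sub>3)"
      using x y z by (simp add: mult A.m_assoc)
    show "(B\<^sub>1 \<oplus>\<^bsub>quotient A I\<^esub> B\<^sub>2) \<otimes>\<^bsub>quotient A I\<^esub> B\<^sub>3 =
        B\<^sub>1 \<otimes>\<^bsub>quotient A I\<^esub> B\<^sub>3 \<oplus>\<^bsub>quotient A I\<^esub> B\<^sub>2 \<otimes>\<^bsub>quotient A I\<^esub> B\<^sub>3"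
      using x y z by (simp add: mult add A.l_distr)
    show "B\<^sub>3 \<otimes>\<^bsub>quotient A I\<^esub> (B\<^sub>1 \<oplus>\<^bsub>quotient A I\<^esub> B\<^sub>2) =
        B\<^sub>3 \<otimes>\<^bsub>quotient A I\<^esub> B\<^sub>1 \<oplus>\<^bsub>quotient A I\<^esub> B\<^sub>3 \<otimes>\<^bsub>quotient A I\<^esub> B\<^sub>2"
      using x y z by (simp add: mult add A.r_distr)
  qed
qed

subsection \<open>Presented algebras\<close>

lemma monoid_lists: "Group.monoid \<lparr>carrier = lists S, monoid.mult = (@), one = []\<rparr>"
  by (rule monoidI) auto

lemma complex_algebra_free_algebra: "complex_algebra (free_algebra S)"
  unfolding free_algebra_def by (rule complex_algebra_monoid_algebra[OF monoid_lists])

lemma letter_closed: "s \<in> S \<Longrightarrow> letter s \<in> carrier (free_algebra S)"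
  by (simp add: free_algebra_def monoid_algebra_simps free_space_simps letter_def)

lemma spanning_words: "spanning (free_algebra S) ((\<lambda>w. Poly_Mapping.single w 1) ` lists S)"
  using spanning_monoid_algebra[of "\<lparr>carrier = lists S, monoid.mult = (@), one = []\<rparr>"]
  by (simp add: free_algebra_def)

lemma free_algebra_mult_single:
  "Poly_Mapping.single v a \<otimes>\<^bsub>free_algebra S\<^esub> Poly_Mapping.single w b = Poly_Mapping.single (v @ w) (a * b)"
  by (simp add: free_algebra_def monoid_algebra_mult_single)

lemma free_algebra_one: "\<one>\<^bsub>free_algebra S\<^esub> = Poly_Mapping.single [] 1"
  by (simp add: free_algebra_def monoid_algebra_simps)

text \<open>The value at a letter is asserted whenever \<open>f s\<close> lies in E, also for s
  outside S, since the evaluation of words is a formula for all words. For the operator algebra,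
  whose carrier is the whole type, it gives equalities of functions and not just of their
  restrictions to valid indices.\<close>

lemma free_algebra_lift:
  assumes E: "complex_algebra E" and f: "f \<in> S \<rightarrow> carrier E"
  shows "\<exists>\<Psi>. algebra_hom (free_algebra S) E \<Psi> \<and> (\<forall>s. f s \<in> carrier E \<longrightarrow> \<Psi> (letter s) = f s)"
proof -
  interpret E: complex_algebra E by fact
  interpret F: complex_algebra "free_algebra S" by (rule complex_algebra_free_algebra)
  note ES = E.complex_space_axioms' and FS = F.complex_space_axioms'
  define wv where "wv w = foldr (\<lambda>s e. f s \<otimes>\<^bsub>E\<^esub> e) w \<one>\<^bsub>E\<^esub>" for w
  have wv: "wv w \<in> carrier E" if "w \<in> lists S" for w
    using that f by (induction w) (auto simp: wv_def)
  have wv_append: "wv (v @ w) = wv v \<otimes>\<^bsub>E\<^esub> wv w" if "v \<in> lists S" "w \<in> lists S" for v w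
    using that(1)
  proof (induction v)
    case Nil
    then show ?case using wv[OF that(2)] by (simp add: wv_def)
  next
    case (Cons s v)
    then have "f s \<in> carrier E" using f by auto
    then show ?case using Cons wv[OF that(2)] wv[of v] by (simp add: wv_def E.m_assoc)
  qed
  define \<Psi> where "\<Psi> = linear_combination E wv"
  have lin: "linear_map (free_algebra S) E \<Psi>"
    unfolding \<Psi>_def free_algebra_def linear_map_monoid_algebra
    by (rule linear_map_linear_combination[OF ES]) (use wv in auto)
  have single: "\<Psi> (Poly_Mapping.single w 1) = wv w" if "w \<in> lists S" for w
    using wv[OF that] by (simp add: \<Psi>_def linear_combination_single[OF ES])
  have sc: "Poly_Mapping.single w 1 \<in> carrier (free_algebra S)" if "w \<in> lists S" for w
    using that by (simp add: free_algebra_def monoid_algebra_simps free_space_simps)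
  note ext = linear_map_eq_on_spanning[OF FS ES _ _ spanning_words]
  have "\<Psi> (p \<otimes>\<^bsub>free_algebra S\<^esub> q) = \<Psi> p \<otimes>\<^bsub>E\<^esub> \<Psi> q"
    if p: "p \<in> carrier (free_algebra S)" and q: "q \<in> carrier (free_algebra S)" for p q
  proof (rule ext[OF linear_map_comp[OF F.linear_map_mult_right[OF q] lin]
        linear_map_comp[OF lin E.linear_map_mult_right[OF linear_mapD(1)[OF lin q]]] _ p], erule imageE, hypsubst)
    fix v assume v: "v \<in> lists S"
    show "\<Psi> (Poly_Mapping.single v 1 \<otimes>\<^bsub>free_algebra S\<^esub> q) = \<Psi> (Poly_Mapping.single v 1) \<otimes>\<^bsub>E\<^esub> \<Psi> q"
      by (rule ext[OF linear_map_comp[OF F.linear_map_mult_left[OF sc[OF v]] lin]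
          linear_map_comp[OF lin E.linear_map_mult_left[OF linear_mapD(1)[OF lin sc[OF v]]]] _ q], erule imageE)
        (use v in \<open>simp add: free_algebra_mult_single single wv_append\<close>)
  qed
  moreover have "\<Psi> \<one>\<^bsub>free_algebra S\<^esub> = \<one>\<^bsub>E\<^esub>" by (simp add: free_algebra_one single wv_def)
  moreover have "\<Psi> (letter s) = f s" if "f s \<in> carrier E" for s
    using that by (simp add: letter_def \<Psi>_def wv_def linear_combination_single[OF ES])
  ultimately show ?thesis using lin unfolding algebra_hom_def by blast
qed

lemma algebra_hom_kernel_ideal:
  assumes "complex_algebra A" "complex_algebra E" "algebra_hom A E \<Psi>"
  shows "ideal {p \<in> carrier A. \<Psi> p = \<zero>\<^bsub>E\<^esub>} A"
proof -
  interpret A: complex_algebra A by fact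
  interpret E: complex_algebra E by fact
  note h = algebra_homD[OF assms(3)]
  have "\<Psi> \<in> ring_hom A E"
    using h linear_mapD(1,2)[OF h(1)] by (auto simp: ring_hom_def)
  then interpret ring_hom_ring A E \<Psi>
    by (intro ring_hom_ringI2 A.ring_axioms E.ring_axioms)
  show ?thesis using kernel_is_ideal unfolding a_kernel_def' .
qed

text \<open>\<open>presented_generated\<close> is the form in which spanning is proved later: words
  arise from the empty word by prepending letters, so stability under left multiplication by letters
  is enough. \<open>presented_lift\<close> holds because the kernel of \<Psi> is an ideal that
  contains the differences of the two sides of all relations.\<close>

lemma
  fixes S R
  assumes R: "R \<subseteq> carrier (free_algebra S) \<times> carrier (free_algebra S)"
  defines "cls \<equiv> (+>\<^bsub>free_algebra S\<^esub>) (relation_ideal S R)" and "H \<equiv> presented_algebra S R"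
  shows ideal_relation_ideal: "ideal (relation_ideal S R) (free_algebra S)"
    and complex_algebra_presented: "complex_algebra H"
    and algebra_hom_class: "algebra_hom (free_algebra S) H cls"
    and class_of_relation: "(l, r) \<in> R \<Longrightarrow> cls l = cls r"
    and presented_cases: "a \<in> carrier H \<Longrightarrow> \<exists>p\<in>carrier (free_algebra S). a = cls p"
    and presented_generated: "complex_subspace H N \<Longrightarrow> \<one>\<^bsub>H\<^esub> \<in> N \<Longrightarrow>
      (\<And>s h. s \<in> S \<Longrightarrow> h \<in> N \<Longrightarrow> cls (letter s) \<otimes>\<^bsub>H\<^esub> h \<in> N) \<Longrightarrow> carrier H \<subseteq> N"
    and presented_lift: "complex_algebra E \<Longrightarrow> algebra_hom (free_algebra S) E \<Psi> \<Longrightarrow>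
      (\<And>l r. (l, r) \<in> R \<Longrightarrow> \<Psi> l = \<Psi> r) \<Longrightarrow>
      \<exists>\<psi>. algebra_hom H E \<psi> \<and> (\<forall>p\<in>carrier (free_algebra S). \<psi> (cls p) = \<Psi> p)"
proof -
  let ?F = "free_algebra S" and ?I = "relation_ideal S R"
  interpret F: complex_algebra ?F by (rule complex_algebra_free_algebra)
  note FA = complex_algebra_free_algebra[of S] and FS = F.complex_space_axioms'
  let ?D = "{l \<ominus>\<^bsub>?F\<^esub> r | l r. (l, r) \<in> R}"
  have D: "?D \<subseteq> carrier ?F"
  proof clarify
    fix l r assume "(l, r) \<in> R"
    then have "l \<in> carrier ?F" "r \<in> carrier ?F" using R by auto
    then show "l \<ominus>\<^bsub>?F\<^esub> r \<in> carrier ?F" by (rule F.minus_closed)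
  qed
  show I: "ideal ?I ?F" unfolding relation_ideal_def by (rule F.genideal_ideal[OF D])
  note sub = complex_subspace_ideal[OF FA I]
  show H: "complex_algebra H" unfolding H_def presented_algebra_def by (rule complex_algebra_quotient[OF FA I])
  then interpret H: complex_algebra H .
  show hom: "algebra_hom ?F H cls" unfolding H_def cls_def presented_algebra_def
    by (rule algebra_hom_quotient[OF FA I])
  show rel: "cls l = cls r" if "(l, r) \<in> R" for l r
  proof -
    have c: "l \<in> carrier ?F" "r \<in> carrier ?F" using R that by auto
    have "l \<ominus>\<^bsub>?F\<^esub> r \<in> ?D" using that by blast
    then have "l \<ominus>\<^bsub>?F\<^esub> r \<in> ?I" unfolding relation_ideal_def by (rule subsetD[OF F.genideal_self[OF D]])
    then show ?thesis unfolding cls_def coset_eq_iff[OF FS sub c] .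
  qed
  show cases: "\<exists>p\<in>carrier ?F. a = cls p" if "a \<in> carrier H" for a
    using quotient_cases[OF FS sub, of a] that unfolding H_def cls_def presented_algebra_def by simp
  show "carrier H \<subseteq> N" if N: "complex_subspace H N" "\<one>\<^bsub>H\<^esub> \<in> N"
    "\<And>s h. s \<in> S \<Longrightarrow> h \<in> N \<Longrightarrow> cls (letter s) \<otimes>\<^bsub>H\<^esub> h \<in> N" for N
  proof
    fix a assume "a \<in> carrier H"
    then obtain p where p: "p \<in> carrier ?F" "a = cls p" using cases by blast
    have "cls (Poly_Mapping.single w 1) \<in> N" if "w \<in> lists S" for w
      using that
    proof (induction w)
      case Nil
      then show ?case using N(2) algebra_homD(2)[OF hom] by (simp add: free_algebra_one)
    next
      case (Cons s w)
      have "Poly_Mapping.single (s # w) 1 = letter s \<otimes>\<^bsub>?F\<^esub> Poly_Mapping.single w (1::complex)"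
        by (simp add: letter_def free_algebra_mult_single)
      moreover have "letter s \<in> carrier ?F" using Cons.hyps by (simp add: letter_closed)
      moreover have w: "w \<in> lists S" "s \<in> S" using Cons.hyps by simp_all
      then have "Poly_Mapping.single w 1 \<in> carrier ?F"
        by (simp add: free_algebra_def monoid_algebra_simps free_space_simps)
      ultimately show ?case using N(3)[OF w(2) Cons.IH] algebra_homD(3)[OF hom] by simp
    qed
    then have "(\<lambda>w. Poly_Mapping.single w 1) ` lists S \<subseteq> {p \<in> carrier ?F. cls p \<in> N}"
      using spanning_words[of S] by (auto simp: spanning_def)
    then have "p \<in> {p \<in> carrier ?F. cls p \<in> N}"
      using p(1) by (rule spanningD[OF spanning_words complex_subspace_preimage[OF FS H.complex_space_axioms' algebra_homD(1)[OF hom] N(1)]])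
    then show "a \<in> N" using p by simp
  qed
  show "\<exists>\<psi>. algebra_hom H E \<psi> \<and> (\<forall>p\<in>carrier ?F. \<psi> (cls p) = \<Psi> p)"
    if E: "complex_algebra E" and \<Psi>: "algebra_hom ?F E \<Psi>" and eq: "\<And>l r. (l, r) \<in> R \<Longrightarrow> \<Psi> l = \<Psi> r"
  proof -
    interpret E: complex_algebra E by fact
    note ES = E.complex_space_axioms' and lin = algebra_homD(1)[OF \<Psi>]
    have "?D \<subseteq> {p \<in> carrier ?F. \<Psi> p = \<zero>\<^bsub>E\<^esub>}"
    proof clarify
      fix l r assume lr: "(l, r) \<in> R"
      then have c: "l \<in> carrier ?F" "r \<in> carrier ?F" using R by auto
      then have "\<Psi> (l \<ominus>\<^bsub>?F\<^esub> r) = \<zero>\<^bsub>E\<^esub>"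
        using linear_map_diff[OF FS ES lin c] eq[OF lr] linear_mapD(1)[OF lin c(2)] E.diff_eq_zero_iff by simp
      then show "l \<ominus>\<^bsub>?F\<^esub> r \<in> carrier ?F \<and> \<Psi> (l \<ominus>\<^bsub>?F\<^esub> r) = \<zero>\<^bsub>E\<^esub>" using c by simp
    qed
    then have "?I \<subseteq> {p \<in> carrier ?F. \<Psi> p = \<zero>\<^bsub>E\<^esub>}"
      unfolding relation_ideal_def by (rule F.genideal_minimal[OF algebra_hom_kernel_ideal[OF FA E \<Psi>]])
    then have ker: "\<Psi> x = \<zero>\<^bsub>E\<^esub>" if "x \<in> ?I" for x using that by blast
    have "\<exists>\<psi>. linear_map H E \<psi> \<and> (\<forall>p\<in>carrier ?F. \<psi> (cls p) = \<Psi> p)"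
      unfolding H_def cls_def presented_algebra_def by (rule quotient_lift[OF FS ES sub lin ker])
    then obtain \<psi> where \<psi>: "linear_map H E \<psi>" "\<forall>p\<in>carrier ?F. \<psi> (cls p) = \<Psi> p"
      by (elim exE conjE) (rule that)
    have mult: "\<psi> (a \<otimes>\<^bsub>H\<^esub> b) = \<psi> a \<otimes>\<^bsub>E\<^esub> \<psi> b" if ab: "a \<in> carrier H" "b \<in> carrier H" for a b
    proof -
      from cases[OF ab(1)] obtain p where p: "p \<in> carrier ?F" "a = cls p" by (elim bexE) (rule that)
      from cases[OF ab(2)] obtain q where q: "q \<in> carrier ?F" "b = cls q" by (elim bexE) (rule that)
      note pq = p(1) q(1)
      have mult: "\<psi> (a \<otimes>\<^bsub>H\<^esub> b) = \<psi> (cls (p \<otimes>\<^bsub>?F\<^esub> q))" using p q algebra_homD(3)[OF hom pq] by simp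
      also have "\<dots> = \<psi> a \<otimes>\<^bsub>E\<^esub> \<psi> b" using p q \<psi>(2) algebra_homD(3)[OF \<Psi> pq] by simp
      finally show ?thesis .
    qed
    have "\<psi> (cls \<one>\<^bsub>?F\<^esub>) = \<Psi> \<one>\<^bsub>?F\<^esub>" using \<psi>(2) by (rule bspec) (rule F.one_closed)
    then have one: "\<psi> \<one>\<^bsub>H\<^esub> = \<one>\<^bsub>E\<^esub>" by (simp only: algebra_homD(2)[OF hom] algebra_homD(2)[OF \<Psi>])
    have "algebra_hom H E \<psi>"
      unfolding algebra_hom_def by (intro conjI ballI \<psi>(1) one mult)
    then have "algebra_hom H E \<psi> \<and> (\<forall>p\<in>carrier ?F. \<psi> (cls p) = \<Psi> p)" using \<psi>(2) by (rule conjI)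
    then show ?thesis by (rule exI[of _ \<psi>])
  qed
qed

section \<open>Weyl groups\<close>

lemma signed_permutationsD:
  assumes "w \<in> signed_permutations n"
  shows "w (- i) = - w i" "bij w" "w i = w j \<longleftrightarrow> i = j" "w 0 = 0" "w i = 0 \<longleftrightarrow> i = 0"
    "\<bar>w i\<bar> \<le> int n \<longleftrightarrow> \<bar>i\<bar> \<le> int n" "\<not> \<bar>i\<bar> \<le> int n \<Longrightarrow> w i = i"
proof -
  have p: "w permutes {- int n..int n}" and odd: "\<And>i. w (- i) = - w i"
    using assms by (auto simp: signed_permutations_def)
  show "w (- i) = - w i" by (rule odd)
  show "bij w" using p by (rule permutes_bij)
  then show eq: "w i = w j \<longleftrightarrow> i = j" for i j by (simp add: bij_is_inj inj_eq)
  show 0: "w 0 = 0" using odd[of 0] by simp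
  show "w i = 0 \<longleftrightarrow> i = 0" using eq[of i 0] 0 by simp
  have "\<bar>i\<bar> \<le> int n \<longleftrightarrow> i \<in> {- int n..int n}" for i by auto
  then show "\<bar>w i\<bar> \<le> int n \<longleftrightarrow> \<bar>i\<bar> \<le> int n" using permutes_in_image[OF p, of i] by simp
  show "w i = i" if "\<not> \<bar>i\<bar> \<le> int n" using that by (intro permutes_not_in[OF p]) auto
qed

lemma signed_permutations_comp:
  "v \<in> signed_permutations n \<Longrightarrow> w \<in> signed_permutations n \<Longrightarrow> v \<circ> w \<in> signed_permutations n"
  by (auto simp: signed_permutations_def intro: permutes_compose)

lemma signed_permutations_inv:
  assumes "w \<in> signed_permutations n"
  shows "inv_into UNIV w \<in> signed_permutations n"
proof -
  note w = signed_permutationsD[OF assms]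
  have "inv_into UNIV w (- i) = - inv_into UNIV w i" for i
    using w(1,2) by (metis bij_inv_eq_iff)
  then show ?thesis using assms by (auto simp: signed_permutations_def intro: permutes_inv)
qed

lemma signed_permutations_abs_bij:
  assumes "w \<in> signed_permutations n"
  shows "bij_betw (\<lambda>i. \<bar>w i\<bar>) {1..int n} {1..int n}"
proof -
  note w = signed_permutationsD[OF assms]
  have "inj_on (\<lambda>i. \<bar>w i\<bar>) {1..int n}"
  proof (rule inj_onI)
    fix i j assume ij: "i \<in> {1..int n}" "j \<in> {1..int n}" "\<bar>w i\<bar> = \<bar>w j\<bar>"
    then have "w i = w j \<or> w i = w (- j)" by (auto simp: w(1) abs_eq_iff)
    then show "i = j" using ij by (auto simp: w(3))
  qed
  moreover have "(\<lambda>i. \<bar>w i\<bar>) ` {1..int n} \<subseteq> {1..int n}"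
  proof clarify
    fix i assume "i \<in> {1..int n}"
    then have "w i \<noteq> 0" "\<bar>w i\<bar> \<le> int n" by (auto simp: w(5,6))
    then show "\<bar>w i\<bar> \<in> {1..int n}" by auto
  qed
  ultimately show ?thesis by (simp add: bij_betw_def endo_inj_surj)
qed

text \<open>Parity of the number of sign changes is multiplicative: it is the product \<sigma> of
  the signs of w i over positive i. The sign of v (w i) is the sign of w i times that of v at
  \<bar>w i\<bar>, and i \<mapsto> \<bar>w i\<bar> permutes the positive indices, so \<sigma> (v w)
  = \<sigma> w * \<sigma> v.\<close>

lemma sign_changes_comp:
  assumes v: "v \<in> signed_permutations n" and w: "w \<in> signed_permutations n"
  shows "even (card {i \<in> {1..int n}. (v \<circ> w) i < 0}) \<longleftrightarrow>
    (even (card {i \<in> {1..int n}. v i < 0}) \<longleftrightarrow> even (card {i \<in> {1..int n}. w i < 0}))"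
proof -
  define \<sigma> where "\<sigma> w = (\<Prod>i\<in>{1..int n}. if w i < 0 then - 1 else 1 :: int)" for w :: "int \<Rightarrow> int"
  have \<sigma>: "\<sigma> w = (- 1) ^ card {i \<in> {1..int n}. w i < 0}" for w
    unfolding \<sigma>_def by (simp add: prod.If_cases Int_def)
  note V = signed_permutationsD[OF v] and W = signed_permutationsD[OF w]
  have "\<sigma> (v \<circ> w) = (\<Prod>i\<in>{1..int n}. (if w i < 0 then - 1 else 1) * (if v \<bar>w i\<bar> < 0 then - 1 else 1))"
    unfolding \<sigma>_def
  proof (rule prod.cong)
    fix i assume "i \<in> {1..int n}"
    then have "v (w i) \<noteq> 0" by (auto simp: V(5) W(5))
    then show "(if (v \<circ> w) i < 0 then - 1 else 1 :: int) =
        (if w i < 0 then - 1 else 1) * (if v \<bar>w i\<bar> < 0 then - 1 else 1)"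
      using V(1)[of "w i"] by (auto simp: abs_if)
  qed simp
  also have "\<dots> = \<sigma> w * \<sigma> v"
    unfolding prod.distrib \<sigma>_def
    by (simp add: prod.reindex_bij_betw[OF signed_permutations_abs_bij[OF w], of "\<lambda>i. if v i < 0 then - 1 else 1"])
  finally have "(- 1 :: int) ^ card {i \<in> {1..int n}. (v \<circ> w) i < 0} =
     (- 1) ^ (card {i \<in> {1..int n}. w i < 0} + card {i \<in> {1..int n}. v i < 0})"
    by (simp only: \<sigma> power_add)
  moreover have "(- 1 :: int) ^ k = (- 1) ^ l \<Longrightarrow> even k \<longleftrightarrow> even l" for k l :: nat
    by (cases "even k"; cases "even l") simp_all
  ultimately have "even (card {i \<in> {1..int n}. (v \<circ> w) i < 0}) \<longleftrightarrow>
     even (card {i \<in> {1..int n}. w i < 0} + card {i \<in> {1..int n}. v i < 0})"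
    by blast
  then show ?thesis by (simp only: even_add) blast
qed

lemma weyl_group_signed: "w \<in> carrier (weyl_group T n) \<Longrightarrow> w \<in> signed_permutations n"
  by (simp add: weyl_group_def)

lemma id_signed_permutation: "id \<in> signed_permutations n"
  by (auto simp: signed_permutations_def permutes_id)

lemma weyl_group_simps:
  "v \<otimes>\<^bsub>weyl_group T n\<^esub> w = v \<circ> w" "\<one>\<^bsub>weyl_group T n\<^esub> = id"
  by (simp_all add: weyl_group_def)

lemma weyl_group_comp:
  assumes v: "v \<in> carrier (weyl_group T n)" and w: "w \<in> carrier (weyl_group T n)"
  shows "v \<circ> w \<in> carrier (weyl_group T n)"
proof -
  have VW: "v \<in> signed_permutations n" "w \<in> signed_permutations n" using v w by (auto dest: weyl_group_signed)
  note V = signed_permutationsD[OF VW(1)] and W = signed_permutationsD[OF VW(2)]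
  show ?thesis
  proof (cases T)
    case TypeA
    have "v (w i) > 0" if "i \<in> {1..int n}" for i
    proof -
      have "w i > 0" using w that TypeA by (simp add: weyl_group_def)
      moreover have "\<bar>w i\<bar> \<le> int n" using W(6) that by auto
      ultimately have "w i \<in> {1..int n}" by auto
      then show ?thesis using v TypeA by (simp add: weyl_group_def)
    qed
    then show ?thesis using TypeA signed_permutations_comp[OF VW] by (simp add: weyl_group_def)
  next
    case TypeB
    then show ?thesis using signed_permutations_comp[OF VW] by (simp add: weyl_group_def)
  next
    case TypeD
    then show ?thesis using signed_permutations_comp[OF VW] sign_changes_comp[OF VW] v w
      by (simp add: weyl_group_def)
  qed
qed

lemma weyl_group_inv_into:
  assumes w: "w \<in> carrier (weyl_group T n)"
  shows "inv_into UNIV w \<in> carrier (weyl_group T n)" "inv_into UNIV w \<circ> w = id" "w \<circ> inv_into UNIV w = id"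
proof -
  have w': "w \<in> signed_permutations n" using w by (rule weyl_group_signed)
  note W = signed_permutationsD[OF w']
  let ?v = "inv_into UNIV w"
  note v' = signed_permutations_inv[OF w'] and V = signed_permutationsD[OF signed_permutations_inv[OF w']]
  show vw: "?v \<circ> w = id" "w \<circ> ?v = id"
    by (rule inv_o_cancel[OF bij_is_inj[OF W(2)]], rule surj_iff[THEN iffD1, OF bij_is_surj[OF W(2)]])
  show "?v \<in> carrier (weyl_group T n)"
  proof (cases T)
    case TypeA
    have "?v i > 0" if i: "i \<in> {1..int n}" for i
    proof (rule ccontr)
      \<comment> \<open>Otherwise - ?v i would be a positive index that w sends to the negative
        number - i.\<close>
      assume neg: "\<not> ?v i > 0"
      have "w (?v i) = i" using vw(2) by (metis comp_apply id_apply)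
      moreover have "\<bar>?v i\<bar> \<le> int n" using V(6) i by auto
      moreover have "?v i \<noteq> 0" using V(5) i by auto
      ultimately have wi: "w (- ?v i) = - i" and "- ?v i \<in> {1..int n}" using W(1) neg by auto
      moreover have "\<forall>k\<in>{1..int n}. w k > 0" using w TypeA by (simp add: weyl_group_def)
      ultimately have "- i > 0" by (metis wi)
      then show False using i by simp
    qed
    then show ?thesis using TypeA v' by (simp add: weyl_group_def)
  next
    case TypeB
    then show ?thesis using v' by (simp add: weyl_group_def)
  next
    case TypeD
    have E: "{i \<in> {1..int n}. id i < 0} = {}" by auto
    have "even (card {i \<in> {1..int n}. (?v \<circ> w) i < 0})"
      unfolding vw E by (simp only: card.empty even_zero)
    then have "even (card {i \<in> {1..int n}. ?v i < 0})"
      using sign_changes_comp[OF v' w'] w TypeD by (simp add: weyl_group_def)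
    then show ?thesis using TypeD v' by (simp add: weyl_group_def)
  qed
qed

lemma id_weyl_group: "id \<in> carrier (weyl_group T n)"
proof -
  have E: "{i. 1 \<le> i \<and> i \<le> int n \<and> i < 0} = {}" by auto
  show ?thesis using id_signed_permutation[of n] by (cases T) (simp_all add: weyl_group_def E)
qed

lemma group_weyl_group: "group (weyl_group T n)"
proof (rule groupI)
  fix w assume "w \<in> carrier (weyl_group T n)"
  then show "\<exists>v\<in>carrier (weyl_group T n). v \<otimes>\<^bsub>weyl_group T n\<^esub> w = \<one>\<^bsub>weyl_group T n\<^esub>"
    using weyl_group_inv_into unfolding weyl_group_simps by blast
qed (auto simp: weyl_group_simps weyl_group_comp id_weyl_group comp_assoc)

lemma weyl_group_inv:
  assumes w: "w \<in> carrier (weyl_group T n)"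
  shows "inv\<^bsub>weyl_group T n\<^esub> w = inv_into UNIV w"
proof -
  interpret group "weyl_group T n" by (rule group_weyl_group)
  show ?thesis using w weyl_group_inv_into[OF w]
    by (intro inv_equality) (auto simp: weyl_group_simps)
qed

lemma s_refl_apply:
  assumes "i \<noteq> j" "i > 0" "j > 0"
  shows "s_refl i j a = (if a = int i then int j else if a = int j then int i
    else if a = - int i then - int j else if a = - int j then - int i else a)"
  using assms by (auto simp: s_refl_def transpose_def)

lemma sbar_refl_apply:
  assumes "i \<noteq> j" "i > 0" "j > 0"
  shows "sbar_refl i j a = (if a = int i then - int j else if a = int j then - int i
    else if a = - int i then int j else if a = - int j then int i else a)"
  using assms by (auto simp: sbar_refl_def transpose_def)

lemma tau_refl_apply: "tau_refl i a = (if \<bar>a\<bar> = int i then - a else a)"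
  by (auto simp: tau_refl_def transpose_def)

lemma involution_signed_permutation:
  assumes "\<And>a. w (w a) = a" "\<And>a. w (- a) = - w a" "\<And>a. \<not> \<bar>a\<bar> \<le> int n \<Longrightarrow> w a = a"
  shows "w \<in> signed_permutations n"
proof -
  have "w a \<in> {- int n..int n}" if "a \<in> {- int n..int n}" for a
    using assms(1)[of a] assms(3)[of "w a"] that by fastforce
  then have "bij_betw w {- int n..int n} {- int n..int n}"
    by (intro bij_betwI[where g = w]) (auto simp: assms(1))
  then have "w permutes {- int n..int n}"
    using assms(3) by (intro bij_imp_permutes) (auto simp: abs_le_iff)
  then show ?thesis using assms(2) by (simp add: signed_permutations_def)
qed

lemma s_refl_closed:
  assumes "i \<noteq> j" "i \<in> {1..n}" "j \<in> {1..n}"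
  shows "s_refl i j \<in> carrier (weyl_group T n)"
proof -
  have "s_refl i j \<in> signed_permutations n"
    by (rule involution_signed_permutation) (use assms in \<open>auto simp: s_refl_apply\<close>)
  moreover have E: "{a. 1 \<le> a \<and> a \<le> int n \<and> s_refl i j a < 0} = {}"
    using assms by (auto simp: s_refl_apply)
  moreover have "\<forall>a\<in>{1..int n}. s_refl i j a > 0" using assms by (auto simp: s_refl_apply)
  ultimately show ?thesis by (cases T) (simp_all add: weyl_group_def E)
qed

lemma sbar_refl_closed:
  assumes "i \<noteq> j" "i \<in> {1..n}" "j \<in> {1..n}" "T \<noteq> TypeA"
  shows "sbar_refl i j \<in> carrier (weyl_group T n)"
proof -
  have "sbar_refl i j \<in> signed_permutations n"
    by (rule involution_signed_permutation) (use assms in \<open>auto simp: sbar_refl_apply\<close>)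
  moreover have E: "{a. 1 \<le> a \<and> a \<le> int n \<and> sbar_refl i j a < 0} = {int i, int j}"
    using assms by (auto simp: sbar_refl_apply)
  ultimately show ?thesis using assms by (cases T) (simp_all add: weyl_group_def E)
qed

lemma tau_refl_closed:
  assumes "i \<in> {1..n}"
  shows "tau_refl i \<in> carrier (weyl_group TypeB n)"
proof -
  have "tau_refl i \<in> signed_permutations n"
    by (rule involution_signed_permutation) (use assms in \<open>auto simp: tau_refl_apply\<close>)
  then show ?thesis by (simp add: weyl_group_def)
qed

section \<open>The defining relations under homomorphisms\<close>

text \<open>The equations are required only under Q because a homomorphism respects the operations
  only for arguments in the carrier.\<close>

lemma image_pairs:
  assumes "\<And>i. Q i \<Longrightarrow> f' i = h (f i)" "\<And>i. Q i \<Longrightarrow> g' i = h (g i)"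
  shows "{(f' i, g' i) | i. Q i} = map_prod h h ` {(f i, g i) | i. Q i}"
proof (intro equalityI subsetI)
  fix a assume "a \<in> {(f' i, g' i) | i. Q i}"
  then obtain i where "a = (f' i, g' i)" "Q i" by blast
  then have "a = map_prod h h (f i, g i)" "Q i" using assms by simp_all
  then show "a \<in> map_prod h h ` {(f i, g i) | i. Q i}" by blast
next
  fix a assume "a \<in> map_prod h h ` {(f i, g i) | i. Q i}"
  then obtain i where i: "a = map_prod h h (f i, g i)" "Q i" by (elim imageE CollectE exE conjE) blast
  then have "a = (f' i, g' i)" using assms by simp
  then show "a \<in> {(f' i, g' i) | i. Q i}" using i(2) by blast
qed

lemma image_pairs2:
  assumes "\<And>i j. Q i j \<Longrightarrow> f' i j = h (f i j)" "\<And>i j. Q i j \<Longrightarrow> g' i j = h (g i j)"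
  shows "{(f' i j, g' i j) | i j. Q i j} = map_prod h h ` {(f i j, g i j) | i j. Q i j}"
proof (intro equalityI subsetI)
  fix a assume "a \<in> {(f' i j, g' i j) | i j. Q i j}"
  then obtain i j where "a = (f' i j, g' i j)" "Q i j" by blast
  then have "a = map_prod h h (f i j, g i j)" "Q i j" using assms by simp_all
  then show "a \<in> map_prod h h ` {(f i j, g i j) | i j. Q i j}" by blast
next
  fix a assume "a \<in> map_prod h h ` {(f i j, g i j) | i j. Q i j}"
  then obtain i j where ij: "a = map_prod h h (f i j, g i j)" "Q i j"
    by (elim imageE CollectE exE conjE) blast
  then have "a = (f' i j, g' i j)" using assms by simp
  then show "a \<in> {(f' i j, g' i j) | i j. Q i j}" using ij(2) by blast
qed

locale hc_family = complex_algebra A for A :: "(complex, 'a) module" (structure) +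
  fixes T :: weyl_type and n :: nat and x y c :: "nat \<Rightarrow> 'a" and g :: "(int \<Rightarrow> int) \<Rightarrow> 'a"
  assumes x_closed: "i \<in> {1..n} \<Longrightarrow> x i \<in> carrier A"
    and y_closed: "i \<in> {1..n} \<Longrightarrow> y i \<in> carrier A"
    and c_closed: "i \<in> {1..n} \<Longrightarrow> c i \<in> carrier A"
    and g_closed: "w \<in> carrier (weyl_group T n) \<Longrightarrow> g w \<in> carrier A"
begin

lemma signed_closed:
  assumes "\<And>i. i \<in> {1..n} \<Longrightarrow> z i \<in> carrier A" "k \<noteq> 0" "\<bar>k\<bar> \<le> int n"
  shows "signed A z k \<in> carrier A"
proof -
  have "nat (- k) \<in> {1..n}" if "k < 0" using that assms(3) by auto
  moreover have "nat k \<in> {1..n}" if "\<not> k < 0" using that assms(2,3) by auto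
  ultimately show ?thesis using assms(1) by (auto simp: signed_def)
qed

lemma weyl_image:
  assumes "w \<in> carrier (weyl_group T n)" "i \<in> {1..n}"
  shows "w (int i) \<noteq> 0" "\<bar>w (int i)\<bar> \<le> int n"
  using signed_permutationsD(5,6)[OF weyl_group_signed[OF assms(1)], of "int i"] assms(2) by auto

lemma g_inv_closed: "w \<in> carrier (weyl_group T n) \<Longrightarrow> g (inv\<^bsub>weyl_group T n\<^esub> w) \<in> carrier A"
  using group.inv_closed[OF group_weyl_group] g_closed by blast

lemmas g_refl_closed =
  g_closed[OF s_refl_closed] g_closed[OF sbar_refl_closed]

lemma g_tau_closed: "T = TypeB \<Longrightarrow> i \<in> {1..n} \<Longrightarrow> g (tau_refl i) \<in> carrier A"
  using g_closed tau_refl_closed by simp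

end

lemma signed_hom:
  assumes "complex_algebra A" "complex_algebra B" "algebra_hom A B h"
    and "\<And>i. i \<in> {1..n} \<Longrightarrow> z i \<in> carrier A" "k \<noteq> 0" "\<bar>k\<bar> \<le> int n"
  shows "h (signed A z k) = signed B (\<lambda>i. h (z i)) k"
proof -
  interpret A: complex_algebra A by fact
  interpret B: complex_algebra B by fact
  have "nat (- k) \<in> {1..n}" if "k < 0" using that assms(6) by auto
  then show ?thesis
    using linear_map_minus[OF A.complex_space_axioms' B.complex_space_axioms' algebra_homD(1)[OF assms(3)]] assms(4)
    by (auto simp: signed_def)
qed

text \<open>The relations are expressions in the generators built from algebra operations, so
  homomorphisms carry them to the relations between the images. Applied to the class map this makes
  them hold in the presented algebra; applied to the lift to operators it reduces the factorization
  through the quotient to an identity between operators. The second part is applied with the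
  identity as h.\<close>

lemma hecke_clifford_relations_hom:
  assumes hc: "hc_family A T n x y c g" and B: "complex_algebra B" and h: "algebra_hom A B h"
  shows "hecke_clifford_relations B T n u v (\<lambda>i. h (x i)) (\<lambda>i. h (y i)) (\<lambda>i. h (c i)) (\<lambda>w. h (g w)) =
    map_prod h h ` hecke_clifford_relations A T n u v x y c g"
    and "hecke_clifford_relations A T n u v x y c g \<subseteq> carrier A \<times> carrier A"
proof -
  interpret hc_family A T n x y c g by fact
  interpret B: complex_algebra B by fact
  have A: "complex_algebra A" ..
  note S = complex_space_axioms' B.complex_space_axioms' algebra_homD(1)[OF h]
  note lin = linear_mapD[OF algebra_homD(1)[OF h]] linear_map_minus[OF S] linear_map_diff[OF S]
  note hom = algebra_homD(2,3)[OF h] lin linear_map_finsum[OF S]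
  note cl = x_closed y_closed c_closed g_closed g_inv_closed g_refl_closed g_tau_closed
    m_closed a_closed a_inv_closed minus_closed smult_closed one_closed finsum_closed signed_closed weyl_image
  have conj: "conjugation_relations B T n (\<lambda>w. h (g w)) (\<lambda>i. h (z i)) =
      map_prod h h ` conjugation_relations A T n g z"
    and conjc: "conjugation_relations A T n g z \<subseteq> carrier A \<times> carrier A"
    if z: "\<And>i. i \<in> {1..n} \<Longrightarrow> z i \<in> carrier A" for z
  proof -
    have sg: "h (signed A z (w (int i))) = signed B (\<lambda>i. h (z i)) (w (int i))"
      and sgc: "signed A z (w (int i)) \<in> carrier A"
      if "w \<in> carrier (weyl_group T n)" "i \<in> {1..n}" for w i
      using signed_hom[OF A B h z weyl_image[OF that]] signed_closed[OF z weyl_image[OF that]] by simp_all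
    show "conjugation_relations B T n (\<lambda>w. h (g w)) (\<lambda>i. h (z i)) =
        map_prod h h ` conjugation_relations A T n g z"
      unfolding conjugation_relations_def
      by (rule image_pairs2) (auto simp: hom cl z sg)
    show "conjugation_relations A T n g z \<subseteq> carrier A \<times> carrier A"
      unfolding conjugation_relations_def using z sgc by (auto simp: cl)
  qed
  have group: "group_relations B T n (\<lambda>w. h (g w)) = map_prod h h ` group_relations A T n g"
    unfolding group_relations_def image_Un
    by (intro arg_cong2[where f = "(\<union>)"] image_pairs2) (auto simp: hom cl)
  have groupc: "group_relations A T n g \<subseteq> carrier A \<times> carrier A"
    unfolding group_relations_def by (auto intro!: cl id_weyl_group weyl_group_comp)
  have cliff: "clifford_relations B n (\<lambda>i. h (c i)) = map_prod h h ` clifford_relations A n c"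
    unfolding clifford_relations_def image_Un
    by (intro arg_cong2[where f = "(\<union>)"] image_pairs image_pairs2) (auto simp: hom cl)
  have cliffc: "clifford_relations A n c \<subseteq> carrier A \<times> carrier A"
    unfolding clifford_relations_def by (auto intro!: cl)
  have comm: "commutation_relations B n (\<lambda>i. h (x i)) (\<lambda>i. h (y i)) (\<lambda>i. h (c i)) =
      map_prod h h ` commutation_relations A n x y c"
    unfolding commutation_relations_def image_Un
    by (intro arg_cong2[where f = "(\<union>)"] image_pairs image_pairs2) (auto simp: hom cl)
  have commc: "commutation_relations A n x y c \<subseteq> carrier A \<times> carrier A"
    unfolding commutation_relations_def by (auto intro!: cl)
  have br: "bracket_relations B T n u v (\<lambda>i. h (x i)) (\<lambda>i. h (y i)) (\<lambda>i. h (c i)) (\<lambda>w. h (g w)) =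
      map_prod h h ` bracket_relations A T n u v x y c g"
  proof -
    have comm: "commutator B (h (y j)) (h (x i)) = h (commutator A (y j) (x i))"
      if "i \<in> {1..n}" "j \<in> {1..n}" for i j
      using that by (simp add: commutator_def hom cl)
    have closA: "(\<one>\<^bsub>A\<^esub> \<oplus>\<^bsub>A\<^esub> c k \<otimes>\<^bsub>A\<^esub> c i) \<otimes>\<^bsub>A\<^esub> g (s_refl k i) \<in> carrier A"
      and homA: "(\<one>\<^bsub>B\<^esub> \<oplus>\<^bsub>B\<^esub> h (c k) \<otimes>\<^bsub>B\<^esub> h (c i)) \<otimes>\<^bsub>B\<^esub> h (g (s_refl k i)) = h ((\<one>\<^bsub>A\<^esub> \<oplus>\<^bsub>A\<^esub> c k \<otimes>\<^bsub>A\<^esub> c i) \<otimes>\<^bsub>A\<^esub> g (s_refl k i))"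
      if "i \<in> {1..n}" "k \<in> {1..n} - {i}" for i k
      using that by (simp_all add: cl hom)
    have sumA: "(\<Oplus>\<^bsub>B\<^esub>k\<in>{Suc 0..n} - {i}. (\<one>\<^bsub>B\<^esub> \<oplus>\<^bsub>B\<^esub> h (c k) \<otimes>\<^bsub>B\<^esub> h (c i)) \<otimes>\<^bsub>B\<^esub> h (g (s_refl k i))) =
        h (\<Oplus>\<^bsub>A\<^esub>k\<in>{Suc 0..n} - {i}. (\<one>\<^bsub>A\<^esub> \<oplus>\<^bsub>A\<^esub> c k \<otimes>\<^bsub>A\<^esub> c i) \<otimes>\<^bsub>A\<^esub> g (s_refl k i))"
      and sumAc: "(\<Oplus>\<^bsub>A\<^esub>k\<in>{Suc 0..n} - {i}. (\<one>\<^bsub>A\<^esub> \<oplus>\<^bsub>A\<^esub> c k \<otimes>\<^bsub>A\<^esub> c i) \<otimes>\<^bsub>A\<^esub> g (s_refl k i)) \<in> carrier A"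
      if "Suc 0 \<le> i \<and> i \<le> n" for i
    proof -
      note i = that
      have k: "i \<in> {1..n}" "k \<in> {1..n} - {i}" if "k \<in> {Suc 0..n} - {i}" for k
        using that \<open>Suc 0 \<le> i \<and> i \<le> n\<close> by auto
      have P: "(\<lambda>k. (\<one>\<^bsub>A\<^esub> \<oplus>\<^bsub>A\<^esub> c k \<otimes>\<^bsub>A\<^esub> c i) \<otimes>\<^bsub>A\<^esub> g (s_refl k i)) \<in> {Suc 0..n} - {i} \<rightarrow> carrier A"
        by (rule funcsetI) (rule closA[OF k]; (assumption | rule i))
      then show "(\<Oplus>\<^bsub>A\<^esub>k\<in>{Suc 0..n} - {i}. (\<one>\<^bsub>A\<^esub> \<oplus>\<^bsub>A\<^esub> c k \<otimes>\<^bsub>A\<^esub> c i) \<otimes>\<^bsub>A\<^esub> g (s_refl k i)) \<in> carrier A"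
        by (rule finsum_closed)
      have "(\<Oplus>\<^bsub>B\<^esub>k\<in>{Suc 0..n} - {i}. (\<one>\<^bsub>B\<^esub> \<oplus>\<^bsub>B\<^esub> h (c k) \<otimes>\<^bsub>B\<^esub> h (c i)) \<otimes>\<^bsub>B\<^esub> h (g (s_refl k i))) = (\<Oplus>\<^bsub>B\<^esub>k\<in>{Suc 0..n} - {i}. h ((\<one>\<^bsub>A\<^esub> \<oplus>\<^bsub>A\<^esub> c k \<otimes>\<^bsub>A\<^esub> c i) \<otimes>\<^bsub>A\<^esub> g (s_refl k i)))"
      proof (rule B.finsum_cong'[OF refl])
        show "(\<lambda>k. h ((\<one>\<^bsub>A\<^esub> \<oplus>\<^bsub>A\<^esub> c k \<otimes>\<^bsub>A\<^esub> c i) \<otimes>\<^bsub>A\<^esub> g (s_refl k i))) \<in> {Suc 0..n} - {i} \<rightarrow> carrier B"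
          by (rule funcsetI) (rule lin(1)[OF closA[OF k]]; (assumption | rule i))
      qed (rule homA[OF k]; (assumption | rule i))
      then show "(\<Oplus>\<^bsub>B\<^esub>k\<in>{Suc 0..n} - {i}. (\<one>\<^bsub>B\<^esub> \<oplus>\<^bsub>B\<^esub> h (c k) \<otimes>\<^bsub>B\<^esub> h (c i)) \<otimes>\<^bsub>B\<^esub> h (g (s_refl k i))) = h (\<Oplus>\<^bsub>A\<^esub>k\<in>{Suc 0..n} - {i}. (\<one>\<^bsub>A\<^esub> \<oplus>\<^bsub>A\<^esub> c k \<otimes>\<^bsub>A\<^esub> c i) \<otimes>\<^bsub>A\<^esub> g (s_refl k i))"
        by (simp only: linear_map_finsum[OF S finite_Diff[OF finite_atLeastAtMost] P])
    qed
    have closB: "(\<one>\<^bsub>A\<^esub> \<oplus>\<^bsub>A\<^esub> c k \<otimes>\<^bsub>A\<^esub> c i) \<otimes>\<^bsub>A\<^esub> g (s_refl k i) \<oplus>\<^bsub>A\<^esub> (\<one>\<^bsub>A\<^esub> \<ominus>\<^bsub>A\<^esub> c k \<otimes>\<^bsub>A\<^esub> c i) \<otimes>\<^bsub>A\<^esub> g (sbar_refl k i) \<in> carrier A"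
      and homB: "(\<one>\<^bsub>B\<^esub> \<oplus>\<^bsub>B\<^esub> h (c k) \<otimes>\<^bsub>B\<^esub> h (c i)) \<otimes>\<^bsub>B\<^esub> h (g (s_refl k i)) \<oplus>\<^bsub>B\<^esub> (\<one>\<^bsub>B\<^esub> \<ominus>\<^bsub>B\<^esub> h (c k) \<otimes>\<^bsub>B\<^esub> h (c i)) \<otimes>\<^bsub>B\<^esub> h (g (sbar_refl k i)) = h ((\<one>\<^bsub>A\<^esub> \<oplus>\<^bsub>A\<^esub> c k \<otimes>\<^bsub>A\<^esub> c i) \<otimes>\<^bsub>A\<^esub> g (s_refl k i) \<oplus>\<^bsub>A\<^esub> (\<one>\<^bsub>A\<^esub> \<ominus>\<^bsub>A\<^esub> c k \<otimes>\<^bsub>A\<^esub> c i) \<otimes>\<^bsub>A\<^esub> g (sbar_refl k i))"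
      if "i \<in> {1..n}" "k \<in> {1..n} - {i}" "T \<noteq> TypeA" for i k
      using that by (simp_all add: cl hom)
    have sumB: "(\<Oplus>\<^bsub>B\<^esub>k\<in>{Suc 0..n} - {i}. (\<one>\<^bsub>B\<^esub> \<oplus>\<^bsub>B\<^esub> h (c k) \<otimes>\<^bsub>B\<^esub> h (c i)) \<otimes>\<^bsub>B\<^esub> h (g (s_refl k i)) \<oplus>\<^bsub>B\<^esub> (\<one>\<^bsub>B\<^esub> \<ominus>\<^bsub>B\<^esub> h (c k) \<otimes>\<^bsub>B\<^esub> h (c i)) \<otimes>\<^bsub>B\<^esub> h (g (sbar_refl k i))) =
        h (\<Oplus>\<^bsub>A\<^esub>k\<in>{Suc 0..n} - {i}. (\<one>\<^bsub>A\<^esub> \<oplus>\<^bsub>A\<^esub> c k \<otimes>\<^bsub>A\<^esub> c i) \<otimes>\<^bsub>A\<^esub> g (s_refl k i) \<oplus>\<^bsub>A\<^esub> (\<one>\<^bsub>A\<^esub> \<ominus>\<^bsub>A\<^esub> c k \<otimes>\<^bsub>A\<^esub> c i) \<otimes>\<^bsub>A\<^esub> g (sbar_refl k i))"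
      and sumBc: "(\<Oplus>\<^bsub>A\<^esub>k\<in>{Suc 0..n} - {i}. (\<one>\<^bsub>A\<^esub> \<oplus>\<^bsub>A\<^esub> c k \<otimes>\<^bsub>A\<^esub> c i) \<otimes>\<^bsub>A\<^esub> g (s_refl k i) \<oplus>\<^bsub>A\<^esub> (\<one>\<^bsub>A\<^esub> \<ominus>\<^bsub>A\<^esub> c k \<otimes>\<^bsub>A\<^esub> c i) \<otimes>\<^bsub>A\<^esub> g (sbar_refl k i)) \<in> carrier A"
      if "Suc 0 \<le> i \<and> i \<le> n" "T \<noteq> TypeA" for i
    proof -
      note i = that
      have k: "i \<in> {1..n}" "k \<in> {1..n} - {i}" if "k \<in> {Suc 0..n} - {i}" for k
        using that \<open>Suc 0 \<le> i \<and> i \<le> n\<close> by auto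
      have P: "(\<lambda>k. (\<one>\<^bsub>A\<^esub> \<oplus>\<^bsub>A\<^esub> c k \<otimes>\<^bsub>A\<^esub> c i) \<otimes>\<^bsub>A\<^esub> g (s_refl k i) \<oplus>\<^bsub>A\<^esub> (\<one>\<^bsub>A\<^esub> \<ominus>\<^bsub>A\<^esub> c k \<otimes>\<^bsub>A\<^esub> c i) \<otimes>\<^bsub>A\<^esub> g (sbar_refl k i)) \<in> {Suc 0..n} - {i} \<rightarrow> carrier A"
        by (rule funcsetI) (rule closB[OF k]; (assumption | rule i))
      then show "(\<Oplus>\<^bsub>A\<^esub>k\<in>{Suc 0..n} - {i}. (\<one>\<^bsub>A\<^esub> \<oplus>\<^bsub>A\<^esub> c k \<otimes>\<^bsub>A\<^esub> c i) \<otimes>\<^bsub>A\<^esub> g (s_refl k i) \<oplus>\<^bsub>A\<^esub> (\<one>\<^bsub>A\<^esub> \<ominus>\<^bsub>A\<^esub> c k \<otimes>\<^bsub>A\<^esub> c i) \<otimes>\<^bsub>A\<^esub> g (sbar_refl k i)) \<in> carrier A"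
        by (rule finsum_closed)
      have "(\<Oplus>\<^bsub>B\<^esub>k\<in>{Suc 0..n} - {i}. (\<one>\<^bsub>B\<^esub> \<oplus>\<^bsub>B\<^esub> h (c k) \<otimes>\<^bsub>B\<^esub> h (c i)) \<otimes>\<^bsub>B\<^esub> h (g (s_refl k i)) \<oplus>\<^bsub>B\<^esub> (\<one>\<^bsub>B\<^esub> \<ominus>\<^bsub>B\<^esub> h (c k) \<otimes>\<^bsub>B\<^esub> h (c i)) \<otimes>\<^bsub>B\<^esub> h (g (sbar_refl k i))) = (\<Oplus>\<^bsub>B\<^esub>k\<in>{Suc 0..n} - {i}. h ((\<one>\<^bsub>A\<^esub> \<oplus>\<^bsub>A\<^esub> c k \<otimes>\<^bsub>A\<^esub> c i) \<otimes>\<^bsub>A\<^esub> g (s_refl k i) \<oplus>\<^bsub>A\<^esub> (\<one>\<^bsub>A\<^esub> \<ominus>\<^bsub>A\<^esub> c k \<otimes>\<^bsub>A\<^esub> c i) \<otimes>\<^bsub>A\<^esub> g (sbar_refl k i)))"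
      proof (rule B.finsum_cong'[OF refl])
        show "(\<lambda>k. h ((\<one>\<^bsub>A\<^esub> \<oplus>\<^bsub>A\<^esub> c k \<otimes>\<^bsub>A\<^esub> c i) \<otimes>\<^bsub>A\<^esub> g (s_refl k i) \<oplus>\<^bsub>A\<^esub> (\<one>\<^bsub>A\<^esub> \<ominus>\<^bsub>A\<^esub> c k \<otimes>\<^bsub>A\<^esub> c i) \<otimes>\<^bsub>A\<^esub> g (sbar_refl k i))) \<in> {Suc 0..n} - {i} \<rightarrow> carrier B"
          by (rule funcsetI) (rule lin(1)[OF closB[OF k]]; (assumption | rule i))
      qed (rule homB[OF k]; (assumption | rule i))
      then show "(\<Oplus>\<^bsub>B\<^esub>k\<in>{Suc 0..n} - {i}. (\<one>\<^bsub>B\<^esub> \<oplus>\<^bsub>B\<^esub> h (c k) \<otimes>\<^bsub>B\<^esub> h (c i)) \<otimes>\<^bsub>B\<^esub> h (g (s_refl k i)) \<oplus>\<^bsub>B\<^esub> (\<one>\<^bsub>B\<^esub> \<ominus>\<^bsub>B\<^esub> h (c k) \<otimes>\<^bsub>B\<^esub> h (c i)) \<otimes>\<^bsub>B\<^esub> h (g (sbar_refl k i))) = h (\<Oplus>\<^bsub>A\<^esub>k\<in>{Suc 0..n} - {i}. (\<one>\<^bsub>A\<^esub> \<oplus>\<^bsub>A\<^esub> c k \<otimes>\<^bsub>A\<^esub> c i) \<otimes>\<^bsub>A\<^esub> g (s_refl k i) \<oplus>\<^bsub>A\<^esub> (\<one>\<^bsub>A\<^esub> \<ominus>\<^bsub>A\<^esub>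 c k \<otimes>\<^bsub>A\<^esub> c i) \<otimes>\<^bsub>A\<^esub> g (sbar_refl k i))"
        by (simp only: linear_map_finsum[OF S finite_Diff[OF finite_atLeastAtMost] P])
    qed
    note hom' = algebra_homD(2,3)[OF h] lin
    show ?thesis
    proof (cases T)
      case TypeA
      then show ?thesis
        unfolding bracket_relations_def Let_def image_Un
        by (intro arg_cong2[where f = "(\<union>)"] image_pairs image_pairs2)
          (auto simp: comm hom' cl sumA sumB sumAc sumBc simp del: B.finsum_addf finsum_addf)
    next
      case TypeB
      then show ?thesis
        unfolding bracket_relations_def Let_def image_Un
        by (intro arg_cong2[where f = "(\<union>)"] image_pairs image_pairs2)
          (auto simp: comm hom' cl sumA sumB sumAc sumBc simp del: B.finsum_addf finsum_addf)
    next
      case TypeD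
      then show ?thesis
        unfolding bracket_relations_def Let_def image_Un
        by (intro arg_cong2[where f = "(\<union>)"] image_pairs image_pairs2)
          (auto simp: comm hom' cl sumA sumB sumAc sumBc simp del: B.finsum_addf finsum_addf)
    qed
  qed
  have brc: "bracket_relations A T n u v x y c g \<subseteq> carrier A \<times> carrier A"
    unfolding bracket_relations_def Let_def
    by (cases T) (auto simp: commutator_def cl Pi_def intro!: finsum_closed)
  show "hecke_clifford_relations B T n u v (\<lambda>i. h (x i)) (\<lambda>i. h (y i)) (\<lambda>i. h (c i)) (\<lambda>w. h (g w)) =
    map_prod h h ` hecke_clifford_relations A T n u v x y c g"
    unfolding hecke_clifford_relations_def image_Un
    by (simp only: group cliff comm br conj[OF x_closed] conj[OF y_closed] conj[OF c_closed])
  show "hecke_clifford_relations A T n u v x y c g \<subseteq> carrier A \<times> carrier A"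
    unfolding hecke_clifford_relations_def
    by (intro Un_least groupc cliffc commc brc conjc x_closed y_closed c_closed)
qed

section \<open>The spanning set\<close>

context complex_algebra begin

lemma complex_subspace_stable:
  assumes S: "S \<subseteq> carrier A" and a: "a \<in> carrier A" and N: "complex_subspace A N"
    and stable: "\<And>s. s \<in> S \<Longrightarrow> a \<otimes> s \<in> N" and h: "h \<in> linear_span A S"
  shows "a \<otimes> h \<in> N"
proof -
  have "complex_subspace A {h \<in> carrier A. a \<otimes> h \<in> N}"
    by (rule complex_subspace_preimage[OF complex_space_axioms' complex_space_axioms' linear_map_mult_left[OF a] N])
  then have "linear_span A S \<subseteq> {h \<in> carrier A. a \<otimes> h \<in> N}"
    by (rule linear_span_least[OF complex_space_axioms']) (use S stable in auto)
  then show ?thesis using h by blast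
qed

text \<open>Arbitrary lists of indices make the ordered product accessible to induction on its first
  factor.\<close>

definition partial_monomial :: "(nat \<Rightarrow> 'a) \<Rightarrow> (nat \<Rightarrow> nat) \<Rightarrow> nat list \<Rightarrow> 'a" where
  "partial_monomial z \<alpha> l = foldr (\<lambda>i a. z i [^] \<alpha> i \<otimes> a) l \<one>"

lemma ordered_monomial_eq: "ordered_monomial A n z \<alpha> = partial_monomial z \<alpha> [1..<Suc n]"
  by (simp add: ordered_monomial_def partial_monomial_def)

lemma partial_monomial_closed:
  "(\<And>i. i \<in> set l \<Longrightarrow> z i \<in> carrier A) \<Longrightarrow> partial_monomial z \<alpha> l \<in> carrier A"
  by (induction l) (auto simp: partial_monomial_def)

lemma partial_monomial_mem:
  assumes "\<And>i. i \<in> set l \<Longrightarrow> z i \<in> carrier A" and Q: "Q \<subseteq> carrier A" "m \<in> Q"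
    and step: "\<And>i h. i \<in> set l \<Longrightarrow> h \<in> Q \<Longrightarrow> z i \<otimes> h \<in> Q"
  shows "partial_monomial z \<alpha> l \<otimes> m \<in> Q"
  using assms(1) step
proof (induction l)
  case Nil
  then show ?case using Q by (auto simp: partial_monomial_def)
next
  case (Cons i l)
  have z: "z i \<in> carrier A" using Cons.prems by simp
  have IH: "partial_monomial z \<alpha> l \<otimes> m \<in> Q" using Cons by simp
  have "z i [^] k \<otimes> h \<in> Q" if "h \<in> Q" for k :: nat and h
  proof (induction k)
    case 0
    then show ?case using that Q by auto
  next
    case (Suc k)
    have "z i [^] Suc k \<otimes> h = z i \<otimes> (z i [^] k \<otimes> h)"
      using z that Q by (simp only: nat_pow_Suc2 nat_pow_closed m_assoc subsetD)
    then show ?case using Suc Cons.prems(2)[of i] by simp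
  qed
  from this[OF IH] show ?case
    using z Q partial_monomial_closed[of l z \<alpha>] Cons.prems(1)
    by (simp add: partial_monomial_def m_assoc subsetD)
qed

text \<open>The scalar s covers commuting generators (s = 1) and Clifford generators (s = -1); the
  exponent k covers both raising \<alpha> i by one and c_i c_i = 1. For spans only the existence of
  the resulting scalar matters, so no signs are recorded in the conclusion.\<close>

lemma mult_partial_monomial:
  assumes z: "\<And>j. j \<in> set l \<Longrightarrow> z j \<in> carrier A" and i: "i \<in> set l" "distinct l"
    and comm: "\<And>j. j \<in> set l \<Longrightarrow> j \<noteq> i \<Longrightarrow> z i \<otimes> z j = s \<odot> (z j \<otimes> z i)"
    and step: "z i \<otimes> z i [^] \<alpha> i = z i [^] (k :: nat)"
  shows "\<exists>s. z i \<otimes> partial_monomial z \<alpha> l = s \<odot> partial_monomial z (\<alpha>(i := k)) l"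
  using z i comm
proof (induction l)
  case (Cons j l)
  have zi: "z i \<in> carrier A" and zj: "z j \<in> carrier A" using Cons.prems by auto
  have c: "partial_monomial z \<beta> l \<in> carrier A" for \<beta>
    using Cons.prems(1) by (intro partial_monomial_closed) auto
  show ?case
  proof (cases "j = i")
    case True
    have "partial_monomial z (\<alpha>(i := k)) l = partial_monomial z \<alpha> l"
      using Cons.prems True unfolding partial_monomial_def by (intro foldr_cong) auto
    then have "z i \<otimes> partial_monomial z \<alpha> (j # l) = 1 \<odot> partial_monomial z (\<alpha>(i := k)) (j # l)"
      using True zi c[of \<alpha>] step unfolding partial_monomial_def by (simp add: m_assoc[symmetric])
    then show ?thesis by blast
  next
    case False
    have "\<exists>t. z i \<otimes> partial_monomial z \<alpha> l = t \<odot> partial_monomial z (\<alpha>(i := k)) l"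
      by (rule Cons.IH) (use Cons.prems False in auto)
    then obtain t where t: "z i \<otimes> partial_monomial z \<alpha> l = t \<odot> partial_monomial z (\<alpha>(i := k)) l" by blast
    have pow: "\<exists>t. z i \<otimes> z j [^] (m::nat) = t \<odot> (z j [^] m \<otimes> z i)" for m
    proof (induction m)
      case 0
      have "z i \<otimes> z j [^] (0::nat) = 1 \<odot> (z j [^] (0::nat) \<otimes> z i)" using zi by simp
      then show ?case by blast
    next
      case (Suc m)
      then obtain t where t: "z i \<otimes> z j [^] m = t \<odot> (z j [^] m \<otimes> z i)" by blast
      have "z i \<otimes> z j [^] Suc m = (z i \<otimes> z j [^] m) \<otimes> z j" using zi zj by (simp add: m_assoc)
      also have "\<dots> = t \<odot> (z j [^] m \<otimes> (z i \<otimes> z j))" using zi zj by (simp add: t smult_assoc2 m_assoc)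
      also have "\<dots> = (t * s) \<odot> (z j [^] Suc m \<otimes> z i)"
        using zi zj False Cons.prems(4)[of j] by (simp add: smult_assoc1 smult_assoc3 m_assoc)
      finally show ?case by blast
    qed
    obtain t' where t': "z i \<otimes> z j [^] \<alpha> j = t' \<odot> (z j [^] \<alpha> j \<otimes> z i)" using pow by blast
    have pj: "z j [^] \<alpha> j \<in> carrier A" using zj by simp
    have "z i \<otimes> partial_monomial z \<alpha> (j # l) = (z i \<otimes> z j [^] \<alpha> j) \<otimes> partial_monomial z \<alpha> l"
      using zi pj c[of \<alpha>] by (simp add: partial_monomial_def m_assoc)
    also have "\<dots> = t' \<odot> (z j [^] \<alpha> j \<otimes> (z i \<otimes> partial_monomial z \<alpha> l))"
      using zi pj c[of \<alpha>] by (simp add: t' smult_assoc2 m_assoc)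
    also have "\<dots> = (t' * t) \<odot> (z j [^] \<alpha> j \<otimes> partial_monomial z (\<alpha>(i := k)) l)"
      using pj c[of "\<alpha>(i := k)"] by (simp add: t smult_assoc1 smult_assoc3)
    also have "z j [^] \<alpha> j \<otimes> partial_monomial z (\<alpha>(i := k)) l = partial_monomial z (\<alpha>(i := k)) (j # l)"
      using False by (simp add: partial_monomial_def)
    finally show ?thesis by blast
  qed
qed simp

definition monomials :: "nat \<Rightarrow> (nat \<Rightarrow> 'a) \<Rightarrow> nat set \<Rightarrow> 'a set \<Rightarrow> 'a set" where
  "monomials n z R S = {ordered_monomial A n z \<alpha> \<otimes> m | \<alpha> m. \<alpha> \<in> {1..n} \<rightarrow>\<^sub>E R \<and> m \<in> S}"

lemma monomials_subset:
  assumes "\<And>i. i \<in> {1..n} \<Longrightarrow> z i \<in> carrier A" "S \<subseteq> carrier A"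
  shows "monomials n z R S \<subseteq> carrier A"
proof
  fix a assume "a \<in> monomials n z R S"
  then obtain \<alpha> m where "a = ordered_monomial A n z \<alpha> \<otimes> m" "m \<in> S" unfolding monomials_def by blast
  moreover have "ordered_monomial A n z \<alpha> \<in> carrier A"
    unfolding ordered_monomial_eq by (rule partial_monomial_closed) (use assms in auto)
  ultimately show "a \<in> carrier A" using assms by auto
qed

lemma subset_monomials:
  assumes "S \<subseteq> carrier A" "0 \<in> R"
  shows "S \<subseteq> monomials n z R S"
proof
  fix m assume m: "m \<in> S"
  define \<alpha> where "\<alpha> = (\<lambda>i\<in>{1..n}. 0::nat)"
  have "partial_monomial z \<alpha> l = \<one>" if "set l \<subseteq> {1..n}" for l
    using that by (induction l) (auto simp: partial_monomial_def \<alpha>_def)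
  from this[of "[1..<Suc n]"] have "ordered_monomial A n z \<alpha> = \<one>"
    unfolding ordered_monomial_eq by (simp del: upt_Suc add: atLeastLessThanSuc_atLeastAtMost)
  then have "m = ordered_monomial A n z \<alpha> \<otimes> m" using m assms by auto
  moreover have "\<alpha> \<in> {1..n} \<rightarrow>\<^sub>E R" using assms by (auto simp: \<alpha>_def)
  ultimately show "m \<in> monomials n z R S" using m unfolding monomials_def by blast
qed

lemma mult_monomials:
  assumes z: "\<And>j. j \<in> {1..n} \<Longrightarrow> z j \<in> carrier A" and S: "S \<subseteq> carrier A" and i: "i \<in> {1..n}"
    and comm: "\<And>j. j \<in> {1..n} \<Longrightarrow> j \<noteq> i \<Longrightarrow> z i \<otimes> z j = s \<odot> (z j \<otimes> z i)"
    and step: "\<And>k. k \<in> R \<Longrightarrow> \<exists>k'\<in>R. z i \<otimes> z i [^] k = z i [^] (k' :: nat)"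
    and h: "h \<in> linear_span A (monomials n z R S)"
  shows "z i \<otimes> h \<in> linear_span A (monomials n z R S)"
proof (rule complex_subspace_stable[OF monomials_subset[OF z S] z[OF i] _ _ h])
  show L: "complex_subspace A (linear_span A (monomials n z R S))"
    by (rule complex_subspace_linear_span[OF complex_space_axioms' monomials_subset[OF z S]])
  fix a assume "a \<in> monomials n z R S"
  then obtain \<alpha> m where a: "a = ordered_monomial A n z \<alpha> \<otimes> m" "m \<in> S" "\<alpha> \<in> {1..n} \<rightarrow>\<^sub>E R"
    unfolding monomials_def by blast
  obtain k where k: "k \<in> R" "z i \<otimes> z i [^] \<alpha> i = z i [^] k"
    using step[of "\<alpha> i"] a(3) i by (meson PiE_mem)
  obtain t where t: "z i \<otimes> ordered_monomial A n z \<alpha> = t \<odot> ordered_monomial A n z (\<alpha>(i := k))"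
    using mult_partial_monomial[of "[1..<Suc n]" z i s \<alpha> k] z i comm k(2)
    unfolding ordered_monomial_eq by (auto simp del: upt_Suc)
  have c: "ordered_monomial A n z \<beta> \<in> carrier A" for \<beta>
    unfolding ordered_monomial_eq by (rule partial_monomial_closed) (use z in auto)
  have "z i \<otimes> a = t \<odot> (ordered_monomial A n z (\<alpha>(i := k)) \<otimes> m)"
    using a(1,2) S z[OF i] c by (simp add: m_assoc[symmetric] t smult_assoc2 subsetD)
  moreover have "\<alpha>(i := k) \<in> {1..n} \<rightarrow>\<^sub>E R"
    using a(3) k(1) i by (auto simp: PiE_iff extensional_def)
  then have "ordered_monomial A n z (\<alpha>(i := k)) \<otimes> m \<in> linear_span A (monomials n z R S)"
    using a(2) linear_span_superset[of "monomials n z R S" A] unfolding monomials_def by blast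
  ultimately show "z i \<otimes> a \<in> linear_span A (monomials n z R S)"
    using complex_subspaceD(4)[OF L] by simp
qed

text \<open>Here a is a generator of another kind, pushed through the monomial one letter at a time.
  The rule \<open>step\<close> for passing one letter may change a or create further terms, as long
  as the result remains in L; this covers signs, the action of W and the brackets alike.\<close>

lemma mult_monomials_stable:
  assumes z: "\<And>j. j \<in> {1..n} \<Longrightarrow> z j \<in> carrier A" and S: "S \<subseteq> carrier A" and a: "a \<in> carrier A"
    and L: "complex_subspace A L" "S \<subseteq> L" "\<And>j h. j \<in> {1..n} \<Longrightarrow> h \<in> L \<Longrightarrow> z j \<otimes> h \<in> L"
    and base: "\<And>m. m \<in> S \<Longrightarrow> a \<otimes> m \<in> L"
    and step: "\<And>j h. j \<in> {1..n} \<Longrightarrow> h \<in> L \<Longrightarrow> a \<otimes> h \<in> L \<Longrightarrow> a \<otimes> (z j \<otimes> h) \<in> L"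
    and h: "h \<in> linear_span A (monomials n z R S)"
  shows "a \<otimes> h \<in> L"
proof (rule complex_subspace_stable[OF monomials_subset[OF z S] a L(1) _ h])
  fix b assume "b \<in> monomials n z R S"
  then obtain \<alpha> m where b: "b = partial_monomial z \<alpha> [1..<Suc n] \<otimes> m" "m \<in> S"
    unfolding monomials_def ordered_monomial_eq by blast
  have "partial_monomial z \<alpha> [1..<Suc n] \<otimes> m \<in> {h \<in> L. a \<otimes> h \<in> L}"
  proof (rule partial_monomial_mem)
    show "{h \<in> L. a \<otimes> h \<in> L} \<subseteq> carrier A" using complex_subspaceD(1)[OF L(1)] by blast
    show "m \<in> {h \<in> L. a \<otimes> h \<in> L}" using b(2) L(2) base by blast
  qed (use z L(3) step in \<open>auto simp del: upt_Suc\<close>)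
  then show "a \<otimes> b \<in> L" using b(1) by blast
qed

end

locale hc_algebra = hc_family A T n x y c g
  for A :: "(complex, 'a) module" (structure) and T n x y c g +
  fixes u v :: complex
  assumes relation: "(l, r) \<in> hecke_clifford_relations A T n u v x y c g \<Longrightarrow> l = r"
begin

lemma group_relation:
  "g id = \<one>" "w \<in> carrier (weyl_group T n) \<Longrightarrow> w' \<in> carrier (weyl_group T n) \<Longrightarrow> g w \<otimes> g w' = g (w \<circ> w')"
  by (rule relation; force simp: hecke_clifford_relations_def group_relations_def)+

lemma clifford_relation:
  "i \<in> {1..n} \<Longrightarrow> c i \<otimes> c i = \<one>"
  "i \<in> {1..n} \<Longrightarrow> j \<in> {1..n} \<Longrightarrow> i \<noteq> j \<Longrightarrow> c i \<otimes> c j = \<ominus> (c j \<otimes> c i)"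
  by (rule relation; force simp: hecke_clifford_relations_def clifford_relations_def)+

lemma commutation_relation:
  "i \<in> {1..n} \<Longrightarrow> j \<in> {1..n} \<Longrightarrow> x i \<otimes> x j = x j \<otimes> x i"
  "i \<in> {1..n} \<Longrightarrow> j \<in> {1..n} \<Longrightarrow> y i \<otimes> y j = y j \<otimes> y i"
  "i \<in> {1..n} \<Longrightarrow> j \<in> {1..n} \<Longrightarrow> y i \<otimes> c j = c j \<otimes> y i"
  "i \<in> {1..n} \<Longrightarrow> x i \<otimes> c i = \<ominus> (c i \<otimes> x i)"
  "i \<in> {1..n} \<Longrightarrow> j \<in> {1..n} \<Longrightarrow> i \<noteq> j \<Longrightarrow> x i \<otimes> c j = c j \<otimes> x i"
  by (rule relation, unfold hecke_clifford_relations_def commutation_relations_def, blast)+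

lemma conjugation_relation:
  assumes "w \<in> carrier (weyl_group T n)" "i \<in> {1..n}"
  shows "g w \<otimes> x i \<otimes> g (inv\<^bsub>weyl_group T n\<^esub> w) = signed A x (w (int i))"
    "g w \<otimes> y i \<otimes> g (inv\<^bsub>weyl_group T n\<^esub> w) = signed A y (w (int i))"
    "g w \<otimes> c i \<otimes> g (inv\<^bsub>weyl_group T n\<^esub> w) = signed A c (w (int i))"
  by (rule relation, unfold hecke_clifford_relations_def conjugation_relations_def, use assms in blast)+

lemma intertwine:
  assumes w: "w \<in> carrier (weyl_group T n)" and i: "i \<in> {1..n}" and z: "z i \<in> carrier A"
    and conj: "g w \<otimes> z i \<otimes> g (inv\<^bsub>weyl_group T n\<^esub> w) = signed A z (w (int i))"
  shows "g w \<otimes> z i = signed A z (w (int i)) \<otimes> g w"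
proof -
  have "g (inv\<^bsub>weyl_group T n\<^esub> w) \<otimes> g w = \<one>"
    using w group_relation weyl_group_inv_into[OF w] by (simp add: weyl_group_inv)
  then have "g w \<otimes> z i = g w \<otimes> z i \<otimes> (g (inv\<^bsub>weyl_group T n\<^esub> w) \<otimes> g w)"
    using z g_closed[OF w] by simp
  also have "\<dots> = g w \<otimes> z i \<otimes> g (inv\<^bsub>weyl_group T n\<^esub> w) \<otimes> g w"
    using z g_closed[OF w] g_inv_closed[OF w] by (simp add: m_assoc)
  finally show ?thesis by (simp only: conj)
qed

lemma g_x: "w \<in> carrier (weyl_group T n) \<Longrightarrow> i \<in> {1..n} \<Longrightarrow> g w \<otimes> x i = signed A x (w (int i)) \<otimes> g w"
  and g_c: "w \<in> carrier (weyl_group T n) \<Longrightarrow> i \<in> {1..n} \<Longrightarrow> g w \<otimes> c i = signed A c (w (int i)) \<otimes> g w"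
  by (intro intertwine conjugation_relation x_closed c_closed; assumption)+

text \<open>The y-monomial is the rightmost factor, so y has to move to the right of group elements,
  with the inverse acting on its index; x and c move to their left.\<close>

lemma y_g:
  assumes w: "w \<in> carrier (weyl_group T n)" and i: "i \<in> {1..n}"
  shows "y i \<otimes> g w = g w \<otimes> signed A y (inv_into UNIV w (int i))"
proof -
  let ?v = "inv_into UNIV w"
  note v = weyl_group_inv_into[OF w]
  have vv: "inv_into UNIV ?v = w"
    using signed_permutationsD(2)[OF weyl_group_signed[OF w]] by (rule inv_inv_eq)
  have vy: "signed A y (?v (int i)) = g ?v \<otimes> y i \<otimes> g w"
    using conjugation_relation(2)[OF v(1) i] by (simp add: weyl_group_inv[OF v(1)] vv)
  have "g w \<otimes> g ?v = \<one>" using group_relation(2)[OF w v(1)] group_relation(1) v(3) by simp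
  then have "y i \<otimes> g w = g w \<otimes> g ?v \<otimes> (y i \<otimes> g w)" using y_closed[OF i] g_closed[OF w] by simp
  also have "\<dots> = g w \<otimes> (g ?v \<otimes> y i \<otimes> g w)"
    using y_closed[OF i] g_closed[OF w] g_closed[OF v(1)] by (simp add: m_assoc)
  finally show ?thesis by (simp only: vy)
qed

text \<open>In every type the bracket lies in the subalgebra generated by the c_i and W. The set P
  of elements whose left multiplication preserves L is a subalgebra containing these
  generators.\<close>

lemma commutator_stable:
  assumes L: "complex_subspace A L" and c: "\<And>i h. i \<in> {1..n} \<Longrightarrow> h \<in> L \<Longrightarrow> c i \<otimes> h \<in> L"
    and g: "\<And>w h. w \<in> carrier (weyl_group T n) \<Longrightarrow> h \<in> L \<Longrightarrow> g w \<otimes> h \<in> L"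
    and ij: "i \<in> {1..n}" "j \<in> {1..n}" and h: "h \<in> L"
  shows "commutator A (y j) (x i) \<otimes> h \<in> L"
proof -
  note LD = complex_subspaceD[OF L]
  have neg: "\<ominus> a \<in> L" if "a \<in> L" for a using that LD by (metis smult_minus_one)
  define P where "P = {a \<in> carrier A. \<forall>h\<in>L. a \<otimes> h \<in> L}"
  have P: "\<one> \<in> P" "\<And>i. i \<in> {1..n} \<Longrightarrow> c i \<in> P" "\<And>w. w \<in> carrier (weyl_group T n) \<Longrightarrow> g w \<in> P"
    using LD(1) c g c_closed g_closed by (auto simp: P_def)
  have P_add: "a \<oplus> b \<in> P" and P_mult: "a \<otimes> b \<in> P" if "a \<in> P" "b \<in> P" for a b
    using that LD(1,3) by (auto simp: P_def l_distr m_assoc)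
  have P_smult: "r \<odot> a \<in> P" and P_neg: "\<ominus> a \<in> P" if "a \<in> P" for a r
    using that LD(1,4) neg by (auto simp: P_def smult_assoc2 l_minus)
  have P_minus: "a \<ominus> b \<in> P" if "a \<in> P" "b \<in> P" for a b
    using that P_add P_neg by (simp add: a_minus_def)
  have P_sum: "(\<Oplus>k\<in>K. f k) \<in> P" if "finite K" "\<And>k. k \<in> K \<Longrightarrow> f k \<in> P" for K :: "nat set" and f
    using that
  proof (induction K rule: finite_induct)
    case empty
    then show ?case using LD(1,2) by (simp add: P_def)
  next
    case (insert k K)
    then have "f \<in> K \<rightarrow> carrier A" "f k \<in> carrier A" by (auto simp: P_def)
    then show ?case using insert by (simp add: P_add)
  qed
  note P_intros = P P_add P_mult P_smult P_neg P_minus P_sum s_refl_closed sbar_refl_closed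
  have tau: "T = TypeB \<Longrightarrow> i \<in> {1..n} \<Longrightarrow> tau_refl i \<in> carrier (weyl_group T n)" for i
    using tau_refl_closed by simp
  have "commutator A (y j) (x i) \<in> P"
  proof (cases "i = j")
    case True
    have "\<exists>r\<in>P. (commutator A (y i) (x i), r) \<in> bracket_relations A T n u v x y c g"
    proof (cases T)
      case TypeA
      show ?thesis unfolding bracket_relations_def Let_def
        by (rule bexI, rule UnI2, rule CollectI, rule exI[of _ i])
          (use ij in \<open>auto simp: TypeA intro!: P_intros\<close>)
    next
      case TypeB
      show ?thesis unfolding bracket_relations_def Let_def
        by (rule bexI, rule UnI2, rule CollectI, rule exI[of _ i])
          (use ij tau in \<open>auto simp: TypeB simp del: finsum_addf intro!: P_intros\<close>)
    next
      case TypeD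
      show ?thesis unfolding bracket_relations_def Let_def
        by (rule bexI, rule UnI2, rule CollectI, rule exI[of _ i])
          (use ij in \<open>auto simp: TypeD simp del: finsum_addf intro!: P_intros\<close>)
    qed
    then show ?thesis using relation True unfolding hecke_clifford_relations_def by blast
  next
    case False
    have "\<exists>r\<in>P. (commutator A (y j) (x i), r) \<in> bracket_relations A T n u v x y c g"
      unfolding bracket_relations_def Let_def
      by (cases T; rule bexI, rule UnI1, rule CollectI, rule exI[of _ i], rule exI[of _ j])
        (use ij False in \<open>auto intro!: P_intros\<close>)
    then show ?thesis using relation unfolding hecke_clifford_relations_def by blast
  qed
  then show ?thesis using h by (simp add: P_def)
qed

text \<open>The normal form is built from the right: y, then w, c, x. The span at each stage
  contains the previous one and is stable under the kinds of generators used so far; each new kind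
  of factor only requires passing the old generators through it.\<close>

definition Y_basis where "Y_basis = monomials n y UNIV {\<one>}"
definition W_basis where "W_basis = {g w \<otimes> m | w m. w \<in> carrier (weyl_group T n) \<and> m \<in> Y_basis}"
definition C_basis where "C_basis = monomials n c {0, 1} W_basis"
definition X_basis where "X_basis = monomials n x UNIV C_basis"

lemma basis_subset:
  "Y_basis \<subseteq> carrier A" "W_basis \<subseteq> carrier A" "C_basis \<subseteq> carrier A" "X_basis \<subseteq> carrier A"
proof -
  show Y: "Y_basis \<subseteq> carrier A" unfolding Y_basis_def by (intro monomials_subset y_closed) auto
  show W: "W_basis \<subseteq> carrier A" unfolding W_basis_def using Y g_closed by auto
  show C: "C_basis \<subseteq> carrier A" unfolding C_basis_def by (intro monomials_subset c_closed W)
  show "X_basis \<subseteq> carrier A" unfolding X_basis_def by (intro monomials_subset x_closed C)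
qed

lemma basis_chain: "\<one> \<in> Y_basis" "Y_basis \<subseteq> W_basis" "W_basis \<subseteq> C_basis" "C_basis \<subseteq> X_basis"
proof -
  show "\<one> \<in> Y_basis" using subset_monomials[of "{\<one>}" UNIV n y] by (auto simp: Y_basis_def)
  show "Y_basis \<subseteq> W_basis"
  proof
    fix m assume m: "m \<in> Y_basis"
    then have "m = g id \<otimes> m" using basis_subset(1) by (auto simp: group_relation)
    then show "m \<in> W_basis" using m id_weyl_group unfolding W_basis_def by blast
  qed
  show "W_basis \<subseteq> C_basis" unfolding C_basis_def by (rule subset_monomials[OF basis_subset(2)]) simp
  show "C_basis \<subseteq> X_basis" unfolding X_basis_def by (rule subset_monomials[OF basis_subset(3)]) simp
qed

abbreviation "LY \<equiv> linear_span A Y_basis"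
abbreviation "LW \<equiv> linear_span A W_basis"
abbreviation "LC \<equiv> linear_span A C_basis"
abbreviation "LX \<equiv> linear_span A X_basis"

lemmas subspaces = basis_subset[THEN complex_subspace_linear_span[OF complex_space_axioms']]

lemma basis_spans:
  "Y_basis \<subseteq> LY" "W_basis \<subseteq> LW" "W_basis \<subseteq> LC" "C_basis \<subseteq> LC" "C_basis \<subseteq> LX"
  using basis_chain linear_span_superset by (meson order_trans)+

lemma signed_stable:
  assumes L: "complex_subspace A L" and z: "\<And>j. j \<in> {1..n} \<Longrightarrow> z j \<in> carrier A"
    "\<And>j h. j \<in> {1..n} \<Longrightarrow> h \<in> L \<Longrightarrow> z j \<otimes> h \<in> L" and k: "k \<noteq> 0" "\<bar>k\<bar> \<le> int n" and h: "h \<in> L"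
  shows "signed A z k \<otimes> h \<in> L"
proof (cases "k < 0")
  case True
  then have j: "nat (- k) \<in> {1..n}" using k by auto
  have "\<ominus> (z (nat (- k)) \<otimes> h) \<in> L"
    using z(2)[OF j h] complex_subspaceD(1,4)[OF L] by (metis smult_minus_one)
  then show ?thesis using True z(1)[OF j] complex_subspaceD(1)[OF L h] by (simp add: signed_def l_minus)
next
  case False
  then have "nat k \<in> {1..n}" using k by auto
  then show ?thesis using False z(2) h by (simp add: signed_def)
qed

lemma commuting_step: "i \<in> {1..n} \<Longrightarrow> z i \<in> carrier A \<Longrightarrow> \<exists>k'\<in>UNIV. z i \<otimes> z i [^] (k::nat) = z i [^] (k'::nat)"
  by (intro bexI[of _ "Suc k"]) (simp_all only: nat_pow_Suc2 UNIV_I)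

lemma y_LY: "i \<in> {1..n} \<Longrightarrow> h \<in> LY \<Longrightarrow> y i \<otimes> h \<in> LY"
  unfolding Y_basis_def
proof (rule mult_monomials[where s = 1])
  show "\<exists>k'\<in>UNIV. y i \<otimes> y i [^] k = y i [^] (k' :: nat)" if "i \<in> {1..n}" for k :: nat
    by (rule commuting_step[of i y k, OF that y_closed[OF that]])
qed (auto simp: commutation_relation(2)[of i] y_closed)

lemma g_LW: "w \<in> carrier (weyl_group T n) \<Longrightarrow> h \<in> LW \<Longrightarrow> g w \<otimes> h \<in> LW"
proof (rule complex_subspace_stable[OF basis_subset(2) g_closed subspaces(2)])
  fix b assume w: "w \<in> carrier (weyl_group T n)" and "b \<in> W_basis"
  then obtain w' m where b: "b = g w' \<otimes> m" "w' \<in> carrier (weyl_group T n)" "m \<in> Y_basis"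
    unfolding W_basis_def by blast
  then have "g w \<otimes> b = g (w \<circ> w') \<otimes> m"
    using w basis_subset(1) g_closed by (simp add: m_assoc[symmetric] group_relation subsetD)
  then have "g w \<otimes> b \<in> W_basis" using b w weyl_group_comp unfolding W_basis_def by blast
  then show "g w \<otimes> b \<in> LW" by (rule subsetD[OF linear_span_superset])
qed

lemma g_LY_LW: "w \<in> carrier (weyl_group T n) \<Longrightarrow> h \<in> LY \<Longrightarrow> g w \<otimes> h \<in> LW"
proof (rule complex_subspace_stable[OF basis_subset(1) g_closed subspaces(2)])
  fix b assume w: "w \<in> carrier (weyl_group T n)" "b \<in> Y_basis"
  then have "g w \<otimes> b \<in> W_basis" unfolding W_basis_def by blast
  then show "g w \<otimes> b \<in> LW" by (rule subsetD[OF linear_span_superset])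
qed

lemma y_LW:
  assumes i: "i \<in> {1..n}" and h: "h \<in> LW"
  shows "y i \<otimes> h \<in> LW"
proof (rule complex_subspace_stable[OF basis_subset(2) y_closed[OF i] subspaces(2) _ h])
  fix b assume "b \<in> W_basis"
  then obtain w m where b: "b = g w \<otimes> m" "w \<in> carrier (weyl_group T n)" "m \<in> Y_basis"
    unfolding W_basis_def by blast
  let ?k = "inv_into UNIV w (int i)"
  have k: "?k \<noteq> 0" "\<bar>?k\<bar> \<le> int n" using weyl_image[OF weyl_group_inv_into(1)[OF b(2)] i] by auto
  have m: "m \<in> carrier A" "m \<in> LY" using b(3) basis_subset(1) basis_spans(1) by auto
  have "y i \<otimes> b = g w \<otimes> (signed A y ?k \<otimes> m)"
    using b(1,2) i m(1) y_closed g_closed signed_closed[OF y_closed k]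
    by (simp add: m_assoc[symmetric] y_g)
  moreover have "signed A y ?k \<otimes> m \<in> LY"
    by (rule signed_stable[OF subspaces(1) y_closed y_LY k m(2)])
  ultimately show "y i \<otimes> b \<in> LW" using g_LY_LW b(2) by simp
qed

lemma clifford_step: "i \<in> {1..n} \<Longrightarrow> k \<in> {0, 1} \<Longrightarrow> \<exists>k'\<in>{0, 1}. c i \<otimes> c i [^] (k::nat) = c i [^] (k'::nat)"
  using c_closed by (auto simp: clifford_relation)

lemma c_LC: "i \<in> {1..n} \<Longrightarrow> h \<in> LC \<Longrightarrow> c i \<otimes> h \<in> LC"
  unfolding C_basis_def
proof (rule mult_monomials[where s = "- 1"])
  show "\<exists>k'\<in>{0, 1}. c i \<otimes> c i [^] k = c i [^] (k' :: nat)" if "i \<in> {1..n}" "k \<in> {0, 1}" for k :: nat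
    by (rule clifford_step[OF that])
qed (use basis_subset(2) in \<open>auto simp: clifford_relation(2)[of i] c_closed smult_minus_one\<close>)

lemma LW_LC: "LW \<subseteq> LC" and LC_LX: "LC \<subseteq> LX"
  by (intro linear_span_least[OF complex_space_axioms'] subspaces basis_spans)+

lemma g_LC: "w \<in> carrier (weyl_group T n) \<Longrightarrow> h \<in> LC \<Longrightarrow> g w \<otimes> h \<in> LC"
proof (rule mult_monomials_stable[where R = "{0, 1}" and z = c and n = n, OF c_closed basis_subset(2) g_closed subspaces(3) _ c_LC _ _ _])
  assume w: "w \<in> carrier (weyl_group T n)"
  show "g w \<otimes> m \<in> LC" if "m \<in> W_basis" for m
    using g_LW[OF w] that LW_LC basis_spans(2) by blast
  fix j h assume j: "j \<in> {1..n}" and h: "h \<in> LC" "g w \<otimes> h \<in> LC"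
  have "g w \<otimes> (c j \<otimes> h) = signed A c (w (int j)) \<otimes> (g w \<otimes> h)"
    using w j g_closed c_closed complex_subspaceD(1)[OF subspaces(3) h(1)] signed_closed[OF c_closed weyl_image[OF w j]]
    by (simp add: m_assoc[symmetric] g_c)
  then show "g w \<otimes> (c j \<otimes> h) \<in> LC"
    using signed_stable[OF subspaces(3) c_closed c_LC weyl_image[OF w j] h(2)] by simp
qed (simp_all only: C_basis_def[symmetric] basis_spans)

lemma y_LC: "i \<in> {1..n} \<Longrightarrow> h \<in> LC \<Longrightarrow> y i \<otimes> h \<in> LC"
proof (rule mult_monomials_stable[where R = "{0, 1}" and z = c and n = n, OF c_closed basis_subset(2) y_closed subspaces(3) _ c_LC _ _ _])
  assume i: "i \<in> {1..n}"
  show "y i \<otimes> m \<in> LC" if "m \<in> W_basis" for m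
    using y_LW[OF i] that LW_LC basis_spans(2) by blast
  fix j h assume j: "j \<in> {1..n}" and h: "h \<in> LC" "y i \<otimes> h \<in> LC"
  have "y i \<otimes> (c j \<otimes> h) = c j \<otimes> (y i \<otimes> h)"
    using i j y_closed c_closed complex_subspaceD(1)[OF subspaces(3) h(1)]
    by (simp add: m_assoc[symmetric] commutation_relation(3))
  then show "y i \<otimes> (c j \<otimes> h) \<in> LC" using c_LC[OF j h(2)] by simp
qed (simp_all only: C_basis_def[symmetric] basis_spans)

lemma x_LX: "i \<in> {1..n} \<Longrightarrow> h \<in> LX \<Longrightarrow> x i \<otimes> h \<in> LX"
  unfolding X_basis_def
proof (rule mult_monomials[where s = 1])
  show "\<exists>k'\<in>UNIV. x i \<otimes> x i [^] k = x i [^] (k' :: nat)" if "i \<in> {1..n}" for k :: nat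
    by (rule commuting_step[of i x k, OF that x_closed[OF that]])
qed (use basis_subset(3) in \<open>auto simp: commutation_relation(1)[of i] x_closed\<close>)

lemma c_LX: "i \<in> {1..n} \<Longrightarrow> h \<in> LX \<Longrightarrow> c i \<otimes> h \<in> LX"
proof (rule mult_monomials_stable[where R = UNIV and z = x and n = n, OF x_closed basis_subset(3) c_closed subspaces(4) _ x_LX _ _ _])
  assume i: "i \<in> {1..n}"
  show "c i \<otimes> m \<in> LX" if "m \<in> C_basis" for m
    using c_LC[OF i] that LC_LX basis_spans(4) by blast
  fix j h assume j: "j \<in> {1..n}" and h: "h \<in> LX" "c i \<otimes> h \<in> LX"
  have hc: "h \<in> carrier A" using complex_subspaceD(1)[OF subspaces(4) h(1)] .
  have xc: "x j \<otimes> (c i \<otimes> h) \<in> LX" by (rule x_LX[OF j h(2)])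
  show "c i \<otimes> (x j \<otimes> h) \<in> LX"
  proof (cases "i = j")
    case True
    have "c i \<otimes> x i = \<ominus> (x i \<otimes> c i)" using commutation_relation(4)[OF i] i x_closed c_closed by simp
    then have "c i \<otimes> (x j \<otimes> h) = (- 1) \<odot> (x j \<otimes> (c i \<otimes> h))"
      using True i j hc x_closed c_closed by (simp add: m_assoc[symmetric] l_minus smult_minus_one)
    then show ?thesis using xc complex_subspaceD(4)[OF subspaces(4)] by simp
  next
    case False
    then have "c i \<otimes> (x j \<otimes> h) = x j \<otimes> (c i \<otimes> h)"
      using i j hc x_closed c_closed by (simp add: m_assoc[symmetric] commutation_relation(5))
    then show ?thesis using xc by simp
  qed
qed (simp_all only: X_basis_def[symmetric] basis_spans)

lemma g_LX: "w \<in> carrier (weyl_group T n) \<Longrightarrow> h \<in> LX \<Longrightarrow> g w \<otimes> h \<in> LX"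
proof (rule mult_monomials_stable[where R = UNIV and z = x and n = n, OF x_closed basis_subset(3) g_closed subspaces(4) _ x_LX _ _ _])
  assume w: "w \<in> carrier (weyl_group T n)"
  show "g w \<otimes> m \<in> LX" if "m \<in> C_basis" for m
    using g_LC[OF w] that LC_LX basis_spans(4) by blast
  fix j h assume j: "j \<in> {1..n}" and h: "h \<in> LX" "g w \<otimes> h \<in> LX"
  have "g w \<otimes> (x j \<otimes> h) = signed A x (w (int j)) \<otimes> (g w \<otimes> h)"
    using w j g_closed x_closed complex_subspaceD(1)[OF subspaces(4) h(1)] signed_closed[OF x_closed weyl_image[OF w j]]
    by (simp add: m_assoc[symmetric] g_x)
  then show "g w \<otimes> (x j \<otimes> h) \<in> LX"
    using signed_stable[OF subspaces(4) x_closed x_LX weyl_image[OF w j] h(2)] by simp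
qed (simp_all only: X_basis_def[symmetric] basis_spans)

text \<open>This is where the inhomogeneous relations enter: y_i x_j = [y_i, x_j] + x_j y_i. The
  bracket involves c and W only, and LX is already known to be stable under these.\<close>

lemma y_LX: "i \<in> {1..n} \<Longrightarrow> h \<in> LX \<Longrightarrow> y i \<otimes> h \<in> LX"
proof (rule mult_monomials_stable[where R = UNIV and z = x and n = n, OF x_closed basis_subset(3) y_closed subspaces(4) _ x_LX _ _ _])
  assume i: "i \<in> {1..n}"
  show "y i \<otimes> m \<in> LX" if "m \<in> C_basis" for m
    using y_LC[OF i] that LC_LX basis_spans(4) by blast
  fix j h assume j: "j \<in> {1..n}" and h: "h \<in> LX" "y i \<otimes> h \<in> LX"
  have hc: "h \<in> carrier A" using complex_subspaceD(1)[OF subspaces(4) h(1)] .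
  have cc: "y i \<in> carrier A" "x j \<in> carrier A" using i j x_closed y_closed by auto
  have K: "commutator A (y i) (x j) \<in> carrier A" using cc by (simp add: commutator_def)
  have eq: "y i \<otimes> x j = commutator A (y i) (x j) \<oplus> x j \<otimes> y i"
    using cc unfolding commutator_def by (simp add: a_minus_def a_assoc l_neg)
  have "y i \<otimes> (x j \<otimes> h) = (y i \<otimes> x j) \<otimes> h" using cc hc by (simp add: m_assoc)
  also have "\<dots> = commutator A (y i) (x j) \<otimes> h \<oplus> x j \<otimes> (y i \<otimes> h)"
    unfolding eq using K cc hc by (simp add: l_distr m_assoc)
  finally have "y i \<otimes> (x j \<otimes> h) = commutator A (y i) (x j) \<otimes> h \<oplus> x j \<otimes> (y i \<otimes> h)" .
  moreover have "commutator A (y i) (x j) \<otimes> h \<in> LX"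
    by (rule commutator_stable[OF subspaces(4) c_LX g_LX j i h(1)])
  ultimately show "y i \<otimes> (x j \<otimes> h) \<in> LX" using x_LX[OF j h(2)] complex_subspaceD(3)[OF subspaces(4)] by simp
qed (simp_all only: X_basis_def[symmetric] basis_spans)

end

section \<open>Linear operators on functionals, determined and constructed by commutation
  rules\<close>

definition preserves_combinations :: "(('k \<Rightarrow> complex) \<Rightarrow> 'k \<Rightarrow> complex) \<Rightarrow> bool" where
  "preserves_combinations f \<longleftrightarrow> (\<forall>a F G k. f (\<lambda>k. a * F k + G k) k = a * f F k + f G k)"

lemma preserves_combinationsD:
  "preserves_combinations f \<Longrightarrow> f (\<lambda>k. a * F k + G k) = (\<lambda>k. a * f F k + f G k)"
  unfolding preserves_combinations_def by (rule ext) (elim allE)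

text \<open>These are all linear self-maps of the space of functions on the index set. That space is
  the full dual of the space with basis indexed by k, so a recursive definition of values at each
  index yields an element without any support condition.\<close>

typedef 'k lin_op = "{f :: ('k \<Rightarrow> complex) \<Rightarrow> 'k \<Rightarrow> complex. preserves_combinations f}"
  morphisms app Abs_lin_op
  by (rule exI[of _ id]) (simp add: preserves_combinations_def)

setup_lifting type_definition_lin_op

instantiation lin_op :: (type) ring_1
begin
lift_definition zero_lin_op :: "'a lin_op" is "\<lambda>F k. 0"
  by (simp add: preserves_combinations_def)
lift_definition one_lin_op :: "'a lin_op" is "\<lambda>F. F"
  by (simp add: preserves_combinations_def)
lift_definition plus_lin_op :: "'a lin_op \<Rightarrow> 'a lin_op \<Rightarrow> 'a lin_op" is "\<lambda>f g F k. f F k + g F k"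
  by (subst preserves_combinations_def) (simp add: preserves_combinationsD distrib_left)
lift_definition uminus_lin_op :: "'a lin_op \<Rightarrow> 'a lin_op" is "\<lambda>f F k. - f F k"
  by (subst preserves_combinations_def) (simp add: preserves_combinationsD)
lift_definition minus_lin_op :: "'a lin_op \<Rightarrow> 'a lin_op \<Rightarrow> 'a lin_op" is "\<lambda>f g F k. f F k - g F k"
  by (subst preserves_combinations_def) (simp add: preserves_combinationsD right_diff_distrib)
lift_definition times_lin_op :: "'a lin_op \<Rightarrow> 'a lin_op \<Rightarrow> 'a lin_op" is "\<lambda>f g F. g (f F)"
  by (subst preserves_combinations_def) (simp add: preserves_combinationsD)
instance
proof
  fix a b c :: "'a lin_op"
  \<comment> \<open>In a product the right factor is applied last to F, so distributivity on this
    side is the one that uses linearity.\<close>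
  have "app c (\<lambda>k. 1 * app a F k + app b F k) = (\<lambda>k. 1 * app c (app a F) k + app c (app b F) k)" for F
    by (rule preserves_combinationsD) (use app[of c] in simp)
  then show "(a + b) * c = a * c + b * c"
    by (simp add: app_inject[symmetric] fun_eq_iff times_lin_op.rep_eq plus_lin_op.rep_eq)
  show "(0::'a lin_op) \<noteq> 1"
  proof
    assume "(0::'a lin_op) = 1"
    then have "app (0::'a lin_op) (\<lambda>_. 1) undefined = app 1 (\<lambda>_. 1) undefined" by (rule arg_cong)
    then show False by (simp add: zero_lin_op.rep_eq one_lin_op.rep_eq)
  qed

qed (rule app_inject[THEN iffD1], simp add: fun_eq_iff plus_lin_op.rep_eq times_lin_op.rep_eq
    zero_lin_op.rep_eq one_lin_op.rep_eq uminus_lin_op.rep_eq minus_lin_op.rep_eq algebra_simps)+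
end

lift_definition scalar :: "complex \<Rightarrow> 'k lin_op" is "\<lambda>a F k. a * F k"
  by (simp add: preserves_combinations_def algebra_simps)

lemma app_simps [simp]:
  "app 0 F k = 0" "app 1 F = F" "app (D + E) F k = app D F k + app E F k"
  "app (- D) F k = - app D F k" "app (D - E) F k = app D F k - app E F k"
  "app (D * E) F = app E (app D F)" "app (scalar a) F k = a * F k"
  by (transfer; simp)+

lemma lin_op_eqI: "(\<And>F k. app D F k = app E F k) \<Longrightarrow> D = E"
  by (simp add: app_inject[symmetric] fun_eq_iff)

lemma app_linear: "app D (\<lambda>k. a * F k + G k) = (\<lambda>k. a * app D F k + app D G k)"
  by (rule preserves_combinationsD) (use app[of D] in simp)

lemma app_scale: "app D (\<lambda>k. a * F k) = (\<lambda>k. a * app D F k)"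
proof -
  have "app D (\<lambda>k. 0) = (\<lambda>k. 0)"
    using app_linear[of D "-1" F F] by (simp add: fun_eq_iff)
  then show ?thesis using app_linear[of D a F "\<lambda>_. 0"] by simp
qed

lemma scalar_commute: "scalar a * D = D * scalar a"
proof (rule lin_op_eqI)
  fix F k
  have "app (scalar a) F = (\<lambda>k. a * F k)" for F :: "'a \<Rightarrow> complex" by (simp add: fun_eq_iff)
  then show "app (scalar a * D) F k = app (D * scalar a) F k" by (simp add: app_scale)
qed

lemma scalar_left_commute: "D * (scalar a * E) = scalar a * (D * E)"
  by (metis mult.assoc scalar_commute)

lemma scalar_simps:
  "scalar 0 = 0" "scalar 1 = 1" "scalar (a + b) = scalar a + scalar b"
  "scalar (a * b) = scalar a * scalar b"
  by (auto intro!: lin_op_eqI simp: algebra_simps)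

text \<open>Multiplication by x_i. Exponents are multisets of variable indices, so that
  commutativity of the x_i is that of \<open>add_mset\<close> and induction on \<alpha> removes one
  variable.\<close>

lift_definition shift :: "nat \<Rightarrow> (nat multiset \<times> 'm) lin_op" is
  "\<lambda>i F k. F (add_mset i (fst k), snd k)"
  by (simp add: preserves_combinations_def)

lemma app_shift [simp]: "app (shift i) F (\<alpha>, m) = F (add_mset i \<alpha>, m)"
  by transfer simp

lemma shift_commute: "shift i * shift j = shift j * shift i"
  by (rule lin_op_eqI) (auto simp: add_mset_commute)

text \<open>The rule computes the value at x_i x^\<alpha> from values at x^\<alpha>. F has to be
  arbitrary in the induction, since evaluating x'_i D at F means evaluating D at the functional
  \<open>app (x' i) F\<close>. Every identity between operators below is an instance: exhibit the
  same x' and R for both sides and compare at \<alpha> = 0.\<close>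

lemma lin_op_eq_by_shift:
  fixes D E :: "(nat multiset \<times> 'm) lin_op"
  assumes D: "\<And>i. D * shift i = x' i * D + R i" and E: "\<And>i. E * shift i = x' i * E + R i"
    and base: "\<And>F m. app D F ({#}, m) = app E F ({#}, m)"
  shows "D = E"
proof -
  have "app D F (\<alpha>, m) = app E F (\<alpha>, m)" for F \<alpha> m
  proof (induction \<alpha> arbitrary: F)
    case (add i \<alpha>)
    have "app D F (add_mset i \<alpha>, m) = app (D * shift i) F (\<alpha>, m)" by simp
    also have "\<dots> = app (E * shift i) F (\<alpha>, m)" unfolding D E by (simp add: add.IH)
    finally show ?case by simp
  qed (simp add: base)
  then show ?thesis by (auto intro: lin_op_eqI)
qed

text \<open>A multiset can be emptied in many orders, and a function needs one of them: the least
  variable is removed first. That the rule then holds for removing any variable is the content of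
  lemma \<open>extension\<close>.\<close>

function extension_value ::
    "(nat \<Rightarrow> (nat multiset \<times> 'm) lin_op) \<Rightarrow> (nat \<Rightarrow> (nat multiset \<times> 'm) lin_op) \<Rightarrow>
      ((nat multiset \<times> 'm \<Rightarrow> complex) \<Rightarrow> 'm \<Rightarrow> complex) \<Rightarrow>
      nat multiset \<Rightarrow> (nat multiset \<times> 'm \<Rightarrow> complex) \<Rightarrow> 'm \<Rightarrow> complex" where
  "extension_value x' R D\<^sub>0 \<alpha> F m = (if \<alpha> = {#} then D\<^sub>0 F m else
     let i = Min_mset \<alpha> in
     extension_value x' R D\<^sub>0 (\<alpha> - {#i#}) (app (x' i) F) m + app (R i) F (\<alpha> - {#i#}, m))"
  by pat_completeness auto
termination
  by (relation "measure (\<lambda>(x', R, D\<^sub>0, \<alpha>, F, m). size \<alpha>)") (auto intro!: size_Diff1_less)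

declare extension_value.simps [simp del]

text \<open>
  The operator with the commutation rules \<open>D x\<^sub>i = x'\<^sub>i D + R\<^sub>i\<close> and the values \<open>D\<^sub>0\<close> at \<open>\<alpha> = 0\<close>.
  It exists if both ways of moving \<open>D\<close> past \<open>x\<^sub>i x\<^sub>j = x\<^sub>j x\<^sub>i\<close> agree, and is unspecified otherwise.
\<close>

definition extension where
  "extension x' R D\<^sub>0 = (SOME D. (\<forall>i. D * shift i = x' i * D + R i) \<and>
     (\<forall>F m. app D F ({#}, m) = D\<^sub>0 F m))"

text \<open>The hypotheses compare the two expansions D x_i x_j = x'_i x'_j D + x'_i R_j + R_i x_j
  and D x_j x_i = x'_j x'_i D + x'_j R_i + R_j x_i.\<close>

lemma extension:
  assumes D0: "\<And>a F G. D\<^sub>0 (\<lambda>k. a * F k + G k) = (\<lambda>m. a * D\<^sub>0 F m + D\<^sub>0 G m)"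
    and x': "\<And>i j. x' i * x' j = x' j * x' i"
    and R: "\<And>i j. x' i * R j + R i * shift j = x' j * R i + R j * shift i"
  shows "extension x' R D\<^sub>0 * shift i = x' i * extension x' R D\<^sub>0 + R i"
    and "app (extension x' R D\<^sub>0) F ({#}, m) = D\<^sub>0 F m"
proof -
  let ?e = "extension_value x' R D\<^sub>0"
  have e0: "?e {#} F m = D\<^sub>0 F m" for F m by (simp add: extension_value.simps)
  have e: "?e (add_mset i \<alpha>) F m = ?e \<alpha> (app (x' i) F) m + app (R i) F (\<alpha>, m)" for i \<alpha> F m
  proof (induction "size \<alpha>" arbitrary: \<alpha> i F rule: less_induct)
    case less
    define j where "j = Min_mset (add_mset i \<alpha>)"
    have j: "j \<in># add_mset i \<alpha>" unfolding j_def by (rule Min_in) auto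
    have red: "?e (add_mset i \<alpha>) F m = ?e (add_mset i \<alpha> - {#j#}) (app (x' j) F) m
        + app (R j) F (add_mset i \<alpha> - {#j#}, m)"
      by (subst extension_value.simps) (simp add: j_def Let_def)
    show ?case
    proof (cases "j = i")
      case True
      then show ?thesis using red by simp
    next
      case False
      \<comment> \<open>The recursion removes the least variable j first, the claim removes i first.
        By induction hypothesis the other variable can be removed next in both cases, which leads to
        \<beta> along two paths; the hypotheses on x' and R say that these agree.\<close>
      then obtain \<beta> where \<beta>: "\<alpha> = add_mset j \<beta>" using j by (auto dest: multi_member_split)
      have "app (x' i * R j + R i * shift j) F (\<beta>, m) = app (x' j * R i + R j * shift i) F (\<beta>, m)"
        by (simp only: R)
      moreover have "app (x' j) (app (x' i) F) = app (x' i) (app (x' j) F)"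
        using arg_cong[OF x'[of i j], of "\<lambda>D. app D F"] by simp
      ultimately show ?thesis
        using red False less[of \<beta>] by (simp add: \<beta> add_mset_commute algebra_simps)
    qed
  qed
  have lin: "?e \<alpha> (\<lambda>k. a * F k + G k) m = a * ?e \<alpha> F m + ?e \<alpha> G m" for a F G \<alpha> m
  proof (induction \<alpha> arbitrary: F G)
    case empty
    show ?case by (simp only: e0 D0)
  next
    case (add i \<alpha>)
    show ?case by (simp only: e app_linear add.IH) (simp only: algebra_simps)
  qed
  have "\<exists>D. (\<forall>i. D * shift i = x' i * D + R i) \<and> (\<forall>F m. app D F ({#}, m) = D\<^sub>0 F m)"
  proof (intro exI[of _ "Abs_lin_op (\<lambda>F k. ?e (fst k) F (snd k))"] conjI allI)
    have app: "app (Abs_lin_op (\<lambda>F k. ?e (fst k) F (snd k))) = (\<lambda>F k. ?e (fst k) F (snd k))"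
      by (rule Abs_lin_op_inverse) (simp add: preserves_combinations_def lin)
    show "Abs_lin_op (\<lambda>F k. ?e (fst k) F (snd k)) * shift i
        = x' i * Abs_lin_op (\<lambda>F k. ?e (fst k) F (snd k)) + R i" for i
      by (rule lin_op_eqI) (clarsimp simp: app e)
    show "app (Abs_lin_op (\<lambda>F k. ?e (fst k) F (snd k))) F ({#}, m) = D\<^sub>0 F m" for F m
      by (simp add: app e0)
  qed
  from someI_ex[OF this]
  have "(\<forall>i. extension x' R D\<^sub>0 * shift i = x' i * extension x' R D\<^sub>0 + R i) \<and>
     (\<forall>F m. app (extension x' R D\<^sub>0) F ({#}, m) = D\<^sub>0 F m)"
    unfolding extension_def .
  note E = this
  from E[THEN conjunct1, rule_format] show "extension x' R D\<^sub>0 * shift i = x' i * extension x' R D\<^sub>0 + R i" .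
  from E[THEN conjunct2, rule_format] show "app (extension x' R D\<^sub>0) F ({#}, m) = D\<^sub>0 F m" .
qed

section \<open>Operators of the Hecke-Clifford algebra\<close>

text \<open>Odd bijections of all integers, without a bound n: the index set of the module is then
  one fixed type for all n and all Weyl types. Only the operators attached to elements of W are used
  in the end.\<close>

typedef signed_perm = "{w :: int \<Rightarrow> int. bij w \<and> (\<forall>i. w (- i) = - w i)}"
  morphisms sp Abs_signed_perm
  by (rule exI[of _ id]) simp

setup_lifting type_definition_signed_perm

lift_definition sp_id :: signed_perm is id by simp

lift_definition sp_comp :: "signed_perm \<Rightarrow> signed_perm \<Rightarrow> signed_perm" is "(\<circ>)"
  by (auto intro: bij_comp)

lift_definition sp_inv :: "signed_perm \<Rightarrow> signed_perm" is "inv_into UNIV"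
proof -
  fix w :: "int \<Rightarrow> int"
  assume w: "bij w \<and> (\<forall>i. w (- i) = - w i)"
  have "inv_into UNIV w (- i) = - inv_into UNIV w i" for i
  proof -
    obtain j where j: "i = w j" using w by (meson bij_pointE)
    then have "- i = w (- j)" using w by simp
    then show ?thesis using w j by (metis bij_is_inj inv_f_f)
  qed
  then show "bij (inv_into UNIV w) \<and> (\<forall>i. inv_into UNIV w (- i) = - inv_into UNIV w i)"
    using w by (simp add: bij_imp_bij_inv)
qed

text \<open>For signed indices this one family contains both kinds of reflections: s_{ij} is the
  swap of i and j, and sbar_{ij} is the swap of i and -j. Degenerate pairs give the identity, so
  that the family is total.\<close>

lift_definition sp_swap :: "int \<Rightarrow> int \<Rightarrow> signed_perm" is
  "\<lambda>a b. if a \<noteq> 0 \<and> b \<noteq> 0 \<and> \<bar>a\<bar> \<noteq> \<bar>b\<bar> then transpose a b \<circ> transpose (- a) (- b) else id"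
  by (auto simp: transpose_def intro!: bij_comp split: if_splits)

lift_definition sp_flip :: "int \<Rightarrow> signed_perm" is "\<lambda>a. transpose a (- a)"
  by (auto simp: transpose_def)

lemma sp_eqI: "(\<And>i. sp v i = sp w i) \<Longrightarrow> v = w"
  by (simp add: sp_inject[symmetric] fun_eq_iff)

lemma sp_simps [simp]:
  "sp sp_id i = i" "sp (sp_comp v w) i = sp v (sp w i)" "sp w (- i) = - sp w i"
  by (transfer; simp)+

lemma sp_inv_left [simp]: "sp (sp_inv w) (sp w i) = i"
  by transfer (simp add: bij_is_inj inv_f_f)

lemma sp_inv_right [simp]: "sp w (sp (sp_inv w) i) = i"
  by transfer (simp add: bij_is_surj surj_f_inv_f)

lemma sp_eq_iff [simp]: "sp w i = sp w j \<longleftrightarrow> i = j"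
  by (metis sp_inv_left)

lemma sp_0 [simp]: "sp w 0 = 0"
  using sp_simps(3)[of w 0] by simp

lemma sp_eq_0_iff [simp]: "sp w i = 0 \<longleftrightarrow> i = 0"
  using sp_eq_iff[of w i 0] by simp

lemma sp_abs_eq_iff [simp]: "\<bar>sp w i\<bar> = \<bar>sp w j\<bar> \<longleftrightarrow> \<bar>i\<bar> = \<bar>j\<bar>"
  by (metis (no_types) abs_eq_iff sp_eq_iff sp_simps(3))

lemma sp_inv_comp [simp]: "sp_inv (sp_comp v w) = sp_comp (sp_inv w) (sp_inv v)"
  by (rule sp_eqI) (metis sp_inv_left sp_inv_right sp_simps(2))

lemma sp_comp_id [simp]: "sp_comp w sp_id = w" "sp_comp sp_id w = w"
  by (auto intro: sp_eqI)

lemma sp_comp_assoc: "sp_comp (sp_comp u v) w = sp_comp u (sp_comp v w)"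
  by (auto intro: sp_eqI)

lemma sp_inv_id [simp]: "sp_inv sp_id = sp_id"
  by (rule sp_eqI) (metis sp_inv_left sp_simps(1))

lemma sp_swap:
  assumes "a \<noteq> 0" "b \<noteq> 0" "\<bar>a\<bar> \<noteq> \<bar>b\<bar>"
  shows "sp (sp_swap a b) i = (if i = a then b else if i = b then a
    else if i = - a then - b else if i = - b then - a else i)"
  using assms by transfer (auto simp: transpose_def)

lemma sp_flip: "sp (sp_flip a) i = (if \<bar>i\<bar> = \<bar>a\<bar> then - i else i)"
  by transfer (auto simp: transpose_def)

lemma sp_swap_trivial: "\<not> (a \<noteq> 0 \<and> b \<noteq> 0 \<and> \<bar>a\<bar> \<noteq> \<bar>b\<bar>) \<Longrightarrow> sp_swap a b = sp_id"
  by transfer auto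

lemma sp_swap_commute: "sp_swap a b = sp_swap b a"
  by (cases "a \<noteq> 0 \<and> b \<noteq> 0 \<and> \<bar>a\<bar> \<noteq> \<bar>b\<bar>")
    (auto intro!: sp_eqI simp: sp_swap sp_swap_trivial)

lemma sp_swap_minus: "sp_swap (- a) (- b) = sp_swap a b"
  by (cases "a \<noteq> 0 \<and> b \<noteq> 0 \<and> \<bar>a\<bar> \<noteq> \<bar>b\<bar>")
    (auto intro!: sp_eqI simp: sp_swap sp_swap_trivial)

lemma sp_flip_minus: "sp_flip (- a) = sp_flip a"
  by (auto intro!: sp_eqI simp: sp_flip)

text \<open>Conjugation by w just applies w to the two signed indices. This uniform rule is what
  makes the brackets equivariant without distinguishing s from sbar.\<close>

lemma sp_comp_swap: "sp_comp w (sp_swap a b) = sp_comp (sp_swap (sp w a) (sp w b)) w"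
proof (cases "a \<noteq> 0 \<and> b \<noteq> 0 \<and> \<bar>a\<bar> \<noteq> \<bar>b\<bar>")
  case True
  then have "sp w i = - sp w j \<longleftrightarrow> i = - j" for i j by (metis sp_eq_iff sp_simps(3))
  with True show ?thesis by (auto intro!: sp_eqI simp: sp_swap)
qed (auto intro!: sp_eqI simp: sp_swap_trivial)

lemma sp_comp_flip: "sp_comp w (sp_flip a) = sp_comp (sp_flip (sp w a)) w"
  by (auto intro!: sp_eqI simp: sp_flip)


section \<open>Signed indices and Clifford signs\<close>

definition signed_elt :: "(nat \<Rightarrow> 'a :: ring_1) \<Rightarrow> int \<Rightarrow> 'a" where
  "signed_elt z k = (if k < 0 then - z (nat (- k)) else z (nat k))"

lemma signed_elt_minus: "k \<noteq> 0 \<Longrightarrow> signed_elt z (- k) = - signed_elt z k"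
  by (auto simp: signed_elt_def)

lemma signed_elt_int [simp]: "signed_elt z (int i) = z i"
  by (simp add: signed_elt_def)

lemma signed_elt_cases:
  obtains i where "k = int i" | i where "k = - int i" "i > 0"
  by (metis int_cases2 neg_0_equal_iff_equal of_nat_0 zero_less_iff_neq_zero)

lemma signed_elt_intertwine:
  assumes "\<And>i. D * z i = signed_elt z' (sp w (int i)) * D" "a \<noteq> 0"
  shows "D * signed_elt z a = signed_elt z' (sp w a) * D"
proof (cases a rule: signed_elt_cases)
  case (1 i)
  then show ?thesis by (simp add: assms)
next
  case (2 i)
  then show ?thesis by (simp add: assms signed_elt_minus)
qed

text \<open>With the factors of c^E in increasing order, this is the sign from moving c_k past the
  factors c_l with l < k. Since c_k c_k = 1, the product c_k c^E is this sign times the monomial of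
  \<open>toggle k E\<close>.\<close>

definition clifford_sign :: "nat \<Rightarrow> nat set \<Rightarrow> complex" where
  "clifford_sign k E = (- 1) ^ card {l \<in> E. l < k}"

definition toggle :: "nat \<Rightarrow> nat set \<Rightarrow> nat set" where
  "toggle k E = (if k \<in> E then E - {k} else insert k E)"

lemma toggle_toggle [simp]: "toggle k (toggle k E) = E"
  by (auto simp: toggle_def)

lemma toggle_commute: "toggle k (toggle l E) = toggle l (toggle k E)"
  by (auto simp: toggle_def)

lemma clifford_sign_toggle:
  "clifford_sign k (toggle l E) = (if l < k then - clifford_sign k E else clifford_sign k E)"
proof -
  have fin: "finite {i \<in> E. i < k}" by (rule finite_subset[of _ "{..<k}"]) auto
  consider "l < k" "l \<in> E" | "l < k" "l \<notin> E" | "\<not> l < k" by blast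
  then show ?thesis
  proof cases
    case 1
    then have "{i \<in> E. i < k} = insert l {i \<in> toggle l E. i < k}"
      by (auto simp: toggle_def)
    moreover have "l \<notin> {i \<in> toggle l E. i < k}" "finite {i \<in> toggle l E. i < k}"
      using 1 fin by (auto simp: toggle_def)
    ultimately show ?thesis using 1 by (simp add: clifford_sign_def)
  next
    case 2
    then have "{i \<in> toggle l E. i < k} = insert l {i \<in> E. i < k}" by (auto simp: toggle_def)
    then show ?thesis using 2 fin by (simp add: clifford_sign_def)
  next
    case 3
    then have "{i \<in> toggle l E. i < k} = {i \<in> E. i < k}" by (auto simp: toggle_def)
    then show ?thesis using 3 by (simp add: clifford_sign_def)
  qed
qed

lemma clifford_sign_square [simp]: "clifford_sign k E * clifford_sign k E = 1"
  by (simp add: clifford_sign_def flip: power_add)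

lemma clifford_sign_nonzero [simp]: "clifford_sign k E \<noteq> 0"
  by (simp add: clifford_sign_def)

section \<open>The operators of x, W and the Clifford generators\<close>

type_synonym basis_tail = "signed_perm \<times> nat set \<times> nat multiset"
type_synonym hc_op = "(nat multiset \<times> basis_tail) lin_op"

text \<open>
  A function \<open>F\<close> on \<open>nat multiset \<times> basis_tail\<close> is a linear functional on the space with basis
  \<open>x\<^sup>\<alpha> w c\<^sup>E y\<^sup>\<gamma>\<close>, indexed by \<open>(\<alpha>, w, E, \<gamma>)\<close>, and \<open>app a F\<close> is the functional
  \<open>k \<mapsto> F (a k)\<close>. This is why products of operators compose in the reverse order.
\<close>

abbreviation opX :: "nat \<Rightarrow> hc_op" where "opX \<equiv> shift"

text \<open>In the module the group element stands to the left of the Clifford part, so at \<alpha>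
  = 0 the group acts by composition alone, without signs. Past x_i there is no remainder: w x_i =
  w(x_i) w.\<close>

definition opW :: "signed_perm \<Rightarrow> hc_op" where
  "opW w = extension (\<lambda>i. signed_elt opX (sp w (int i))) (\<lambda>_. 0)
     (\<lambda>F (w', m). F ({#}, sp_comp w w', m))"

text \<open>At \<alpha> = 0 the generator is first moved through w': c_j w' = w' c_k with k the
  signed index w'^{-1}(j), and c_k is \<open>sgn k\<close> times the generator with index l. For j =
  0 the factor \<open>sgn k\<close> is 0, which is why \<open>opC_square\<close> asks for i >
  0.\<close>

definition opC :: "nat \<Rightarrow> hc_op" where
  "opC j = extension (\<lambda>i. if i = j then - opX i else opX i) (\<lambda>_. 0)
     (\<lambda>F (w', E, \<gamma>). let k = sp (sp_inv w') (int j); l = nat \<bar>k\<bar> in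
        of_int (sgn k) * clifford_sign l E * F ({#}, w', toggle l E, \<gamma>))"

lemma signed_opX_commute: "signed_elt opX a * signed_elt opX b = signed_elt opX b * signed_elt opX a"
  by (simp add: signed_elt_def shift_commute)

lemma opW_opX': "opW w * opX i = signed_elt opX (sp w (int i)) * opW w"
  and opW_base: "app (opW w) F ({#}, w', m) = F ({#}, sp_comp w w', m)"
proof -
  note E = extension[of "\<lambda>F (w', m). F ({#}, sp_comp w w', m)"
      "\<lambda>i. signed_elt opX (sp w (int i))" "\<lambda>_. 0", folded opW_def]
  show "opW w * opX i = signed_elt opX (sp w (int i)) * opW w"
    by (subst E(1)) (auto simp: signed_opX_commute)
  show "app (opW w) F ({#}, w', m) = F ({#}, sp_comp w w', m)"
    by (subst E(2)) (auto simp: signed_opX_commute)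
qed

lemma opC_opX': "opC j * opX i = (if i = j then - opX i else opX i) * opC j"
  and opC_base: "app (opC j) F ({#}, w', E, \<gamma>) = (let k = sp (sp_inv w') (int j); l = nat \<bar>k\<bar> in
        of_int (sgn k) * clifford_sign l E * F ({#}, w', toggle l E, \<gamma>))"
proof -
  note E = extension[of "(\<lambda>F (w', E, \<gamma>). let k = sp (sp_inv w') (int j); l = nat \<bar>k\<bar> in
        of_int (sgn k) * clifford_sign l E * F ({#}, w', toggle l E, \<gamma>))"
      "\<lambda>i. if i = j then - opX i else opX i" "\<lambda>_. 0", folded opC_def]
  show "opC j * opX i = (if i = j then - opX i else opX i) * opC j"
    by (subst E(1)) (auto simp: shift_commute Let_def algebra_simps)
  show "app (opC j) F ({#}, w', E, \<gamma>) = (let k = sp (sp_inv w') (int j); l = nat \<bar>k\<bar> in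
        of_int (sgn k) * clifford_sign l E * F ({#}, w', toggle l E, \<gamma>))"
    by (subst E(2)) (auto simp: shift_commute Let_def algebra_simps)
qed

abbreviation "sX \<equiv> signed_elt opX"
abbreviation "sC \<equiv> signed_elt opC"

lemma opW_opX: "a \<noteq> 0 \<Longrightarrow> opW w * sX a = sX (sp w a) * opW w"
  by (rule signed_elt_intertwine) (rule opW_opX')

lemma opW_id: "opW sp_id = 1"
  by (rule lin_op_eq_by_shift[where x' = opX and R = "\<lambda>_. 0"])
    (auto simp: opW_opX' opW_base)

lemma opW_comp: "opW v * opW w = opW (sp_comp v w)"
proof (rule lin_op_eq_by_shift[where x' = "\<lambda>i. sX (sp v (sp w (int i)))" and R = "\<lambda>_. 0"])
  fix i
  show "opW v * opW w * opX i = sX (sp v (sp w (int i))) * (opW v * opW w) + 0"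
  proof (cases "i = 0")
    \<comment> \<open>The uniqueness principle quantifies over all natural indices. The index 0 is
      no variable of the algebra; as a signed index it is fixed by every signed permutation and is
      treated separately.\<close>
    case True
    have "opW v * opX 0 = opX 0 * opW v" for v using opW_opX'[of v 0]
      by (simp add: signed_elt_def)
    then show ?thesis using True by (simp add: signed_elt_def mult.assoc) (simp add: mult.assoc[symmetric])
  next
    case False
    then show ?thesis by (simp add: mult.assoc opW_opX') (simp add: mult.assoc[symmetric] opW_opX)
  qed
  show "opW (sp_comp v w) * opX i = sX (sp v (sp w (int i))) * opW (sp_comp v w) + 0"
    by (simp add: opW_opX')
qed (auto simp: opW_base sp_comp_assoc)

lemma opC_opC: "i \<noteq> j \<Longrightarrow> opC i * opC j = - (opC j * opC i)"
proof (rule lin_op_eq_by_shift[where x' = "\<lambda>k. if k = i \<or> k = j then - opX k else opX k" and R = "\<lambda>_. 0"])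
  fix k assume "i \<noteq> j"
  then show "opC i * opC j * opX k = (if k = i \<or> k = j then - opX k else opX k) * (opC i * opC j) + 0"
    "- (opC j * opC i) * opX k = (if k = i \<or> k = j then - opX k else opX k) * - (opC j * opC i) + 0"
    by (auto simp: mult.assoc opC_opX') (auto simp: mult.assoc[symmetric] opC_opX')
next
  fix F and m :: basis_tail assume ij: "i \<noteq> j"
  obtain w E \<gamma> where m: "m = (w, E, \<gamma>)" by (cases m)
  let ?a = "sp (sp_inv w) (int i)" and ?b = "sp (sp_inv w) (int j)"
  have "\<bar>?a\<bar> \<noteq> \<bar>?b\<bar>" using ij by simp
  \<comment> \<open>Toggling the smaller of the two positions changes the sign counted at the larger
    one, and not conversely, so exactly one of the two orders acquires an additional minus.\<close>
  then have "nat \<bar>?a\<bar> < nat \<bar>?b\<bar> \<or> nat \<bar>?b\<bar> < nat \<bar>?a\<bar>" by linarith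
  then show "app (opC i * opC j) F ({#}, m) = app (- (opC j * opC i)) F ({#}, m)"
    by (auto simp: m opC_base Let_def clifford_sign_toggle toggle_commute)
qed

lemma opC_square: "i > 0 \<Longrightarrow> opC i * opC i = 1"
proof (rule lin_op_eq_by_shift[where x' = opX and R = "\<lambda>_. 0"])
  fix k
  show "opC i * opC i * opX k = opX k * (opC i * opC i) + 0" "1 * opX k = opX k * 1 + 0"
    by (auto simp: mult.assoc opC_opX') (auto simp: mult.assoc[symmetric] opC_opX')
next
  fix F and m :: basis_tail assume i: "i > 0"
  obtain w E \<gamma> where m: "m = (w, E, \<gamma>)" by (cases m)
  have "sp (sp_inv w) (int i) \<noteq> 0" using i by simp
  then show "app (opC i * opC i) F ({#}, m) = app 1 F ({#}, m)"
    by (auto simp: m opC_base Let_def clifford_sign_toggle sgn_if)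
qed

lemma signed_opC_opX':
  "a \<noteq> 0 \<Longrightarrow> sC a * opX i = (if int i = \<bar>a\<bar> then - opX i else opX i) * sC a"
  by (auto simp: signed_elt_def opC_opX')

lemma signed_opC_opX:
  "a \<noteq> 0 \<Longrightarrow> sC a * sX b = (if \<bar>a\<bar> = \<bar>b\<bar> then - sX b else sX b) * sC a"
  by (auto simp: signed_elt_def[of opX] signed_opC_opX')

lemma opW_opC': "i > 0 \<Longrightarrow> opW w * opC i = sC (sp w (int i)) * opW w"
proof (rule lin_op_eq_by_shift[where x' = "\<lambda>k. if k = i then - sX (sp w (int k)) else sX (sp w (int k))" and R = "\<lambda>_. 0"])
  fix k assume i: "i > 0"
  show "opW w * opC i * opX k = (if k = i then - sX (sp w (int k)) else sX (sp w (int k))) * (opW w * opC i) + 0"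
    by (auto simp: mult.assoc opC_opX') (auto simp: mult.assoc[symmetric] opW_opX')
  have *: "sC (sp w (int i)) * sX (sp w (int k)) =
    (if k = i then - sX (sp w (int k)) else sX (sp w (int k))) * sC (sp w (int i))"
  proof -
    have "sp w (int i) \<noteq> 0" using i by simp
    then show ?thesis by (simp add: signed_opC_opX)
  qed
  show "sC (sp w (int i)) * opW w * opX k = (if k = i then - sX (sp w (int k)) else sX (sp w (int k))) *
     (sC (sp w (int i)) * opW w) + 0"
    by (simp only: mult.assoc opW_opX') (simp add: mult.assoc[symmetric] *)
next
  fix F and m :: basis_tail assume i: "i > 0"
  obtain w' E \<gamma> where m: "m = (w', E, \<gamma>)" by (cases m)
  have sg: "app (sC a) F ({#}, w, E, \<gamma>) = (let k = sp (sp_inv w) a; l = nat \<bar>k\<bar> in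
        of_int (sgn k) * clifford_sign l E * F ({#}, w, toggle l E, \<gamma>))" for a w F
  proof (cases a rule: signed_elt_cases)
    case (1 i)
    then show ?thesis by (simp add: opC_base)
  next
    case (2 i)
    then show ?thesis by (simp add: opC_base signed_elt_minus Let_def)
  qed
  show "app (opW w * opC i) F ({#}, m) = app (sC (sp w (int i)) * opW w) F ({#}, m)"
    by (simp add: m opC_base sg opW_base Let_def)
qed

lemma opW_opC: "a \<noteq> 0 \<Longrightarrow> opW w * sC a = sC (sp w a) * opW w"
  by (cases a rule: signed_elt_cases) (auto simp: opW_opC' signed_elt_minus)

lemma signed_opC_opC: "\<bar>a\<bar> \<noteq> \<bar>b\<bar> \<Longrightarrow> sC a * sC b = - (sC b * sC a)"
  using opC_opC[of "nat \<bar>a\<bar>" "nat \<bar>b\<bar>"] by (auto simp: signed_elt_def split: if_splits)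

lemma signed_opC_square: "a \<noteq> 0 \<Longrightarrow> sC a * sC a = 1"
  by (auto simp: signed_elt_def opC_square)

text \<open>\<kappa> a b weights the reflection that swaps the signed indices a and b, and r weights
  the sign changes. The last two assumptions say that reflections occurring with nonzero weight
  preserve all weights. This abstracts from the three types what the construction of y uses.\<close>

locale dunkl =
  fixes n :: nat and \<kappa> :: "int \<Rightarrow> int \<Rightarrow> complex" and r :: complex
  assumes \<kappa>_commute: "\<kappa> a b = \<kappa> b a"
    and \<kappa>_minus: "\<kappa> (- a) (- b) = \<kappa> a b"
    and \<kappa>_swap: "a \<noteq> 0 \<Longrightarrow> b \<noteq> 0 \<Longrightarrow> \<bar>a\<bar> \<noteq> \<bar>b\<bar> \<Longrightarrow> \<kappa> a b \<noteq> 0 \<Longrightarrow>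
      \<kappa> (sp (sp_swap a b) c) (sp (sp_swap a b) d) = \<kappa> c d"
    and \<kappa>_flip: "r \<noteq> 0 \<Longrightarrow> \<kappa> (sp (sp_flip a) c) (sp (sp_flip a) d) = \<kappa> c d"
begin

text \<open>
  With \<open>Q a b = \<kappa>\<^bsub>a b\<^esub> (1 + c\<^sub>b c\<^sub>a) s\<^bsub>a b\<^esub>\<close> for signed indices, the brackets \<open>[y\<^sub>b, x\<^sub>a]\<close> of all
  three types take the same form, on which the group acts by permuting the signed indices. In type A the
  weight \<open>\<kappa>\<^bsub>a b\<^esub>\<close> vanishes unless \<open>a\<close> and \<open>b\<close> have the same sign, in types B and D it is constant.
\<close>

definition Q :: "int \<Rightarrow> int \<Rightarrow> hc_op" where
  "Q a b = scalar (\<kappa> a b) * ((1 + sC b * sC a) * opW (sp_swap a b))"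

definition partners :: "int \<Rightarrow> int set" where
  "partners a = {k. k \<noteq> 0 \<and> \<bar>k\<bar> \<le> int n \<and> \<bar>k\<bar> \<noteq> \<bar>a\<bar>}"

text \<open>In the sum over signed partners, k and -k contribute the s and the sbar term of one
  unsigned index.\<close>

definition diag :: "int \<Rightarrow> hc_op" where
  "diag a = - (\<Sum>k\<in>partners a. Q a k) - scalar r * opW (sp_flip a)"

text \<open>The bracket of y_b and x_a must be odd in a, hence the antisymmetrization of Q in the
  sign of a and the sign in front of diag. The value 0 for indices out of range supplies
  \<open>extension\<close> with a remainder for every natural index.\<close>

definition bracket :: "int \<Rightarrow> int \<Rightarrow> hc_op" where
  "bracket b a = (if a \<noteq> 0 \<and> b \<noteq> 0 \<and> \<bar>a\<bar> \<le> int n \<and> \<bar>b\<bar> \<le> int n then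
     if \<bar>a\<bar> \<noteq> \<bar>b\<bar> then Q a b - Q (- a) b else if a = b then diag a else - diag a else 0)"

lemma finite_partners [simp]: "finite (partners a)"
  by (rule finite_subset[of _ "{- int n..int n}"]) (auto simp: partners_def)

lemma Q_minus: "a \<noteq> 0 \<Longrightarrow> b \<noteq> 0 \<Longrightarrow> Q (- a) (- b) = Q a b"
  by (simp add: Q_def \<kappa>_minus signed_elt_minus sp_swap_minus)

lemma diag_minus: "a \<noteq> 0 \<Longrightarrow> diag (- a) = diag a"
proof -
  assume a: "a \<noteq> 0"
  have "(\<Sum>k\<in>partners (- a). Q (- a) k) = (\<Sum>k\<in>partners a. Q a k)"
    by (rule sum.reindex_bij_witness[of _ uminus uminus])
      (use a Q_minus[of "- a"] in \<open>auto simp: partners_def\<close>)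
  then show ?thesis by (simp add: diag_def sp_flip_minus)
qed

lemma bracket_minus_right: "bracket b (- a) = - bracket b a"
proof (cases "a \<noteq> 0 \<and> b \<noteq> 0")
  case True
  consider "\<bar>a\<bar> \<noteq> \<bar>b\<bar>" | "a = b" | "a = - b" by linarith
  then show ?thesis by cases (use True diag_minus[of b] in \<open>simp_all add: bracket_def\<close>)
qed (auto simp: bracket_def)

lemma bracket_minus_left: "bracket (- b) a = - bracket b a"
proof (cases "a \<noteq> 0 \<and> b \<noteq> 0")
  case True
  consider "\<bar>a\<bar> \<noteq> \<bar>b\<bar>" | "a = b" | "a = - b" by linarith
  then show ?thesis
  proof cases
    case 1
    have "Q a (- b) = Q (- a) b" using Q_minus[of "- a" b] True by simp
    moreover have "Q (- a) (- b) = Q a b" using Q_minus[of a b] True by simp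
    ultimately show ?thesis using 1 True unfolding bracket_def by simp
  qed (use True diag_minus[of b] in \<open>simp_all add: bracket_def\<close>)
next
  case False
  then consider "a = 0" | "b = 0" by blast
  then show ?thesis by cases (simp_all add: bracket_def)
qed

text \<open>The symmetries of the bracket data. They include the elements of W, and also each
  reflection that occurs in a bracket with nonzero weight, so that the group relation for y can be
  applied inside the brackets themselves.\<close>

definition equivariant :: "signed_perm \<Rightarrow> bool" where
  "equivariant w \<longleftrightarrow> (\<forall>a. \<bar>sp w a\<bar> \<le> int n \<longleftrightarrow> \<bar>a\<bar> \<le> int n) \<and>
     (\<forall>a b. \<kappa> (sp w a) (sp w b) = \<kappa> a b)"

lemma equivariant_swap:
  assumes "a \<noteq> 0" "b \<noteq> 0" "\<bar>a\<bar> \<noteq> \<bar>b\<bar>" "\<bar>a\<bar> \<le> int n" "\<bar>b\<bar> \<le> int n" "\<kappa> a b \<noteq> 0"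
  shows "equivariant (sp_swap a b)"
  using assms \<kappa>_swap unfolding equivariant_def by (auto simp: sp_swap)

lemma equivariant_flip:
  assumes "\<bar>a\<bar> \<le> int n" "r \<noteq> 0"
  shows "equivariant (sp_flip a)"
  using assms \<kappa>_flip unfolding equivariant_def by (auto simp: sp_flip)

lemma opW_Q:
  assumes "equivariant w" "a \<noteq> 0" "b \<noteq> 0"
  shows "opW w * Q a b = Q (sp w a) (sp w b) * opW w"
proof -
  have "opW w * Q a b = scalar (\<kappa> a b) * (opW w * ((1 + sC b * sC a) * opW (sp_swap a b)))"
    by (simp only: Q_def scalar_left_commute)
  also have "opW w * ((1 + sC b * sC a) * opW (sp_swap a b)) =
     (1 + sC (sp w b) * sC (sp w a)) * (opW w * opW (sp_swap a b))"
    using assms by (simp add: distrib_left distrib_right mult.assoc[symmetric] opW_opC)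
      (simp add: mult.assoc opW_opC)
  finally show ?thesis
    using assms(1) by (simp add: Q_def opW_comp sp_comp_swap equivariant_def mult.assoc)
qed

lemma opW_diag:
  assumes w: "equivariant w" and "a \<noteq> 0"
  shows "opW w * diag a = diag (sp w a) * opW w"
proof -
  have "(\<Sum>k\<in>partners a. opW w * Q a k) = (\<Sum>k\<in>partners a. Q (sp w a) (sp w k) * opW w)"
    using assms by (intro sum.cong) (auto simp: opW_Q partners_def)
  also have "\<dots> = (\<Sum>k\<in>partners (sp w a). Q (sp w a) k * opW w)"
  proof (rule sum.reindex_bij_witness[of _ "sp (sp_inv w)" "sp w"])
    fix k assume "k \<in> partners (sp w a)"
    moreover have "\<bar>sp w (sp (sp_inv w) k)\<bar> \<le> int n \<longleftrightarrow> \<bar>sp (sp_inv w) k\<bar> \<le> int n"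
      using w unfolding equivariant_def by blast
    moreover have "\<bar>sp (sp_inv w) k\<bar> = \<bar>a\<bar> \<longleftrightarrow> \<bar>k\<bar> = \<bar>sp w a\<bar>"
      using sp_abs_eq_iff[of w "sp (sp_inv w) k" a] by simp
    ultimately show "sp (sp_inv w) k \<in> partners a" by (auto simp: partners_def)
  qed (use w in \<open>auto simp: partners_def equivariant_def\<close>)
  finally have "opW w * (\<Sum>k\<in>partners a. Q a k) = (\<Sum>k\<in>partners (sp w a). Q (sp w a) k) * opW w"
    by (simp add: sum_distrib_left sum_distrib_right)
  moreover have "opW w * (scalar r * opW (sp_flip a)) = scalar r * opW (sp_flip (sp w a)) * opW w"
    by (simp add: mult.assoc opW_comp sp_comp_flip[symmetric])
      (simp add: mult.assoc[symmetric] scalar_commute[symmetric], simp add: mult.assoc opW_comp)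
  ultimately show ?thesis by (simp add: diag_def algebra_simps)
qed

lemma opW_bracket:
  assumes "equivariant w"
  shows "opW w * bracket b a = bracket (sp w b) (sp w a) * opW w"
proof (cases "a \<noteq> 0 \<and> b \<noteq> 0 \<and> \<bar>a\<bar> \<le> int n \<and> \<bar>b\<bar> \<le> int n")
  case True
  then have "\<bar>sp w a\<bar> \<le> int n" "\<bar>sp w b\<bar> \<le> int n" using assms by (auto simp: equivariant_def)
  moreover have "opW w * Q (- a) b = Q (- sp w a) (sp w b) * opW w"
    using opW_Q[OF assms, of "- a" b] True by simp
  ultimately show ?thesis using True assms
    by (simp add: bracket_def opW_Q opW_diag right_diff_distrib left_diff_distrib)
next
  case False
  then have "\<not> (sp w a \<noteq> 0 \<and> sp w b \<noteq> 0 \<and> \<bar>sp w a\<bar> \<le> int n \<and> \<bar>sp w b\<bar> \<le> int n)"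
    using assms by (auto simp: equivariant_def)
  then show ?thesis using False unfolding bracket_def by (simp only: if_False mult_zero_left mult_zero_right)
qed

text \<open>The families \<open>x\<close> and \<open>y\<close> both satisfy the assumptions made on \<open>z\<close> here.\<close>

definition intertwined :: "(int \<Rightarrow> hc_op) \<Rightarrow> bool" where
  "intertwined z \<longleftrightarrow> (\<forall>w a. equivariant w \<longrightarrow> a \<noteq> 0 \<longrightarrow> opW w * z a = z (sp w a) * opW w) \<and>
     (\<forall>a b. a \<noteq> 0 \<longrightarrow> b \<noteq> 0 \<longrightarrow> \<bar>a\<bar> \<noteq> \<bar>b\<bar> \<longrightarrow> sC a * z b = z b * sC a) \<and>
     (\<forall>a. a \<noteq> 0 \<longrightarrow> z (- a) = - z a)"

text \<open>The reflection fixes d, and c_a, c_b commute with z_d. The case distinction is essential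
  in type A: the swap of two indices of opposite sign need not be equivariant, but then the weight
  vanishes and with it Q.\<close>

lemma Q_commute:
  assumes z: "intertwined z" and ab: "a \<noteq> 0" "b \<noteq> 0" "\<bar>a\<bar> \<noteq> \<bar>b\<bar>" "\<bar>a\<bar> \<le> int n" "\<bar>b\<bar> \<le> int n"
    and d: "d \<noteq> 0" "\<bar>d\<bar> \<noteq> \<bar>a\<bar>" "\<bar>d\<bar> \<noteq> \<bar>b\<bar>"
  shows "Q a b * z d = z d * Q a b"
proof (cases "\<kappa> a b = 0")
  case False
  have "opW (sp_swap a b) * z d = z d * opW (sp_swap a b)"
    using z equivariant_swap[OF ab False] d ab unfolding intertwined_def by (auto simp: sp_swap)
  moreover have "(1 + sC b * sC a) * z d = z d * (1 + sC b * sC a)"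
  proof -
    have 1: "sC a * z d = z d * sC a" "sC b * z d = z d * sC b"
      using z d ab unfolding intertwined_def by simp_all
    have "sC b * sC a * z d = z d * (sC b * sC a)"
      by (simp add: mult.assoc 1(1)) (simp add: mult.assoc[symmetric] 1(2))
    then show ?thesis by (simp add: distrib_left distrib_right)
  qed
  ultimately have "(1 + sC b * sC a) * opW (sp_swap a b) * z d = z d * ((1 + sC b * sC a) * opW (sp_swap a b))"
    by (simp add: mult.assoc) (simp add: mult.assoc[symmetric])
  then show ?thesis
    by (simp only: Q_def scalar_left_commute mult.assoc)
qed (simp add: Q_def scalar_simps)

text \<open>By \<open>Q_commute\<close> only the summands with k = d or k = - d fail to commute with
  z_d, and the sign change at a fixes d.\<close>

lemma diag_bracket:
  assumes z: "intertwined z" and a: "a \<noteq> 0" "\<bar>a\<bar> \<le> int n" and d: "d \<noteq> 0" "\<bar>d\<bar> \<noteq> \<bar>a\<bar>"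
  shows "diag a * z d - z d * diag a =
    (if \<bar>d\<bar> \<le> int n then - ((Q a d + Q a (- d)) * z d - z d * (Q a d + Q a (- d))) else 0)"
proof -
  have "(\<Sum>k\<in>partners a. Q a k * z d - z d * Q a k) = (\<Sum>k\<in>partners a \<inter> {d, - d}. Q a k * z d - z d * Q a k)"
    using z a d by (intro sum.mono_neutral_right[OF finite_partners]) (auto simp: partners_def intro!: Q_commute)
  also have "\<dots> = (if \<bar>d\<bar> \<le> int n then (Q a d * z d - z d * Q a d) + (Q a (- d) * z d - z d * Q a (- d)) else 0)"
  proof (cases "\<bar>d\<bar> \<le> int n")
    case True
    then have "partners a \<inter> {d, - d} = {d, - d}" using d by (auto simp: partners_def)
    then show ?thesis using True d by simp
  next
    case False
    then have "partners a \<inter> {d, - d} = {}" by (auto simp: partners_def)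
    then show ?thesis using False by simp
  qed
  finally have S: "(\<Sum>k\<in>partners a. Q a k) * z d - z d * (\<Sum>k\<in>partners a. Q a k) = \<dots>"
    by (simp add: sum_distrib_left sum_distrib_right sum_subtractf)
  have "scalar r * opW (sp_flip a) * z d = z d * (scalar r * opW (sp_flip a))"
  proof (cases "r = 0")
    case False
    then have "opW (sp_flip a) * z d = z d * opW (sp_flip a)"
      using z equivariant_flip[OF a(2) False] d unfolding intertwined_def by (auto simp: sp_flip)
    then show ?thesis by (simp only: scalar_left_commute mult.assoc)
  qed (simp add: scalar_simps)
  then have "diag a * z d - z d * diag a =
      - ((\<Sum>k\<in>partners a. Q a k) * z d - z d * (\<Sum>k\<in>partners a. Q a k))"
    by (simp add: diag_def left_diff_distrib right_diff_distrib)
  then show ?thesis unfolding S by (simp add: distrib_left distrib_right)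
qed

lemma intertwined_sX: "intertwined sX"
  unfolding intertwined_def by (auto simp: opW_opX signed_opC_opX signed_elt_minus)

text \<open>Both x_a and x_b anticommute with c_b c_a, so passing one of them turns 1 + c_b c_a into
  1 - c_b c_a. Since c_a c_b = - c_b c_a, the latter is the factor of Q b a. The terms without and
  with c_b c_a then match separately.\<close>

lemma Q_sX:
  assumes ab: "a \<noteq> 0" "b \<noteq> 0" "\<bar>a\<bar> \<noteq> \<bar>b\<bar>"
  shows "Q a b * sX b + Q b a * sX a = sX b * Q a b + sX a * Q b a"
proof -
  let ?d = "sC b * sC a" and ?t = "opW (sp_swap a b)"
  have d: "?d * sX a = - sX a * ?d" "?d * sX b = - sX b * ?d"
    using ab by (simp_all add: mult.assoc signed_opC_opX) (simp_all add: mult.assoc[symmetric] signed_opC_opX)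
  have t: "?t * sX a = sX b * ?t" "?t * sX b = sX a * ?t"
    using ab by (auto simp: opW_opX sp_swap)
  have ba: "sC a * sC b = - ?d" using signed_opC_opC[of a b] ab by simp
  have "((1 + ?d) * ?t) * sX b + ((1 - ?d) * ?t) * sX a = sX b * ((1 + ?d) * ?t) + sX a * ((1 - ?d) * ?t)"
  proof -
    have 1: "((1 + ?d) * ?t) * sX b = sX a * ?t - sX a * ?d * ?t"
      by (simp only: mult.assoc t) (simp add: distrib_right left_diff_distrib mult.assoc[symmetric] d)
    have 2: "((1 - ?d) * ?t) * sX a = sX b * ?t + sX b * ?d * ?t"
      by (simp only: mult.assoc t) (simp add: distrib_right left_diff_distrib mult.assoc[symmetric] d)
    show ?thesis unfolding 1 2 by (simp add: distrib_left distrib_right right_diff_distrib left_diff_distrib mult.assoc)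
  qed
  then have "scalar (\<kappa> a b) * (((1 + ?d) * ?t) * sX b + ((1 - ?d) * ?t) * sX a) =
      scalar (\<kappa> a b) * (sX b * ((1 + ?d) * ?t) + sX a * ((1 - ?d) * ?t))" by simp
  moreover have "Q b a = scalar (\<kappa> a b) * ((1 - ?d) * ?t)"
    by (simp add: Q_def ba sp_swap_commute[of b a] \<kappa>_commute[of b a])
  ultimately show ?thesis
    unfolding Q_def by (simp only: scalar_left_commute mult.assoc distrib_left)
qed

lemma bracket_commute:
  assumes z: "intertwined z" and d: "d \<noteq> 0" "\<bar>d\<bar> \<noteq> \<bar>a\<bar>" "\<bar>d\<bar> \<noteq> \<bar>b\<bar>" and ab: "\<bar>a\<bar> \<noteq> \<bar>b\<bar>"
  shows "bracket b a * z d = z d * bracket b a"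
  using Q_commute[OF z, of a b d] Q_commute[OF z, of "- a" b d] d ab
  by (auto simp: bracket_def right_diff_distrib left_diff_distrib)

end

section \<open>Jacobi identity of the brackets with x, and their behaviour under Clifford
  generators\<close>

context dunkl begin

text \<open>If neither index is b or -b, both commutators vanish. Otherwise one bracket is diagonal;
  by \<open>diag_bracket\<close> only its terms at k and -k survive, and \<open>Q_sX\<close> for the
  pairs (b, k) and (b, -k) matches them with the off-diagonal bracket.\<close>

lemma bracket_jacobi_xx:
  assumes b: "b \<noteq> 0" and ik: "i \<noteq> 0" "k \<noteq> 0" "\<bar>i\<bar> \<noteq> \<bar>k\<bar>"
  shows "bracket b i * sX k - sX k * bracket b i = bracket b k * sX i - sX i * bracket b k"
proof -
  \<comment> \<open>The case i = b. The others follow from it by the symmetry in i and k and by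
    oddness of \<open>bracket b\<close> and \<open>sX\<close>.\<close>
  have main: "bracket b b * sX k - sX k * bracket b b = bracket b k * sX b - sX b * bracket b k"
    if k: "k \<noteq> 0" "\<bar>k\<bar> \<noteq> \<bar>b\<bar>" for k
  proof (cases "\<bar>b\<bar> \<le> int n \<and> \<bar>k\<bar> \<le> int n")
    case True
    have 1: "Q b k * sX k + Q k b * sX b = sX k * Q b k + sX b * Q k b"
      using Q_sX[of b k] b k by simp
    have "Q b (- k) * - sX k + Q (- k) b * sX b = - sX k * Q b (- k) + sX b * Q (- k) b"
      using Q_sX[of b "- k"] b k by (simp add: signed_elt_minus)
    with 1 have "- ((Q b k + Q b (- k)) * sX k - sX k * (Q b k + Q b (- k))) =
        (Q k b - Q (- k) b) * sX b - sX b * (Q k b - Q (- k) b)"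
      by (simp add: algebra_simps)
    then show ?thesis
      using True b k by (simp add: bracket_def diag_bracket[OF intertwined_sX])
  next
    case False
    then show ?thesis using b k diag_bracket[OF intertwined_sX, of b k] by (auto simp: bracket_def)
  qed
  consider "\<bar>i\<bar> \<noteq> \<bar>b\<bar>" "\<bar>k\<bar> \<noteq> \<bar>b\<bar>" | "i = b" | "i = - b" | "k = b" | "k = - b" by linarith
  then show ?thesis
  proof cases
    case 1
    then show ?thesis using ik
      by (simp add: bracket_commute[OF intertwined_sX])
  next
    case 2
    then show ?thesis using main[of k] ik by simp
  next
    case 3
    have m: "bracket b b * sX k - sX k * bracket b b = bracket b k * sX b - sX b * bracket b k"
      using main[of k] ik 3 by simp
    have e: "bracket b i = - bracket b b" "sX i = - sX b"
      unfolding 3 using b by (simp_all only: bracket_minus_right signed_elt_minus[OF b])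
    show ?thesis by (simp only: e mult_minus_left mult_minus_right minus_diff_minus m)
  next
    case 4
    then show ?thesis using main[of i] ik by simp
  next
    case 5
    have m: "bracket b b * sX i - sX i * bracket b b = bracket b i * sX b - sX b * bracket b i"
      using main[of i] ik 5 by simp
    have e: "bracket b k = - bracket b b" "sX k = - sX b"
      unfolding 5 using b by (simp_all only: bracket_minus_right signed_elt_minus[OF b])
    show ?thesis by (simp only: e mult_minus_left mult_minus_right minus_diff_minus m)
  qed
qed

lemma intertwine_mult:
  fixes c :: "'a :: semigroup_mult"
  shows "c * m = m * c' \<Longrightarrow> c' * t = t * c'' \<Longrightarrow> c * (m * t) = m * t * c''"
  by (metis mult.assoc)

lemma anticommuting_involutions:
  fixes p q :: "'a :: ring_1"
  assumes "p * q = - (q * p)" "p * p = 1" "q * q = 1"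
  shows "p * (q * p) = - q" "q * p * q = - p" "q * (q * p) = p" "q * p * p = q"
proof -
  show "q * (q * p) = p" "q * p * p = q"
    using assms by (simp add: mult.assoc[symmetric], simp add: mult.assoc)
  have "p * (q * p) = - (q * p) * p" by (simp only: mult.assoc[symmetric] assms(1))
  also have "\<dots> = - (q * (p * p))" by (simp only: mult_minus_left mult.assoc)
  finally show "p * (q * p) = - q" using assms by simp
  have "q * p * q = q * - (q * p)" by (simp only: mult.assoc assms(1))
  also have "\<dots> = - (q * q * p)" by (simp only: mult_minus_right mult.assoc)
  finally show "q * p * q = - p" using assms by simp
qed

text \<open>The reflection exchanges c_a and c_b, and the factor 1 + c_b c_a exchanges them back up
  to sign: c_a (1 + c_b c_a) = (1 + c_b c_a) (- c_b) and c_b (1 + c_b c_a) = (1 + c_b c_a) c_a. So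
  c_a anticommutes with Q a b while c_b commutes with it, as x_a and y_b do.\<close>

lemma opC_Q:
  assumes "a \<noteq> 0" "b \<noteq> 0" "\<bar>a\<bar> \<noteq> \<bar>b\<bar>" "d \<noteq> 0"
  shows "sC d * Q a b = (if \<bar>d\<bar> = \<bar>a\<bar> then - Q a b else Q a b) * sC d"
proof -
  let ?d = "sC b * sC a" and ?t = "opW (sp_swap a b)"
  note ab = anticommuting_involutions[OF signed_opC_opC[OF assms(3)]
      signed_opC_square[OF assms(1)] signed_opC_square[OF assms(2)]]
  have main: "sC d * ((1 + ?d) * ?t) = (1 + ?d) * ?t * (if \<bar>d\<bar> = \<bar>a\<bar> then - sC d else sC d)"
    if "\<bar>d\<bar> \<noteq> \<bar>a\<bar> \<and> \<bar>d\<bar> \<noteq> \<bar>b\<bar> \<or> d = a \<or> d = b" "d \<noteq> 0" for d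
  proof -
    from that(1) show ?thesis
    proof (elim disjE conjE)
      assume 1: "\<bar>d\<bar> \<noteq> \<bar>a\<bar>" "\<bar>d\<bar> \<noteq> \<bar>b\<bar>"
      have "sC d * (sC b * sC a) = - (sC b * sC d) * sC a"
        by (simp only: mult.assoc[symmetric] signed_opC_opC[OF 1(2)])
      also have "\<dots> = - (sC b * (sC d * sC a))" by (simp only: mult_minus_left mult.assoc)
      also have "\<dots> = sC b * sC a * sC d"
        by (simp only: signed_opC_opC[OF 1(1)] mult_minus_right minus_minus mult.assoc)
      finally have "sC d * (1 + ?d) = (1 + ?d) * sC d"
        by (simp add: distrib_left distrib_right)
      moreover have "sC d * ?t = ?t * sC d"
        using assms that 1 by (auto simp: opW_opC sp_swap)
      ultimately have "sC d * ((1 + ?d) * ?t) = (1 + ?d) * ?t * sC d"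
        by (rule intertwine_mult)
      then show ?thesis using 1 by simp
    next
      assume 2: "d = a"
      have "?t * sC a = sC b * ?t" using assms by (simp add: opW_opC sp_swap)
      moreover have "sC a * (1 + ?d) = (1 + ?d) * - sC b"
        using ab by (simp add: distrib_left distrib_right)
      ultimately have "sC a * ((1 + ?d) * ?t) = (1 + ?d) * ?t * - sC a"
        by (intro intertwine_mult[of _ _ "- sC b"]) simp_all
      then show ?thesis using 2 by simp
    next
      assume 3: "d = b"
      have "?t * sC b = sC a * ?t" using assms by (simp add: opW_opC sp_swap)
      moreover have "sC b * (1 + ?d) = (1 + ?d) * sC a"
        using ab by (simp add: distrib_left distrib_right)
      ultimately have "sC b * ((1 + ?d) * ?t) = (1 + ?d) * ?t * sC b"
        by (intro intertwine_mult[of _ _ "sC a"]) simp_all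
      then show ?thesis using 3 assms by simp
    qed
  qed
  have "sC d * ((1 + ?d) * ?t) = (1 + ?d) * ?t * (if \<bar>d\<bar> = \<bar>a\<bar> then - sC d else sC d)"
  proof (cases "\<bar>d\<bar> \<noteq> \<bar>a\<bar> \<and> \<bar>d\<bar> \<noteq> \<bar>b\<bar> \<or> d = a \<or> d = b")
    case True
    then show ?thesis using main assms by blast
  next
    case False
    \<comment> \<open>Both sides are odd in c_d, so the remaining signs of d are reduced to d = a
      and d = b.\<close>
    then have "- d = a \<or> - d = b" by linarith
    with main[of "- d"] assms
    have "- sC d * ((1 + ?d) * ?t) = (1 + ?d) * ?t * (if \<bar>d\<bar> = \<bar>a\<bar> then sC d else - sC d)"
      by (simp only: signed_elt_minus[OF assms(4)] abs_minus_cancel minus_minus neg_equal_0_iff_equal) simp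
    then show ?thesis by (cases "\<bar>d\<bar> = \<bar>a\<bar>") (simp_all, metis minus_minus)
  qed
  then have "scalar (\<kappa> a b) * (sC d * ((1 + ?d) * ?t)) =
      scalar (\<kappa> a b) * ((1 + ?d) * ?t * (if \<bar>d\<bar> = \<bar>a\<bar> then - sC d else sC d))"
    by (rule arg_cong)
  then have "sC d * Q a b = Q a b * (if \<bar>d\<bar> = \<bar>a\<bar> then - sC d else sC d)"
    unfolding Q_def by (simp only: scalar_left_commute mult.assoc)
  then show ?thesis by (simp split: if_splits)
qed

end

context dunkl begin

text \<open>A bracket of y_b and x_a has to behave towards c_d like x_a alone, because y_b commutes
  with c_d. This is the compatibility of remainders in \<open>opY_opC\<close>.\<close>

lemma opC_bracket:
  assumes "b \<noteq> 0" "d \<noteq> 0"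
  shows "sC d * bracket b a = (if \<bar>d\<bar> = \<bar>a\<bar> then - bracket b a else bracket b a) * sC d"
proof -
  have diag: "sC d * diag b = (if \<bar>d\<bar> = \<bar>b\<bar> then - diag b else diag b) * sC d"
  proof -
    have "(\<Sum>k\<in>partners b. sC d * Q b k) = (\<Sum>k\<in>partners b. (if \<bar>d\<bar> = \<bar>b\<bar> then - Q b k else Q b k) * sC d)"
      by (rule sum.cong) (use assms in \<open>auto simp: partners_def opC_Q\<close>)
    then have 1: "sC d * (\<Sum>k\<in>partners b. Q b k) =
        (if \<bar>d\<bar> = \<bar>b\<bar> then - (\<Sum>k\<in>partners b. Q b k) else (\<Sum>k\<in>partners b. Q b k)) * sC d"
      by (simp add: sum_distrib_left sum_distrib_right sum_negf)
    have "opW (sp_flip b) * sC d = (if \<bar>d\<bar> = \<bar>b\<bar> then - sC d else sC d) * opW (sp_flip b)"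
      using assms by (simp add: opW_opC sp_flip signed_elt_minus)
    then have "sC d * opW (sp_flip b) = (if \<bar>d\<bar> = \<bar>b\<bar> then - opW (sp_flip b) else opW (sp_flip b)) * sC d"
      by (simp split: if_splits)
    then have "sC d * (scalar r * opW (sp_flip b)) =
        (if \<bar>d\<bar> = \<bar>b\<bar> then - (scalar r * opW (sp_flip b)) else scalar r * opW (sp_flip b)) * sC d"
      by (simp add: scalar_left_commute mult.assoc split: if_splits)
    with 1 show ?thesis
      by (cases "\<bar>d\<bar> = \<bar>b\<bar>") (simp_all add: diag_def distrib_left distrib_right right_diff_distrib left_diff_distrib)
  qed
  have bb: "sC d * bracket b b = (if \<bar>d\<bar> = \<bar>b\<bar> then - bracket b b else bracket b b) * sC d"
    using diag assms by (simp add: bracket_def)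
  consider "a = 0" | "a \<noteq> 0" "\<bar>a\<bar> \<noteq> \<bar>b\<bar>" | "a = b" | "a = - b" by linarith
  then show ?thesis
  proof cases
    case 1
    then show ?thesis by (simp add: bracket_def)
  next
    case 2
    have 1: "sC d * Q a b = (if \<bar>d\<bar> = \<bar>a\<bar> then - Q a b else Q a b) * sC d"
      and 2: "sC d * Q (- a) b = (if \<bar>d\<bar> = \<bar>a\<bar> then - Q (- a) b else Q (- a) b) * sC d"
      using opC_Q[of a b d] opC_Q[of "- a" b d] 2 assms by simp_all
    have D: "sC d * (Q a b - Q (- a) b) = (if \<bar>d\<bar> = \<bar>a\<bar> then - (Q a b - Q (- a) b) else Q a b - Q (- a) b) * sC d"
      unfolding right_diff_distrib 1 2
      by (cases "\<bar>d\<bar> = \<bar>a\<bar>") (simp_all add: left_diff_distrib)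
    have "bracket b a = Q a b - Q (- a) b \<or> bracket b a = 0"
      using \<open>\<bar>a\<bar> \<noteq> \<bar>b\<bar>\<close> by (simp add: bracket_def)
    then show ?thesis
    proof
      assume "bracket b a = Q a b - Q (- a) b"
      then show ?thesis using D by (simp only:)
    qed simp
  next
    case 3
    then show ?thesis using bb by simp
  next
    case 4
    show ?thesis unfolding 4 bracket_minus_right mult_minus_right bb
      by (cases "\<bar>d\<bar> = \<bar>b\<bar>") simp_all
  qed
qed

lemma bracket_0: "bracket b 0 = 0"
  by (simp add: bracket_def)

text \<open>The compatibility condition of \<open>extension\<close> includes the natural index 0.
  There the bracket itself vanishes, and the condition becomes that x_0, which is moved by no group
  element and commutes with the signed Clifford operators occurring here, commutes with all
  brackets.\<close>

lemma bracket_opX_0: "bracket b a * opX 0 = opX 0 * bracket b a"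
proof -
  have sC: "sC a * opX 0 = opX 0 * sC a" if "a \<noteq> 0" for a
    using signed_opC_opX'[OF that, of 0] that by simp
  have W: "opW w * opX 0 = opX 0 * opW w" for w
    using opW_opX'[of w 0] by (simp add: signed_elt_def)
  have Q: "Q a b * opX 0 = opX 0 * Q a b" if "a \<noteq> 0" "b \<noteq> 0" for a b
  proof -
    have "sC b * sC a * opX 0 = opX 0 * (sC b * sC a)"
      by (simp only: mult.assoc sC[OF that(1)]) (simp only: mult.assoc[symmetric] sC[OF that(2)])
    then have "(1 + sC b * sC a) * opX 0 = opX 0 * (1 + sC b * sC a)"
      by (simp add: distrib_left distrib_right)
    then have "opX 0 * ((1 + sC b * sC a) * opW (sp_swap a b)) = (1 + sC b * sC a) * opW (sp_swap a b) * opX 0"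
      by (intro intertwine_mult[of _ _ "opX 0"]) (simp_all only: W)
    then show ?thesis unfolding Q_def by (simp only: scalar_left_commute mult.assoc)
  qed
  have "diag a * opX 0 = opX 0 * diag a" if "a \<noteq> 0" for a
  proof -
    have "(\<Sum>k\<in>partners a. Q a k * opX 0) = (\<Sum>k\<in>partners a. opX 0 * Q a k)"
      by (rule sum.cong) (use that Q in \<open>auto simp: partners_def\<close>)
    moreover have "scalar r * opW (sp_flip a) * opX 0 = opX 0 * (scalar r * opW (sp_flip a))"
      by (simp only: scalar_left_commute mult.assoc W)
    ultimately show ?thesis
      by (simp add: diag_def left_diff_distrib right_diff_distrib sum_distrib_left sum_distrib_right)
  qed
  then show ?thesis using Q[of a b] Q[of "- a" b]
    by (auto simp: bracket_def left_diff_distrib right_diff_distrib)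
qed

text \<open>At \<alpha> = 0, y_j w' c^E y^\<gamma> = w' c^E y_k y^\<gamma> with k the signed index
  w'^{-1}(j): y changes its index when passing the group element and commutes with the Clifford
  part. The remainder past x_i is the prescribed bracket.\<close>

definition opY :: "nat \<Rightarrow> hc_op" where
  "opY j = extension opX (\<lambda>i. bracket (int j) (int i))
     (\<lambda>F (w', E, \<gamma>). let k = sp (sp_inv w') (int j) in
        of_int (sgn k) * F ({#}, w', E, add_mset (nat \<bar>k\<bar>) \<gamma>))"

abbreviation "sY \<equiv> signed_elt opY"

lemma opY_opX': "j > 0 \<Longrightarrow> opY j * opX i = opX i * opY j + bracket (int j) (int i)"
  and opY_base: "j > 0 \<Longrightarrow> app (opY j) F ({#}, w', E, \<gamma>) = (let k = sp (sp_inv w') (int j) in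
        of_int (sgn k) * F ({#}, w', E, add_mset (nat \<bar>k\<bar>) \<gamma>))"
proof -
  note E = extension[of "\<lambda>F (w', E, \<gamma>). let k = sp (sp_inv w') (int j) in
        of_int (sgn k) * F ({#}, w', E, add_mset (nat \<bar>k\<bar>) \<gamma>)"
      opX "\<lambda>i. bracket (int j) (int i)", folded opY_def, OF _ shift_commute]
  \<comment> \<open>The compatibility of remainders required by \<open>extension\<close>; for
    nonzero distinct indices it is the Jacobi identity in rearranged form.\<close>
  have J: "opX i * bracket (int j) (int k) + bracket (int j) (int i) * opX k =
      opX k * bracket (int j) (int i) + bracket (int j) (int k) * opX i" if j: "j > 0" for i k
  proof -
    consider "i = k" | "i = 0" | "k = 0" | "i > 0" "k > 0" "i \<noteq> k" by blast
    then show ?thesis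
    proof cases
      case 4
      then show ?thesis
        using bracket_jacobi_xx[of "int j" "int i" "int k"] j by (simp add: algebra_simps)
    qed (simp_all add: bracket_0 bracket_opX_0)
  qed
  show "opY j * opX i = opX i * opY j + bracket (int j) (int i)" if "j > 0"
    by (rule E(1)) (auto simp: Let_def algebra_simps J[OF that])
  show "app (opY j) F ({#}, w', E, \<gamma>) = (let k = sp (sp_inv w') (int j) in
        of_int (sgn k) * F ({#}, w', E, add_mset (nat \<bar>k\<bar>) \<gamma>))" if "j > 0"
    by (subst E(2)) (auto simp: Let_def algebra_simps J[OF that])
qed

lemma opY_sX: 
  assumes "j > 0" shows "opY j * sX a = sX a * opY j + bracket (int j) a"
proof (cases a rule: signed_elt_cases)
  case (1 i)
  then show ?thesis using assms by (simp add: opY_opX')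
next
  case (2 i)
  then show ?thesis using assms by (simp add: opY_opX' signed_elt_minus bracket_minus_right)
qed

lemma sY_sX: 
  assumes "b \<noteq> 0" shows "sY b * sX a = sX a * sY b + bracket b a"
proof (cases b rule: signed_elt_cases)
  case (1 i)
  then show ?thesis using assms by (simp add: opY_sX)
next
  case (2 i)
  then show ?thesis using assms by (simp add: opY_sX signed_elt_minus bracket_minus_left)
qed

end

section \<open>The relations between the operators y and the other generators\<close>

context dunkl begin

text \<open>The reflection exchanges z_a and z_b, and z commutes with the Clifford generators, so Q
  a b commutes with z_a + z_b. For k = i the difference of the two sides is [Q i j, z_i + z_j] -
  [Q i (-j), z_i - z_j], in which both commutators vanish.\<close>

lemma bracket_jacobi_yy:
  assumes ij: "i \<noteq> 0" "j \<noteq> 0" "\<bar>i\<bar> \<noteq> \<bar>j\<bar>" "\<bar>i\<bar> \<le> int n" "\<bar>j\<bar> \<le> int n"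
    and z: "intertwined z" "\<And>a b. a \<noteq> 0 \<Longrightarrow> b \<noteq> 0 \<Longrightarrow> sC a * z b = z b * sC a"
  shows "bracket j k * z i - z i * bracket j k = bracket i k * z j - z j * bracket i k"
proof -
  have Q: "Q a b * (z a + z b) = (z a + z b) * Q a b"
    if ab: "a \<noteq> 0" "b \<noteq> 0" "\<bar>a\<bar> \<noteq> \<bar>b\<bar>" "\<bar>a\<bar> \<le> int n" "\<bar>b\<bar> \<le> int n" for a b
  proof (cases "\<kappa> a b = 0")
    case False
    then have "equivariant (sp_swap a b)" by (intro equivariant_swap ab)
    then have "opW (sp_swap a b) * (z a + z b) = (z a + z b) * opW (sp_swap a b)"
      using z(1) ab unfolding intertwined_def by (simp add: sp_swap distrib_left distrib_right add.commute)
    moreover have "(z a + z b) * (1 + sC b * sC a) = (1 + sC b * sC a) * (z a + z b)"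
    proof -
      have "sC b * sC a * z d = z d * (sC b * sC a)" if "d \<noteq> 0" for d
        by (simp only: mult.assoc z(2)[OF ab(1) that]) (simp only: mult.assoc[symmetric] z(2)[OF ab(2) that])
      then show ?thesis using ab by (simp add: distrib_left distrib_right)
    qed
    ultimately have "(z a + z b) * ((1 + sC b * sC a) * opW (sp_swap a b)) =
        (1 + sC b * sC a) * opW (sp_swap a b) * (z a + z b)"
      by (intro intertwine_mult[of _ _ "z a + z b"]) simp_all
    then show ?thesis unfolding Q_def by (simp only: scalar_left_commute mult.assoc)
  qed (simp add: Q_def scalar_simps)
  have main: "bracket j i * z i - z i * bracket j i = bracket i i * z j - z j * bracket i i"
    if "i \<noteq> 0" "j \<noteq> 0" "\<bar>i\<bar> \<noteq> \<bar>j\<bar>" "\<bar>i\<bar> \<le> int n" "\<bar>j\<bar> \<le> int n" for i j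
  proof -
    have "z (- j) = - z j" using z(1) that unfolding intertwined_def by blast
    then have 1: "Q i j * (z i + z j) = (z i + z j) * Q i j"
      and 2: "Q i (- j) * (z i - z j) = (z i - z j) * Q i (- j)"
      using Q[of i j] Q[of i "- j"] that by simp_all
    have 3: "Q (- i) j = Q i (- j)" using Q_minus[of i "- j"] that by simp
    have 4: "bracket i i * z j - z j * bracket i i = - ((Q i j + Q i (- j)) * z j - z j * (Q i j + Q i (- j)))"
      using diag_bracket[OF z(1), of i j] that by (simp add: bracket_def)
    have 5: "bracket j i = Q i j - Q i (- j)" using that by (simp add: bracket_def 3)
    show ?thesis unfolding 4 5 using 1 2 by (simp add: algebra_simps)
  qed
  have zm: "z (- i) = - z i" "z (- j) = - z j" using z(1) ij unfolding intertwined_def by blast+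
  consider "k = 0" | "k \<noteq> 0" "\<bar>k\<bar> \<noteq> \<bar>i\<bar>" "\<bar>k\<bar> \<noteq> \<bar>j\<bar>" | "k = i" | "k = - i" | "k = j" | "k = - j" by linarith
  then show ?thesis
  proof cases
    case 1
    then show ?thesis by (simp add: bracket_0)
  next
    case 2
    then show ?thesis using ij by (simp add: bracket_commute[OF z(1)])
  next
    case 3
    then show ?thesis using main[of i j] ij by simp
  next
    case 4
    have "bracket j i * z i - z i * bracket j i = bracket i i * z j - z j * bracket i i"
      using main[of i j] ij by simp
    then show ?thesis
      unfolding 4 bracket_minus_right mult_minus_left mult_minus_right minus_diff_minus by simp
  next
    case 5
    then show ?thesis using main[of j i] ij by simp
  next
    case 6
    have "bracket i j * z j - z j * bracket i j = bracket j j * z i - z i * bracket j j"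
      using main[of j i] ij by simp
    then show ?thesis
      unfolding 6 bracket_minus_right mult_minus_left mult_minus_right minus_diff_minus by simp
  qed
qed

text \<open>Past x_i both products have the remainder c_k [y_j, x_i]: for c_k y_j this is immediate,
  for y_j c_k it is the sign rule \<open>opC_bracket\<close>. At \<alpha> = 0 the two operators act
  on different components, E and \<gamma>.\<close>

lemma opY_opC:
  assumes "j > 0" "k > 0"
  shows "opY j * opC k = opC k * opY j"
proof (rule lin_op_eq_by_shift[where x' = "\<lambda>i. if i = k then - opX i else opX i"
      and R = "\<lambda>i. opC k * bracket (int j) (int i)"])
  fix i
  have B: "opC k * bracket (int j) (int i) = (if i = k then - bracket (int j) (int i) else bracket (int j) (int i)) * opC k"
    using opC_bracket[of "int j" "int k" "int i"] assms by auto
  have "opY j * opC k * opX i = opY j * (if i = k then - opX i else opX i) * opC k"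
    by (simp only: mult.assoc opC_opX')
  also have "\<dots> = (if i = k then - opX i else opX i) * (opY j * opC k) +
     (if i = k then - bracket (int j) (int i) else bracket (int j) (int i)) * opC k"
    using assms by (cases "i = k") (simp_all add: opY_opX' distrib_right left_diff_distrib mult.assoc)
  finally show "opY j * opC k * opX i = (if i = k then - opX i else opX i) * (opY j * opC k) +
     opC k * bracket (int j) (int i)" by (simp only: B)
  have "opC k * opY j * opX i = (opC k * opX i) * opY j + opC k * bracket (int j) (int i)"
    by (simp only: mult.assoc opY_opX'[OF assms(1)] distrib_left)
  then show "opC k * opY j * opX i = (if i = k then - opX i else opX i) * (opC k * opY j) +
     opC k * bracket (int j) (int i)"
    by (simp only: opC_opX' mult.assoc)
next
  fix F and m :: basis_tail
  obtain w E \<gamma> where "m = (w, E, \<gamma>)" by (cases m)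
  then show "app (opY j * opC k) F ({#}, m) = app (opC k * opY j) F ({#}, m)"
    using assms by (simp add: opY_base opC_base Let_def)
qed

lemma sY_base:
  assumes "a \<noteq> 0"
  shows "app (sY a) F ({#}, w, E, \<gamma>) = (let k = sp (sp_inv w) a in
    of_int (sgn k) * F ({#}, w, E, add_mset (nat \<bar>k\<bar>) \<gamma>))"
proof (cases a rule: signed_elt_cases)
  case (1 i)
  then show ?thesis using assms by (simp add: opY_base)
next
  case (2 i)
  then show ?thesis by (simp add: opY_base signed_elt_minus Let_def)
qed

lemma opW_opY':
  assumes w: "equivariant w" and j: "j > 0"
  shows "opW w * opY j = sY (sp w (int j)) * opW w"
proof (rule lin_op_eq_by_shift[where x' = "\<lambda>i. sX (sp w (int i))"
      and R = "\<lambda>i. opW w * bracket (int j) (int i)"])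
  fix i
  have wj: "sp w (int j) \<noteq> 0" using j by simp
  have "opW w * opY j * opX i = opW w * opX i * opY j + opW w * bracket (int j) (int i)"
    by (simp only: mult.assoc opY_opX'[OF j] distrib_left)
  then show "opW w * opY j * opX i = sX (sp w (int i)) * (opW w * opY j) + opW w * bracket (int j) (int i)"
    by (simp only: opW_opX' mult.assoc)
  have "sY (sp w (int j)) * opW w * opX i = sY (sp w (int j)) * sX (sp w (int i)) * opW w"
    by (simp only: opW_opX' mult.assoc)
  also have "\<dots> = sX (sp w (int i)) * (sY (sp w (int j)) * opW w) + bracket (sp w (int j)) (sp w (int i)) * opW w"
    by (simp only: sY_sX[OF wj] distrib_right mult.assoc)
  finally show "sY (sp w (int j)) * opW w * opX i =
      sX (sp w (int i)) * (sY (sp w (int j)) * opW w) + opW w * bracket (int j) (int i)"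
    by (simp only: opW_bracket[OF w])
next
  fix F and m :: basis_tail
  obtain w' E \<gamma> where "m = (w', E, \<gamma>)" by (cases m)
  then show "app (opW w * opY j) F ({#}, m) = app (sY (sp w (int j)) * opW w) F ({#}, m)"
    using j by (simp add: opY_base sY_base opW_base Let_def)
qed

lemma sC_sY: "a \<noteq> 0 \<Longrightarrow> b \<noteq> 0 \<Longrightarrow> sC a * sY b = sY b * sC a"
  by (auto simp: signed_elt_def opY_opC)

lemma opW_opY: "equivariant w \<Longrightarrow> a \<noteq> 0 \<Longrightarrow> opW w * sY a = sY (sp w a) * opW w"
  by (cases a rule: signed_elt_cases) (auto simp: opW_opY' signed_elt_minus)

lemma intertwined_sY: "intertwined sY"
  unfolding intertwined_def by (auto simp: opW_opY sC_sY signed_elt_minus)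

lemma opY_opY:
  assumes "i \<in> {1..n}" "j \<in> {1..n}"
  shows "opY i * opY j = opY j * opY i"
proof (cases "i = j")
  case False
  show ?thesis
  proof (rule lin_op_eq_by_shift[where x' = opX
      and R = "\<lambda>k. bracket (int i) (int k) * opY j + opY i * bracket (int j) (int k)"])
    fix k
    have step: "opY i * opY j * opX k = opX k * (opY i * opY j) + (bracket (int i) (int k) * opY j + opY i * bracket (int j) (int k))"
      if "i > 0" "j > 0" for i j
    proof -
      have "opY i * opY j * opX k = opY i * opX k * opY j + opY i * bracket (int j) (int k)"
        by (simp only: mult.assoc opY_opX'[OF that(2)] distrib_left)
      then show ?thesis by (simp only: opY_opX'[OF that(1)] distrib_right mult.assoc add.assoc)
    qed
    show "opY i * opY j * opX k = opX k * (opY i * opY j) + (bracket (int i) (int k) * opY j + opY i * bracket (int j) (int k))"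
      using step assms by simp
    have "bracket (int i) (int k) * opY j + opY i * bracket (int j) (int k) =
        bracket (int j) (int k) * opY i + opY j * bracket (int i) (int k)"
      using bracket_jacobi_yy[OF _ _ _ _ _ intertwined_sY sC_sY, of "int i" "int j" "int k"] assms False
      by (simp add: algebra_simps)
    then show "opY j * opY i * opX k = opX k * (opY j * opY i) + (bracket (int i) (int k) * opY j + opY i * bracket (int j) (int k))"
      using step[of j i] assms by simp
  next
    fix F and m :: basis_tail
    obtain w' E \<gamma> where "m = (w', E, \<gamma>)" by (cases m)
    then show "app (opY i * opY j) F ({#}, m) = app (opY j * opY i) F ({#}, m)"
      using assms by (simp add: opY_base Let_def add_mset_commute)
  qed
qed simp

end

section \<open>The algebra of operators\<close>

definition op_algebra :: "(complex, 'k lin_op) module" where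
  "op_algebra = \<lparr>carrier = UNIV, monoid.mult = (*), one = 1, ring.zero = 0, ring.add = (+),
     module.smult = (\<lambda>a D. scalar a * D)\<rparr>"

lemma op_algebra_simps [simp]:
  "carrier op_algebra = UNIV" "D \<otimes>\<^bsub>op_algebra\<^esub> E = D * E" "\<one>\<^bsub>op_algebra\<^esub> = 1"
  "\<zero>\<^bsub>op_algebra\<^esub> = 0" "D \<oplus>\<^bsub>op_algebra\<^esub> E = D + E" "a \<odot>\<^bsub>op_algebra\<^esub> D = scalar a * D"
  by (simp_all add: op_algebra_def)

lemma complex_algebra_op_algebra: "complex_algebra (op_algebra :: (complex, 'k lin_op) module)"
proof -
  have "ring (op_algebra :: (complex, 'k lin_op) module)"
  proof (rule ringI)
    show "abelian_group (op_algebra :: (complex, 'k lin_op) module)"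
    proof (rule abelian_groupI)
      fix D :: "'k lin_op"
      show "\<exists>E\<in>carrier op_algebra. E \<oplus>\<^bsub>op_algebra\<^esub> D = \<zero>\<^bsub>op_algebra\<^esub>"
        by (rule bexI[of _ "- D"]) simp_all
    qed (simp_all add: ac_simps)
    show "Group.monoid (op_algebra :: (complex, 'k lin_op) module)" by (rule monoidI) (simp_all add: mult.assoc)
  qed (simp_all add: algebra_simps)
  then interpret ring "op_algebra :: (complex, 'k lin_op) module" .
  show ?thesis
    by unfold_locales (simp_all add: scalar_simps distrib_left distrib_right mult.assoc, rule scalar_left_commute)
qed

lemma op_algebra_minus [simp]:
  "\<ominus>\<^bsub>op_algebra\<^esub> D = - D" "D \<ominus>\<^bsub>op_algebra\<^esub> E = D - E"
proof -
  interpret complex_algebra op_algebra by (rule complex_algebra_op_algebra)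
  show neg: "\<ominus>\<^bsub>op_algebra\<^esub> D = - D" for D
    by (rule minus_equality) simp_all
  show "D \<ominus>\<^bsub>op_algebra\<^esub> E = D - E" by (simp add: a_minus_def neg)
qed

lemma op_algebra_finsum [simp]:
  "finite S \<Longrightarrow> (\<Oplus>\<^bsub>op_algebra\<^esub>k\<in>S. f k) = (\<Sum>k\<in>S. f k)"
proof -
  interpret complex_algebra op_algebra by (rule complex_algebra_op_algebra)
  show "finite S \<Longrightarrow> ?thesis" by (induction S rule: finite_induct) simp_all
qed

lemma op_algebra_pow [simp]: "D [^]\<^bsub>op_algebra\<^esub> (k :: nat) = D ^ k"
proof -
  interpret complex_algebra op_algebra by (rule complex_algebra_op_algebra)
  show ?thesis by (induction k) (simp_all add: power_commutes)
qed

lemma op_algebra_signed [simp]: "signed op_algebra z k = signed_elt z k"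
  by (simp add: signed_def signed_elt_def)

section \<open>The Weyl groups and the parameters of the three types\<close>

definition as_sp :: "(int \<Rightarrow> int) \<Rightarrow> signed_perm" where "as_sp w = Abs_signed_perm w"

lemma sp_as_sp: "w \<in> signed_permutations n \<Longrightarrow> sp (as_sp w) = w"
  unfolding as_sp_def by (rule Abs_signed_perm_inverse) (auto dest: signed_permutationsD)

lemma as_sp_id: "as_sp id = sp_id"
  by (rule sp_eqI) (simp add: sp_as_sp[OF id_signed_permutation])

lemma as_sp_comp:
  "v \<in> signed_permutations n \<Longrightarrow> w \<in> signed_permutations n \<Longrightarrow> as_sp (v \<circ> w) = sp_comp (as_sp v) (as_sp w)"
  by (rule sp_eqI) (simp add: sp_as_sp[of _ n] signed_permutations_comp)

lemma sp_swap_eq_s_refl: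
  assumes "i \<noteq> j" "i \<in> {1..n}" "j \<in> {1..n}"
  shows "as_sp (s_refl i j) = sp_swap (int i) (int j)"
  using assms weyl_group_signed[OF s_refl_closed[OF assms]]
  by (intro sp_eqI) (auto simp: sp_as_sp s_refl_apply sp_swap)

lemma sp_swap_eq_sbar_refl:
  assumes "i \<noteq> j" "i \<in> {1..n}" "j \<in> {1..n}"
  shows "as_sp (sbar_refl i j) = sp_swap (int i) (- int j)"
  using assms weyl_group_signed[OF sbar_refl_closed[OF assms, of TypeB]]
  by (intro sp_eqI) (auto simp: sp_as_sp sbar_refl_apply sp_swap)

lemma sp_flip_eq_tau_refl:
  assumes "i \<in> {1..n}"
  shows "as_sp (tau_refl i) = sp_flip (int i)"
  using assms weyl_group_signed[OF tau_refl_closed[OF assms]]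
  by (intro sp_eqI) (auto simp: sp_as_sp tau_refl_apply sp_flip)

definition hc_\<kappa> :: "weyl_type \<Rightarrow> complex \<Rightarrow> int \<Rightarrow> int \<Rightarrow> complex" where
  "hc_\<kappa> T u a b = (if T = TypeA \<and> sgn a * sgn b \<noteq> 1 then 0 else u)"

definition hc_r :: "weyl_type \<Rightarrow> complex \<Rightarrow> complex" where
  "hc_r T v = (if T = TypeB then complex_of_real (sqrt 2) * v else 0)"

text \<open>In type A a nonzero weight means that a and b have equal signs, so their swap preserves
  the sign of every index and hence all weights. In types B and D the weight is constant, and r is
  nonzero only in type B.\<close>

lemma dunkl_hc: "dunkl (hc_\<kappa> T u) (hc_r T v)"
proof
  fix a b c d :: int
  show "hc_\<kappa> T u a b = hc_\<kappa> T u b a" by (simp add: hc_\<kappa>_def mult.commute)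
  show "hc_\<kappa> T u (- a) (- b) = hc_\<kappa> T u a b" by (simp add: hc_\<kappa>_def)
  show "hc_\<kappa> T u (sp (sp_swap a b) c) (sp (sp_swap a b) d) = hc_\<kappa> T u c d"
    if "a \<noteq> 0" "b \<noteq> 0" "\<bar>a\<bar> \<noteq> \<bar>b\<bar>" "hc_\<kappa> T u a b \<noteq> 0"
  proof (cases "T = TypeA")
    case True
    then have "sgn a = sgn b" using that by (auto simp: hc_\<kappa>_def sgn_if split: if_splits)
    then have "sgn (sp (sp_swap a b) c) = sgn c" for c
      using that(1-3) by (simp add: sp_swap)
    then show ?thesis by (simp add: hc_\<kappa>_def)
  qed (simp add: hc_\<kappa>_def)
  show "hc_\<kappa> T u (sp (sp_flip a) c) (sp (sp_flip a) d) = hc_\<kappa> T u c d" if "hc_r T v \<noteq> 0"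
    using that by (simp add: hc_r_def hc_\<kappa>_def split: if_splits)
qed

lemma equivariant_weyl:
  assumes w: "w \<in> carrier (weyl_group T n)"
  shows "dunkl.equivariant n (hc_\<kappa> T u) (as_sp w)"
proof -
  interpret dunkl n "hc_\<kappa> T u" "hc_r T 0" by (rule dunkl_hc)
  note W = signed_permutationsD[OF weyl_group_signed[OF w]]
  have "hc_\<kappa> T u (w a) (w b) = hc_\<kappa> T u a b" for a b
  proof (cases "T = TypeA")
    case True
    have pos: "w a > 0" if "a \<in> {1..int n}" for a using w True that by (simp add: weyl_group_def)
    have "sgn (w a) = sgn a" for a
    proof -
      consider "\<not> \<bar>a\<bar> \<le> int n" | "a = 0" | "a \<in> {1..int n}" | "- a \<in> {1..int n}" by fastforce
      then show ?thesis
      proof cases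
        case 3
        then show ?thesis using pos[OF 3] by simp
      next
        case 4
        then show ?thesis using pos[OF 4] W(1)[of a] by simp
      qed (simp_all add: W(4,7))
    qed
    then show ?thesis by (simp add: hc_\<kappa>_def)
  qed (simp add: hc_\<kappa>_def)
  then show ?thesis by (simp add: equivariant_def sp_as_sp[OF weyl_group_signed[OF w]] W(6))
qed

locale hc_representation =
  fixes T :: weyl_type and n :: nat and u v :: complex
begin

sublocale dunkl n "hc_\<kappa> T u" "hc_r T v" by (rule dunkl_hc)

abbreviation gW :: "(int \<Rightarrow> int) \<Rightarrow> hc_op" where "gW w \<equiv> opW (as_sp w)"

lemma partners_split:
  assumes "i \<in> {1..n}"
  shows "(\<Sum>k\<in>partners (int i). f k) = (\<Sum>k\<in>{1..n} - {i}. f (int k) + f (- int k))"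
proof -
  have "partners (int i) = int ` ({1..n} - {i}) \<union> (\<lambda>k. - int k) ` ({1..n} - {i})" (is "_ = ?R")
  proof (intro equalityI subsetI)
    fix k assume "k \<in> partners (int i)"
    then have k: "k \<noteq> 0" "\<bar>k\<bar> \<le> int n" "\<bar>k\<bar> \<noteq> int i" by (auto simp: partners_def)
    then have m: "nat \<bar>k\<bar> \<in> {1..n} - {i}" by auto
    have "k = int (nat \<bar>k\<bar>) \<or> k = - int (nat \<bar>k\<bar>)" by linarith
    then show "k \<in> ?R" using m by blast
  qed (auto simp: partners_def)
  moreover have "int ` ({1..n} - {i}) \<inter> (\<lambda>k. - int k) ` ({1..n} - {i}) = {}" by auto
  ultimately have "(\<Sum>k\<in>partners (int i). f k) =
      sum f (int ` ({1..n} - {i})) + sum f ((\<lambda>k. - int k) ` ({1..n} - {i}))"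
    by (simp add: sum.union_disjoint)
  also have "\<dots> = (\<Sum>k\<in>{1..n} - {i}. f (int k)) + (\<Sum>k\<in>{1..n} - {i}. f (- int k))"
    by (subst (1 2) sum.reindex) (auto intro: inj_onI)
  finally show ?thesis by (simp add: sum.distrib)
qed

lemma Q_pos:
  assumes "i \<in> {1..n}" "k \<in> {1..n}" "i \<noteq> k"
  shows "Q (int i) (int k) = scalar u * ((1 + opC k * opC i) * gW (s_refl k i))"
    and "Q (int i) (- int k) = (if T = TypeA then 0 else scalar u * ((1 - opC k * opC i) * gW (sbar_refl k i)))"
    and "Q (- int i) (int k) = (if T = TypeA then 0 else scalar u * ((1 - opC k * opC i) * gW (sbar_refl k i)))"
proof -
  have s: "as_sp (s_refl k i) = sp_swap (int i) (int k)"
    using sp_swap_eq_s_refl[of k i n] assms by (simp add: sp_swap_commute)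
  have b: "as_sp (sbar_refl k i) = sp_swap (int i) (- int k)" "as_sp (sbar_refl k i) = sp_swap (- int i) (int k)"
    using sp_swap_eq_sbar_refl[of k i n] sp_swap_minus[of "int k" "- int i"]
      sp_swap_commute[of "int k" "- int i"] sp_swap_commute[of "- int k" "int i"] assms by simp_all
  show "Q (int i) (int k) = scalar u * ((1 + opC k * opC i) * gW (s_refl k i))"
    using assms by (simp add: Q_def s hc_\<kappa>_def)
  show "Q (int i) (- int k) = (if T = TypeA then 0 else scalar u * ((1 - opC k * opC i) * gW (sbar_refl k i)))"
    using assms by (simp add: Q_def b(1) hc_\<kappa>_def signed_elt_minus scalar_simps)
  show "Q (- int i) (int k) = (if T = TypeA then 0 else scalar u * ((1 - opC k * opC i) * gW (sbar_refl k i)))"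
    using assms by (simp add: Q_def b(2) hc_\<kappa>_def signed_elt_minus scalar_simps)
qed

lemma sbar_refl_commute: "i \<noteq> j \<Longrightarrow> i > 0 \<Longrightarrow> j > 0 \<Longrightarrow> sbar_refl i j = sbar_refl j i"
  by (auto simp: sbar_refl_apply)

lemma s_refl_commute: "i \<noteq> j \<Longrightarrow> i > 0 \<Longrightarrow> j > 0 \<Longrightarrow> s_refl i j = s_refl j i"
  by (auto simp: s_refl_apply)

lemma representation_relations:
  assumes "(l, r) \<in> hecke_clifford_relations op_algebra T n u v opX opY opC gW"
  shows "l = r"
proof -
  have intertwine: "gW w * z i * gW (inv\<^bsub>weyl_group T n\<^esub> w) = signed_elt z (w (int i))"
    if w: "w \<in> carrier (weyl_group T n)" and eq: "gW w * z i = signed_elt z (w (int i)) * gW w" for w i and z :: "nat \<Rightarrow> hc_op"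
  proof -
    have "gW w * gW (inv\<^bsub>weyl_group T n\<^esub> w) = 1"
      using weyl_group_inv_into[OF w] w
      by (simp add: weyl_group_inv opW_comp as_sp_comp[symmetric, of _ n] weyl_group_signed as_sp_id opW_id)
    then show ?thesis by (simp add: eq mult.assoc)
  qed
  have spw: "sp (as_sp w) = w" if "w \<in> carrier (weyl_group T n)" for w
    using that by (intro sp_as_sp[of _ n] weyl_group_signed)
  have group: "l = r" if "(l, r) \<in> group_relations op_algebra T n gW" for l r
    using that unfolding group_relations_def
    by (auto simp: as_sp_id opW_id opW_comp as_sp_comp[of _ n] weyl_group_signed)
  have cliff: "l = r" if "(l, r) \<in> clifford_relations op_algebra n opC" for l r
    using that unfolding clifford_relations_def by (auto simp: opC_square intro: opC_opC)
  have comm: "l = r" if "(l, r) \<in> commutation_relations op_algebra n opX opY opC" for l r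
    using that unfolding commutation_relations_def
    by (auto simp: shift_commute opC_opX' intro: opY_opY opY_opC)
  have conj: "l = r" if "(l, r) \<in> conjugation_relations op_algebra T n gW opX \<union>
      conjugation_relations op_algebra T n gW opY \<union> conjugation_relations op_algebra T n gW opC" for l r
  proof -
    have "gW w * opX i * gW (inv\<^bsub>weyl_group T n\<^esub> w) = sX (w (int i))"
      "gW w * opY i * gW (inv\<^bsub>weyl_group T n\<^esub> w) = sY (w (int i))"
      "gW w * opC i * gW (inv\<^bsub>weyl_group T n\<^esub> w) = sC (w (int i))"
      if "w \<in> carrier (weyl_group T n)" "i \<in> {1..n}" for w i
    proof -
      have e: "gW w * opX i = sX (w (int i)) * gW w" "gW w * opY i = sY (w (int i)) * gW w"
        "gW w * opC i = sC (w (int i)) * gW w"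
        using that opW_opX'[of "as_sp w" i] opW_opY'[OF equivariant_weyl[OF that(1)], of i]
          opW_opC'[of i "as_sp w"] by (simp_all add: spw)
      show "gW w * opX i * gW (inv\<^bsub>weyl_group T n\<^esub> w) = sX (w (int i))"
        "gW w * opY i * gW (inv\<^bsub>weyl_group T n\<^esub> w) = sY (w (int i))"
        "gW w * opC i * gW (inv\<^bsub>weyl_group T n\<^esub> w) = sC (w (int i))"
        using e[THEN intertwine[OF that(1)]] by simp_all
    qed
    then show ?thesis using that unfolding conjugation_relations_def by auto
  qed
  have yx: "commutator op_algebra (opY j) (opX i) = bracket (int j) (int i)" if "j \<in> {1..n}" for i j
    using that by (simp add: commutator_def opY_opX')
  have off: "bracket (int j) (int i) = (case T of
        TypeA \<Rightarrow> scalar u * ((1 + opC j * opC i) * gW (s_refl j i))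
      | _ \<Rightarrow> scalar u * ((1 + opC j * opC i) * gW (s_refl i j) - (1 - opC j * opC i) * gW (sbar_refl i j)))"
    if ij: "i \<in> {1..n}" "j \<in> {1..n}" "i \<noteq> j" for i j
  proof -
    have "s_refl j i = s_refl i j" "sbar_refl j i = sbar_refl i j"
      using ij s_refl_commute sbar_refl_commute by auto
    moreover have "bracket (int j) (int i) = Q (int i) (int j) - Q (- int i) (int j)"
      using ij by (simp add: bracket_def)
    ultimately show ?thesis
      unfolding Q_pos[OF ij] by (simp add: right_diff_distrib split: weyl_type.split)
  qed
  have dg: "bracket (int i) (int i) = (case T of
        TypeA \<Rightarrow> - (scalar u * (\<Sum>k\<in>{1..n} - {i}. (1 + opC k * opC i) * gW (s_refl k i)))
      | TypeD \<Rightarrow> - (scalar u * (\<Sum>k\<in>{1..n} - {i}.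
          (1 + opC k * opC i) * gW (s_refl k i) + (1 - opC k * opC i) * gW (sbar_refl k i)))
      | TypeB \<Rightarrow> - (scalar u * (\<Sum>k\<in>{1..n} - {i}.
          (1 + opC k * opC i) * gW (s_refl k i) + (1 - opC k * opC i) * gW (sbar_refl k i)))
          - scalar (complex_of_real (sqrt 2) * v) * gW (tau_refl i))"
    if i: "i \<in> {1..n}" for i
  proof -
    have "(\<Sum>k\<in>{1..n} - {i}. Q (int i) (int k) + Q (int i) (- int k)) =
        (\<Sum>k\<in>{1..n} - {i}. scalar u * ((1 + opC k * opC i) * gW (s_refl k i)) +
          (if T = TypeA then 0 else scalar u * ((1 - opC k * opC i) * gW (sbar_refl k i))))"
      using i by (intro sum.cong refl) (simp add: Q_pos)
    moreover have "bracket (int i) (int i) =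
        - (\<Sum>k\<in>{1..n} - {i}. Q (int i) (int k) + Q (int i) (- int k)) - scalar (hc_r T v) * gW (tau_refl i)"
      using i by (simp add: bracket_def diag_def partners_split sp_flip_eq_tau_refl[OF i])
    ultimately show ?thesis
      by (simp add: sum_distrib_left distrib_left hc_r_def scalar_simps split: weyl_type.split)
  qed
  have br: "l = r" if lr: "(l, r) \<in> bracket_relations op_algebra T n u v opX opY opC gW" for l r
    using lr unfolding bracket_relations_def Let_def Un_iff mem_Collect_eq
  proof (elim disjE exE conjE)
    fix i j
    assume ij: "i \<in> {1..n}" "j \<in> {1..n}" "i \<noteq> j"
      and eq: "(l, r) = (commutator op_algebra (opY j) (opX i), case T of
          TypeA \<Rightarrow> u \<odot>\<^bsub>op_algebra\<^esub> ((\<one>\<^bsub>op_algebra\<^esub> \<oplus>\<^bsub>op_algebra\<^esub> opC j \<otimes>\<^bsub>op_algebra\<^esub> opC i) \<otimes>\<^bsub>op_algebra\<^esub> gW (s_refl j i))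
        | _ \<Rightarrow> u \<odot>\<^bsub>op_algebra\<^esub> ((\<one>\<^bsub>op_algebra\<^esub> \<oplus>\<^bsub>op_algebra\<^esub> opC j \<otimes>\<^bsub>op_algebra\<^esub> opC i) \<otimes>\<^bsub>op_algebra\<^esub> gW (s_refl i j) \<ominus>\<^bsub>op_algebra\<^esub>
            (\<one>\<^bsub>op_algebra\<^esub> \<ominus>\<^bsub>op_algebra\<^esub> opC j \<otimes>\<^bsub>op_algebra\<^esub> opC i) \<otimes>\<^bsub>op_algebra\<^esub> gW (sbar_refl i j)))"
    have "l = (case T of
        TypeA \<Rightarrow> scalar u * ((1 + opC j * opC i) * gW (s_refl j i))
      | _ \<Rightarrow> scalar u * ((1 + opC j * opC i) * gW (s_refl i j) - (1 - opC j * opC i) * gW (sbar_refl i j)))"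
      using eq yx[OF ij(2)] off[OF ij] by (simp only: prod.inject)
    then show "l = r" using eq by (cases T) simp_all
  next
    fix i
    assume i: "i \<in> {1..n}"
    assume "(l, r) = (commutator op_algebra (opY i) (opX i), case T of
        TypeA \<Rightarrow> \<ominus>\<^bsub>op_algebra\<^esub> (u \<odot>\<^bsub>op_algebra\<^esub> (\<Oplus>\<^bsub>op_algebra\<^esub>k\<in>{1..n} - {i}.
          (\<one>\<^bsub>op_algebra\<^esub> \<oplus>\<^bsub>op_algebra\<^esub> opC k \<otimes>\<^bsub>op_algebra\<^esub> opC i) \<otimes>\<^bsub>op_algebra\<^esub> gW (s_refl k i)))
      | TypeB \<Rightarrow> \<ominus>\<^bsub>op_algebra\<^esub> (u \<odot>\<^bsub>op_algebra\<^esub> (\<Oplus>\<^bsub>op_algebra\<^esub>k\<in>{1..n} - {i}.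
          (\<one>\<^bsub>op_algebra\<^esub> \<oplus>\<^bsub>op_algebra\<^esub> opC k \<otimes>\<^bsub>op_algebra\<^esub> opC i) \<otimes>\<^bsub>op_algebra\<^esub> gW (s_refl k i) \<oplus>\<^bsub>op_algebra\<^esub>
          (\<one>\<^bsub>op_algebra\<^esub> \<ominus>\<^bsub>op_algebra\<^esub> opC k \<otimes>\<^bsub>op_algebra\<^esub> opC i) \<otimes>\<^bsub>op_algebra\<^esub> gW (sbar_refl k i)))
          \<ominus>\<^bsub>op_algebra\<^esub> (complex_of_real (sqrt 2) * v) \<odot>\<^bsub>op_algebra\<^esub> gW (tau_refl i)
      | TypeD \<Rightarrow> \<ominus>\<^bsub>op_algebra\<^esub> (u \<odot>\<^bsub>op_algebra\<^esub> (\<Oplus>\<^bsub>op_algebra\<^esub>k\<in>{1..n} - {i}.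
          (\<one>\<^bsub>op_algebra\<^esub> \<oplus>\<^bsub>op_algebra\<^esub> opC k \<otimes>\<^bsub>op_algebra\<^esub> opC i) \<otimes>\<^bsub>op_algebra\<^esub> gW (s_refl k i) \<oplus>\<^bsub>op_algebra\<^esub>
          (\<one>\<^bsub>op_algebra\<^esub> \<ominus>\<^bsub>op_algebra\<^esub> opC k \<otimes>\<^bsub>op_algebra\<^esub> opC i) \<otimes>\<^bsub>op_algebra\<^esub> gW (sbar_refl k i))))"
    then show "l = r"
      unfolding yx[OF i] dg[OF i] prod.inject
      by (elim conjE, hypsubst) (simp only: op_algebra_simps op_algebra_minus op_algebra_finsum
          finite_Diff finite_atLeastAtMost)
  qed
  show ?thesis using assms group cliff comm conj br unfolding hecke_clifford_relations_def by blast
qed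


subsection \<open>Action of the monomials on the vacuum\<close>

definition exponent_mset :: "(nat \<Rightarrow> nat) \<Rightarrow> nat list \<Rightarrow> nat multiset" where
  "exponent_mset \<alpha> l = (\<Sum>i\<leftarrow>l. replicate_mset (\<alpha> i) i)"

definition op_monomial :: "(nat \<Rightarrow> hc_op) \<Rightarrow> (nat \<Rightarrow> nat) \<Rightarrow> nat list \<Rightarrow> hc_op" where
  "op_monomial z \<alpha> l = foldr (\<lambda>i a. z i ^ \<alpha> i * a) l 1"

lemma app_power_opX: "app (opX i ^ k) F (\<mu>, m) = F (\<mu> + replicate_mset k i, m)"
  by (induction k arbitrary: F \<mu>) (simp_all add: power_commutes[symmetric])

lemma app_monomial_opX: "app (op_monomial opX \<alpha> l) F (\<mu>, m) = F (\<mu> + exponent_mset \<alpha> l, m)"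
  by (induction l arbitrary: F \<mu>)
    (simp_all add: op_monomial_def exponent_mset_def app_power_opX ac_simps)

text \<open>At the identity of the group y_j neither changes its index nor acquires a sign. The
  y-monomial is the factor that meets the vacuum first, so this is the only case that
  occurs.\<close>

lemma app_power_opY:
  "j > 0 \<Longrightarrow> app (opY j ^ k) F ({#}, sp_id, E, \<mu>) = F ({#}, sp_id, E, \<mu> + replicate_mset k j)"
  by (induction k arbitrary: F \<mu>) (simp_all add: opY_base power_commutes[symmetric])

lemma app_monomial_opY:
  "(\<And>j. j \<in> set l \<Longrightarrow> j > 0) \<Longrightarrow>
    app (op_monomial opY \<alpha> l) F ({#}, sp_id, E, \<mu>) = F ({#}, sp_id, E, \<mu> + exponent_mset \<alpha> l)"
  by (induction l arbitrary: F \<mu>)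
    (simp_all add: op_monomial_def exponent_mset_def app_power_opY ac_simps)

text \<open>c_i w = w c_k with k = w^{-1}(i); this is the unsigned index of the generator after it
  has passed w. It relates the normal form with c before w to the module basis with w before
  c.\<close>

definition position :: "signed_perm \<Rightarrow> nat \<Rightarrow> nat" where
  "position w i = nat \<bar>sp (sp_inv w) (int i)\<bar>"

lemma position_inj: "position w i = position w j \<longleftrightarrow> i = j"
  by (simp add: position_def eq_nat_nat_iff)

text \<open>Distinct indices have distinct positions, so each generator enlarges the set and none
  cancels. The accumulated sign only has to be nonzero.\<close>

lemma app_monomial_opC:
  assumes "distinct l" "\<And>i. i \<in> set l \<Longrightarrow> i > 0 \<and> \<epsilon> i \<in> {0, 1}"
  shows "\<exists>s\<noteq>0. \<forall>F. app (op_monomial opC \<epsilon> l) F ({#}, w, {}, \<gamma>) =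
    s * F ({#}, w, position w ` {i \<in> set l. \<epsilon> i = 1}, \<gamma>)"
  using assms
proof (induction l)
  case Nil
  then show ?case by (intro exI[of _ 1]) (simp add: op_monomial_def)
next
  case (Cons i l)
  let ?E = "position w ` {i \<in> set l. \<epsilon> i = 1}"
  obtain s where s: "s \<noteq> 0" "\<And>F. app (op_monomial opC \<epsilon> l) F ({#}, w, {}, \<gamma>) = s * F ({#}, w, ?E, \<gamma>)"
    using Cons by auto
  have red: "app (op_monomial opC \<epsilon> (i # l)) F ({#}, w, {}, \<gamma>) = s * app (opC i ^ \<epsilon> i) F ({#}, w, ?E, \<gamma>)" for F
    using s(2) by (simp add: op_monomial_def)
  have i: "i > 0" "\<epsilon> i = 0 \<or> \<epsilon> i = 1" "i \<notin> set l" using Cons.prems by auto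
  from i(2) show ?case
  proof
    assume "\<epsilon> i = 0"
    then have "{j \<in> set (i # l). \<epsilon> j = 1} = {j \<in> set l. \<epsilon> j = 1}" by auto
    then show ?thesis using s(1) red \<open>\<epsilon> i = 0\<close> by (intro exI[of _ s]) (simp del: set_simps)
  next
    assume e: "\<epsilon> i = 1"
    then have "{j \<in> set (i # l). \<epsilon> j = 1} = insert i {j \<in> set l. \<epsilon> j = 1}" by auto
    moreover have "position w i \<notin> ?E" using i(3) by (auto simp: position_inj)
    ultimately have E: "position w ` {j \<in> set (i # l). \<epsilon> j = 1} = toggle (position w i) ?E"
      by (simp add: toggle_def del: set_simps)
    let ?t = "of_int (sgn (sp (sp_inv w) (int i))) * clifford_sign (position w i) ?E"
    have "?t \<noteq> 0" using i(1) by (simp add: sgn_if)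
    then show ?thesis unfolding E using s(1) red e
      by (intro exI[of _ "s * ?t"]) (simp add: opC_base Let_def position_def mult.assoc del: set_simps)
  qed
qed

end

section \<open>The basis theorem\<close>

lemma ordered_monomial_hom:
  assumes "complex_algebra A" "complex_algebra B" "algebra_hom A B h"
    and z: "\<And>i. i \<in> {1..n} \<Longrightarrow> z i \<in> carrier A"
  shows "h (ordered_monomial A n z \<alpha>) = ordered_monomial B n (\<lambda>i. h (z i)) \<alpha>"
proof -
  interpret A: complex_algebra A by fact
  interpret B: complex_algebra B by fact
  note h = algebra_homD[OF assms(3)] linear_mapD(1)[OF algebra_homD(1)[OF assms(3)]]
  have pow: "h (a [^]\<^bsub>A\<^esub> (k :: nat)) = h a [^]\<^bsub>B\<^esub> k" if "a \<in> carrier A" for a k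
    using that by (induction k) (simp_all add: h)
  have "h (A.partial_monomial z \<alpha> l) = B.partial_monomial (\<lambda>i. h (z i)) \<alpha> l" if "set l \<subseteq> {1..n}" for l
    using that
  proof (induction l)
    case (Cons i l)
    have "z i \<in> carrier A" "A.partial_monomial z \<alpha> l \<in> carrier A"
      by (rule z, use Cons in simp) (rule A.partial_monomial_closed, use z Cons in auto)
    then show ?case using Cons
      by (simp add: A.partial_monomial_def B.partial_monomial_def h pow)
  qed (simp add: A.partial_monomial_def B.partial_monomial_def h)
  then show ?thesis unfolding A.ordered_monomial_eq B.ordered_monomial_eq
    by (simp del: upt_Suc add: atLeastLessThanSuc_atLeastAtMost)
qed

lemma ordered_monomial_cong:
  "(\<And>i. i \<in> {1..n} \<Longrightarrow> z i = z' i) \<Longrightarrow> ordered_monomial A n z \<alpha> = ordered_monomial A n z' \<alpha>"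
  unfolding ordered_monomial_def by (intro foldr_cong) auto

definition hc_index :: "weyl_type \<Rightarrow> nat \<Rightarrow> ((nat \<Rightarrow> nat) \<times> (nat \<Rightarrow> nat) \<times> (int \<Rightarrow> int) \<times> (nat \<Rightarrow> nat)) set" where
  "hc_index T n = ({1..n} \<rightarrow>\<^sub>E UNIV) \<times> ({1..n} \<rightarrow>\<^sub>E {0, 1}) \<times> carrier (weyl_group T n) \<times> ({1..n} \<rightarrow>\<^sub>E UNIV)"

definition hc_basis where
  "hc_basis T n u v = (\<lambda>(\<alpha>, \<epsilon>, w, \<gamma>). let H = hecke_clifford T n u v in
     x_monomial T n u v \<alpha> \<otimes>\<^bsub>H\<^esub> c_monomial T n u v \<epsilon> \<otimes>\<^bsub>H\<^esub> hc_w T n u v w \<otimes>\<^bsub>H\<^esub> y_monomial T n u v \<gamma>)"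

section \<open>The presented algebra, its spanning monomials and its representation\<close>

context hc_representation begin

abbreviation "Gen \<equiv> hc_generators T n"
abbreviation "Free \<equiv> free_algebra Gen"
abbreviation "H \<equiv> hecke_clifford T n u v"
abbreviation "Rel \<equiv> hc_relations T n u v"

lemma hc_family_free:
  "hc_family Free T n (\<lambda>i. letter (GenX i)) (\<lambda>i. letter (GenY i)) (\<lambda>i. letter (GenC i)) (\<lambda>w. letter (GenW w))"
  by (intro hc_family.intro hc_family_axioms.intro complex_algebra_free_algebra letter_closed)
    (auto simp: hc_generators_def)

lemma Rel_subset: "Rel \<subseteq> carrier Free \<times> carrier Free"
  unfolding hc_relations_def
  by (rule hecke_clifford_relations_hom(2)[OF hc_family_free complex_algebra_free_algebra[of Gen], where h = "\<lambda>p. p"])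
    (simp add: algebra_hom_def linear_map_def)

lemmas presented = complex_algebra_presented[OF Rel_subset, folded hecke_clifford_def]
  algebra_hom_class[OF Rel_subset, folded hecke_clifford_def]

lemma class_hom: "algebra_hom Free H (hc_class T n u v)"
  using presented(2) by (simp add: hc_class_def[abs_def])

lemma hc_algebra_H: "hc_algebra H T n (hc_x T n u v) (hc_y T n u v) (hc_c T n u v) (hc_w T n u v) u v"
proof -
  note cl = linear_mapD(1)[OF algebra_homD(1)[OF class_hom]]
  interpret F: hc_family Free T n "\<lambda>i. letter (GenX i)" "\<lambda>i. letter (GenY i)" "\<lambda>i. letter (GenC i)" "\<lambda>w. letter (GenW w)"
    by (rule hc_family_free)
  show ?thesis
  proof (intro hc_algebra.intro hc_family.intro hc_algebra_axioms.intro hc_family_axioms.intro presented(1))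
    fix l r
    assume "(l, r) \<in> hecke_clifford_relations H T n u v (hc_x T n u v) (hc_y T n u v) (hc_c T n u v) (hc_w T n u v)"
    then have "(l, r) \<in> map_prod (hc_class T n u v) (hc_class T n u v) ` Rel"
      using hecke_clifford_relations_hom(1)[OF hc_family_free presented(1) class_hom, of u v]
      by (simp add: hc_relations_def hc_x_def[abs_def] hc_y_def[abs_def] hc_c_def[abs_def] hc_w_def[abs_def])
    then obtain l' r' where lr: "(l', r') \<in> Rel" "l = hc_class T n u v l'" "r = hc_class T n u v r'" by auto
    show "l = r" using class_of_relation[OF Rel_subset lr(1)] lr(2,3) by (simp add: hc_class_def)
  qed (auto simp: hc_x_def hc_y_def hc_c_def hc_w_def intro!: cl F.x_closed F.y_closed F.c_closed F.g_closed)
qed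

sublocale H: hc_algebra H T n "hc_x T n u v" "hc_y T n u v" "hc_c T n u v" "hc_w T n u v" u v
  by (rule hc_algebra_H)

lemma carrier_subset_LX: "carrier H \<subseteq> H.LX"
proof -
  have gen: "complex_subspace H N \<Longrightarrow> \<one>\<^bsub>H\<^esub> \<in> N \<Longrightarrow>
      (\<And>s h. s \<in> Gen \<Longrightarrow> h \<in> N \<Longrightarrow> hc_class T n u v (letter s) \<otimes>\<^bsub>H\<^esub> h \<in> N) \<Longrightarrow> carrier H \<subseteq> N" for N
    using presented_generated[OF Rel_subset, folded hecke_clifford_def, of N] by (simp add: hc_class_def)
  show ?thesis
  proof (rule gen[OF H.subspaces(4)])
    show "\<one>\<^bsub>H\<^esub> \<in> H.LX" using H.basis_chain H.basis_spans by blast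
    fix s h assume "s \<in> Gen" "h \<in> H.LX"
    then show "hc_class T n u v (letter s) \<otimes>\<^bsub>H\<^esub> h \<in> H.LX"
      using H.x_LX H.y_LX H.c_LX H.g_LX
      by (auto simp: hc_generators_def hc_x_def hc_y_def hc_c_def hc_w_def)
  qed
qed

lemma monomial_closed:
  "x_monomial T n u v \<alpha> \<in> carrier H" "y_monomial T n u v \<alpha> \<in> carrier H" "c_monomial T n u v \<alpha> \<in> carrier H"
  unfolding x_monomial_def y_monomial_def c_monomial_def H.ordered_monomial_eq
  by (auto intro!: H.partial_monomial_closed H.x_closed H.y_closed H.c_closed simp del: upt_Suc)

lemma hc_basis_closed: "k \<in> hc_index T n \<Longrightarrow> hc_basis T n u v k \<in> carrier H"
  unfolding hc_index_def hc_basis_def Let_def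
  by (auto intro!: H.m_closed monomial_closed H.g_closed)

lemma X_basis_eq: "H.X_basis = hc_basis T n u v ` hc_index T n"
proof -
  have eq: "x_monomial T n u v \<alpha> \<otimes>\<^bsub>H\<^esub> (c_monomial T n u v \<epsilon> \<otimes>\<^bsub>H\<^esub> (hc_w T n u v w \<otimes>\<^bsub>H\<^esub>
      (y_monomial T n u v \<gamma> \<otimes>\<^bsub>H\<^esub> \<one>\<^bsub>H\<^esub>))) = hc_basis T n u v (\<alpha>, \<epsilon>, w, \<gamma>)"
    if "w \<in> carrier (weyl_group T n)" for \<alpha> \<epsilon> w \<gamma>
    using monomial_closed H.g_closed[OF that] by (simp add: hc_basis_def Let_def H.m_assoc)
  have "H.X_basis = {x_monomial T n u v \<alpha> \<otimes>\<^bsub>H\<^esub> (c_monomial T n u v \<epsilon> \<otimes>\<^bsub>H\<^esub> (hc_w T n u v w \<otimes>\<^bsub>H\<^esub>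
      (y_monomial T n u v \<gamma> \<otimes>\<^bsub>H\<^esub> \<one>\<^bsub>H\<^esub>))) | \<alpha> \<epsilon> w \<gamma>. (\<alpha>, \<epsilon>, w, \<gamma>) \<in> hc_index T n}"
    unfolding H.X_basis_def H.C_basis_def H.W_basis_def H.Y_basis_def H.monomials_def hc_index_def
      x_monomial_def[symmetric] y_monomial_def[symmetric] c_monomial_def[symmetric]
    by blast
  also have "\<dots> = hc_basis T n u v ` hc_index T n"
  proof (intro equalityI subsetI)
    fix a assume "a \<in> hc_basis T n u v ` hc_index T n"
    then obtain \<alpha> \<epsilon> w \<gamma> where k: "(\<alpha>, \<epsilon>, w, \<gamma>) \<in> hc_index T n" "a = hc_basis T n u v (\<alpha>, \<epsilon>, w, \<gamma>)" by auto
    moreover have "w \<in> carrier (weyl_group T n)" using k(1) by (simp add: hc_index_def)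
    ultimately show "a \<in> {x_monomial T n u v \<alpha> \<otimes>\<^bsub>H\<^esub> (c_monomial T n u v \<epsilon> \<otimes>\<^bsub>H\<^esub> (hc_w T n u v w \<otimes>\<^bsub>H\<^esub>
      (y_monomial T n u v \<gamma> \<otimes>\<^bsub>H\<^esub> \<one>\<^bsub>H\<^esub>))) | \<alpha> \<epsilon> w \<gamma>. (\<alpha>, \<epsilon>, w, \<gamma>) \<in> hc_index T n}"
      using eq by blast
  next
    fix a assume "a \<in> {x_monomial T n u v \<alpha> \<otimes>\<^bsub>H\<^esub> (c_monomial T n u v \<epsilon> \<otimes>\<^bsub>H\<^esub> (hc_w T n u v w \<otimes>\<^bsub>H\<^esub>
      (y_monomial T n u v \<gamma> \<otimes>\<^bsub>H\<^esub> \<one>\<^bsub>H\<^esub>))) | \<alpha> \<epsilon> w \<gamma>. (\<alpha>, \<epsilon>, w, \<gamma>) \<in> hc_index T n}"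
    then obtain \<alpha> \<epsilon> w \<gamma> where k: "(\<alpha>, \<epsilon>, w, \<gamma>) \<in> hc_index T n"
      "a = x_monomial T n u v \<alpha> \<otimes>\<^bsub>H\<^esub> (c_monomial T n u v \<epsilon> \<otimes>\<^bsub>H\<^esub> (hc_w T n u v w \<otimes>\<^bsub>H\<^esub>
      (y_monomial T n u v \<gamma> \<otimes>\<^bsub>H\<^esub> \<one>\<^bsub>H\<^esub>)))" by blast
    moreover have "w \<in> carrier (weyl_group T n)" using k(1) by (simp add: hc_index_def)
    ultimately have "a = hc_basis T n u v (\<alpha>, \<epsilon>, w, \<gamma>)" using eq by simp
    then show "a \<in> hc_basis T n u v ` hc_index T n" using k(1) by blast
  qed
  finally show ?thesis .
qed

lemma spanning_hc_basis: "spanning H (hc_basis T n u v ` hc_index T n)"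
  unfolding spanning_def
proof (intro conjI allI impI; (elim conjE)?)
  show "hc_basis T n u v ` hc_index T n \<subseteq> carrier H" using hc_basis_closed by auto
  fix N assume "complex_subspace H N" "hc_basis T n u v ` hc_index T n \<subseteq> N"
  then have "H.LX \<subseteq> N"
    unfolding X_basis_eq by (intro linear_span_least[OF H.complex_space_axioms'])
  then show "carrier H \<subseteq> N" using carrier_subset_LX by blast
qed

lemma representation:
  "\<exists>\<psi>. algebra_hom H op_algebra \<psi> \<and> (\<forall>i\<in>{1..n}. \<psi> (hc_x T n u v i) = opX i \<and> \<psi> (hc_y T n u v i) = opY i \<and>
     \<psi> (hc_c T n u v i) = opC i) \<and> (\<forall>w\<in>carrier (weyl_group T n). \<psi> (hc_w T n u v w) = gW w)"
proof -
  define f where "f s = (case s of GenX i \<Rightarrow> opX i | GenY i \<Rightarrow> opY i | GenC i \<Rightarrow> opC i | GenW w \<Rightarrow> gW w)" for s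
  obtain \<Psi> where \<Psi>: "algebra_hom Free op_algebra \<Psi>" "\<And>s. \<Psi> (letter s) = f s"
    using free_algebra_lift[OF complex_algebra_op_algebra, of f Gen] by auto
  have val: "(\<lambda>i. \<Psi> (letter (GenX i))) = opX" "(\<lambda>i. \<Psi> (letter (GenY i))) = opY"
      "(\<lambda>i. \<Psi> (letter (GenC i))) = opC" "(\<lambda>w. \<Psi> (letter (GenW w))) = gW"
    by (simp_all add: \<Psi>(2) f_def)
  have rel: "\<Psi> l = \<Psi> r" if lr: "(l, r) \<in> Rel" for l r
  proof (rule representation_relations)
    have "(\<Psi> l, \<Psi> r) \<in> map_prod \<Psi> \<Psi> ` Rel" using lr by force
    then show "(\<Psi> l, \<Psi> r) \<in> hecke_clifford_relations op_algebra T n u v opX opY opC gW"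
      using hecke_clifford_relations_hom(1)[OF hc_family_free complex_algebra_op_algebra \<Psi>(1), of u v]
      by (simp add: hc_relations_def val)
  qed
  obtain \<psi> where \<psi>: "algebra_hom H op_algebra \<psi>" "\<forall>p\<in>carrier Free. \<psi> (hc_class T n u v p) = \<Psi> p"
    using presented_lift[OF Rel_subset complex_algebra_op_algebra \<Psi>(1) rel, folded hecke_clifford_def]
    unfolding hc_class_def by blast
  have "letter (GenX i) \<in> carrier Free" "letter (GenY i) \<in> carrier Free" "letter (GenC i) \<in> carrier Free"
    if "i \<in> {1..n}" for i
    using that by (auto intro!: letter_closed simp: hc_generators_def)
  moreover have "letter (GenW w) \<in> carrier Free" if "w \<in> carrier (weyl_group T n)" for w
    using that by (auto intro!: letter_closed simp: hc_generators_def)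
  ultimately show ?thesis using \<psi>
    by (intro exI[of _ \<psi>]) (simp add: hc_x_def hc_y_def hc_c_def hc_w_def \<Psi>(2) f_def)
qed

end

section \<open>Linear independence of the monomials\<close>

lemma app_sum: "app (sum f S) F k = (\<Sum>i\<in>S. app (f i) F k)"
  by (induction S rule: infinite_finite_induct) simp_all

lemma app_scalar_mult: "app (scalar a * D) F k = a * app D F k"
  by (simp only: scalar_commute app_simps)

context hc_representation begin

lemma count_exponent_mset:
  "distinct l \<Longrightarrow> count (exponent_mset \<alpha> l) i = (if i \<in> set l then \<alpha> i else 0)"
  by (induction l) (auto simp: exponent_mset_def)

lemma exponent_mset_inj:
  assumes "\<alpha> \<in> {1..n} \<rightarrow>\<^sub>E R" "\<beta> \<in> {1..n} \<rightarrow>\<^sub>E R'"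
    "exponent_mset \<alpha> [1..<Suc n] = exponent_mset \<beta> [1..<Suc n]"
  shows "\<alpha> = \<beta>"
proof (rule extensionalityI[of _ "{1..n}"])
  fix i assume "i \<in> {1..n}"
  then show "\<alpha> i = \<beta> i"
    using arg_cong[OF assms(3), of "\<lambda>M. count M i"]
    by (simp add: count_exponent_mset del: upt_Suc)
qed (use assms in \<open>auto simp: PiE_def\<close>)

text \<open>The index of the basis vector to which a monomial sends the vacuum, up to a
  scalar.\<close>

definition code :: "(nat \<Rightarrow> nat) \<times> (nat \<Rightarrow> nat) \<times> (int \<Rightarrow> int) \<times> (nat \<Rightarrow> nat) \<Rightarrow> nat multiset \<times> basis_tail" where
  "code = (\<lambda>(\<alpha>, \<epsilon>, w, \<gamma>). (exponent_mset \<alpha> [1..<Suc n], as_sp w,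
     position (as_sp w) ` {i \<in> set [1..<Suc n]. \<epsilon> i = 1}, exponent_mset \<gamma> [1..<Suc n]))"

lemma code_inj: "inj_on code (hc_index T n)"
proof (rule inj_onI)
  fix k k' assume k: "k \<in> hc_index T n" "k' \<in> hc_index T n" "code k = code k'"
  obtain \<alpha> \<epsilon> w \<gamma> where 1: "k = (\<alpha>, \<epsilon>, w, \<gamma>)" by (cases k)
  obtain \<alpha>' \<epsilon>' w' \<gamma>' where 2: "k' = (\<alpha>', \<epsilon>', w', \<gamma>')" by (cases k')
  have in1: "\<alpha> \<in> {1..n} \<rightarrow>\<^sub>E UNIV" "\<epsilon> \<in> {1..n} \<rightarrow>\<^sub>E {0, 1}" "w \<in> carrier (weyl_group T n)" "\<gamma> \<in> {1..n} \<rightarrow>\<^sub>E UNIV"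
    using k(1) by (simp_all add: 1 hc_index_def)
  have in2: "\<alpha>' \<in> {1..n} \<rightarrow>\<^sub>E UNIV" "\<epsilon>' \<in> {1..n} \<rightarrow>\<^sub>E {0, 1}" "w' \<in> carrier (weyl_group T n)" "\<gamma>' \<in> {1..n} \<rightarrow>\<^sub>E UNIV"
    using k(2) by (simp_all add: 2 hc_index_def)
  note eq0 = k(3)[unfolded 1 2 code_def prod.case prod.inject]
  note eq = conjunct1[OF eq0] conjunct1[OF conjunct2[OF eq0]]
    conjunct1[OF conjunct2[OF conjunct2[OF eq0]]] conjunct2[OF conjunct2[OF conjunct2[OF eq0]]]
  have w: "w = w'"
    by (rule trans[OF sp_as_sp[OF weyl_group_signed[OF in1(3)], symmetric, unfolded eq(2)]
        sp_as_sp[OF weyl_group_signed[OF in2(3)]]])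
  \<comment> \<open>Only now that w = w' are the two Clifford sets images under the same injective
    map.\<close>
  have E: "{i \<in> set [1..<Suc n]. \<epsilon> i = 1} = {i \<in> set [1..<Suc n]. \<epsilon>' i = 1}"
  proof -
    have "inj (position (as_sp w'))" by (rule injI) (drule position_inj[THEN iffD1])
    then show ?thesis by (rule inj_image_eq_iff[THEN iffD1, OF _ eq(3)[unfolded w]])
  qed
  have "\<epsilon> = \<epsilon>'"
  proof (rule extensionalityI[of _ "{1..n}"])
    fix i assume i: "i \<in> {1..n}"
    then have "i \<in> set [1..<Suc n]" by auto
    then have "\<epsilon> i = 1 \<longleftrightarrow> \<epsilon>' i = 1" using E by blast
    moreover have "\<epsilon> i \<in> {0, 1}" "\<epsilon>' i \<in> {0, 1}" using PiE_mem[OF in1(2) i] PiE_mem[OF in2(2) i] by auto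
    ultimately show "\<epsilon> i = \<epsilon>' i" by auto
  qed (use in1(2) in2(2) in \<open>auto simp: PiE_def\<close>)
  then show "k = k'"
    using w exponent_mset_inj[OF in1(1) in2(1) eq(1)] exponent_mset_inj[OF in1(4) in2(4) eq(4)]
    by (simp add: 1 2)
qed

lemma ordered_monomial_op: "ordered_monomial op_algebra n z \<alpha> = op_monomial z \<alpha> [1..<Suc n]"
  unfolding ordered_monomial_def op_monomial_def op_algebra_simps by (rule foldr_cong) simp_all

lemma hc_basis_action:
  assumes \<psi>: "algebra_hom H op_algebra \<psi>"
    and val: "\<And>i. i \<in> {1..n} \<Longrightarrow> \<psi> (hc_x T n u v i) = opX i" "\<And>i. i \<in> {1..n} \<Longrightarrow> \<psi> (hc_y T n u v i) = opY i"
      "\<And>i. i \<in> {1..n} \<Longrightarrow> \<psi> (hc_c T n u v i) = opC i"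
      "\<And>w. w \<in> carrier (weyl_group T n) \<Longrightarrow> \<psi> (hc_w T n u v w) = gW w"
    and k: "k \<in> hc_index T n"
  shows "\<exists>s\<noteq>0. \<forall>F. app (\<psi> (hc_basis T n u v k)) F ({#}, sp_id, {}, {#}) = s * F (code k)"
proof -
  obtain \<alpha> \<epsilon> w \<gamma> where k': "k = (\<alpha>, \<epsilon>, w, \<gamma>)" by (cases k)
  have w: "w \<in> carrier (weyl_group T n)" and \<epsilon>: "\<epsilon> \<in> {1..n} \<rightarrow>\<^sub>E {0, 1}" using k by (simp_all add: k' hc_index_def)
  let ?L = "[1..<Suc n]"
  note hom = ordered_monomial_hom[OF presented(1) complex_algebra_op_algebra \<psi>]
  have x: "\<psi> (x_monomial T n u v \<alpha>) = op_monomial opX \<alpha> ?L"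
  proof -
    have "\<psi> (x_monomial T n u v \<alpha>) = ordered_monomial op_algebra n (\<lambda>i. \<psi> (hc_x T n u v i)) \<alpha>"
      unfolding x_monomial_def by (rule hom) (rule H.x_closed)
    also have "\<dots> = ordered_monomial op_algebra n opX \<alpha>"
      by (rule ordered_monomial_cong) (rule val(1))
    finally show ?thesis unfolding ordered_monomial_op .
  qed
  have y: "\<psi> (y_monomial T n u v \<gamma>) = op_monomial opY \<gamma> ?L"
  proof -
    have "\<psi> (y_monomial T n u v \<gamma>) = ordered_monomial op_algebra n (\<lambda>i. \<psi> (hc_y T n u v i)) \<gamma>"
      unfolding y_monomial_def by (rule hom) (rule H.y_closed)
    also have "\<dots> = ordered_monomial op_algebra n opY \<gamma>"
      by (rule ordered_monomial_cong) (rule val(2))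
    finally show ?thesis unfolding ordered_monomial_op .
  qed
  have c: "\<psi> (c_monomial T n u v \<epsilon>) = op_monomial opC \<epsilon> ?L"
  proof -
    have "\<psi> (c_monomial T n u v \<epsilon>) = ordered_monomial op_algebra n (\<lambda>i. \<psi> (hc_c T n u v i)) \<epsilon>"
      unfolding c_monomial_def by (rule hom) (rule H.c_closed)
    also have "\<dots> = ordered_monomial op_algebra n opC \<epsilon>"
      by (rule ordered_monomial_cong) (rule val(3))
    finally show ?thesis unfolding ordered_monomial_op .
  qed
  have prod: "\<psi> (hc_basis T n u v k) = op_monomial opX \<alpha> ?L * op_monomial opC \<epsilon> ?L * gW w * op_monomial opY \<gamma> ?L"
    using monomial_closed H.g_closed[OF w]
    by (simp add: k' hc_basis_def Let_def algebra_homD(3)[OF \<psi>] x y c val(4)[OF w] del: upt_Suc)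
  have "\<exists>s\<noteq>0. \<forall>F. app (op_monomial opC \<epsilon> ?L) F ({#}, as_sp w, {}, exponent_mset \<gamma> ?L) =
      s * F ({#}, as_sp w, position (as_sp w) ` {i \<in> set ?L. \<epsilon> i = 1}, exponent_mset \<gamma> ?L)"
  proof (rule app_monomial_opC)
    fix i assume "i \<in> set ?L"
    then have i: "i \<in> {1..n}" by auto
    then show "i > 0 \<and> \<epsilon> i \<in> {0, 1}" using PiE_mem[OF \<epsilon> i] by auto
  qed simp
  then obtain s where s: "s \<noteq> 0" "\<And>F. app (op_monomial opC \<epsilon> ?L) F ({#}, as_sp w, {}, exponent_mset \<gamma> ?L) =
      s * F ({#}, as_sp w, position (as_sp w) ` {i \<in> set ?L. \<epsilon> i = 1}, exponent_mset \<gamma> ?L)" by blast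
  have Y: "app (op_monomial opY \<gamma> ?L) G ({#}, sp_id, {}, {#}) = G ({#}, sp_id, {}, exponent_mset \<gamma> ?L)" for G
    by (subst app_monomial_opY) auto
  have "app (\<psi> (hc_basis T n u v k)) F ({#}, sp_id, {}, {#}) = s * F (code k)" for F
    unfolding prod app_simps(6) Y
    by (simp only: opW_base sp_comp_id s(2) app_monomial_opX add_0 k' code_def prod.case)
  then show ?thesis using s(1) by blast
qed

lemma linear_basis_hc: "linear_basis H (hc_index T n) (hc_basis T n u v)"
  unfolding linear_basis_def
proof (intro conjI allI impI ballI; (elim conjE)?)
  show b: "hc_basis T n u v \<in> hc_index T n \<rightarrow> carrier H" using hc_basis_closed by blast
  show "\<exists>p. Poly_Mapping.keys p \<subseteq> hc_index T n \<and> a = linear_combination H (hc_basis T n u v) p"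
    if "a \<in> carrier H" for a
    by (rule spanning_imp_linear_combination[OF H.complex_space_axioms' b spanning_hc_basis that])
  fix p assume p: "Poly_Mapping.keys p \<subseteq> hc_index T n" "linear_combination H (hc_basis T n u v) p = \<zero>\<^bsub>H\<^esub>"
  obtain \<psi> where \<psi>: "algebra_hom H op_algebra \<psi>" and val: "\<And>i. i \<in> {1..n} \<Longrightarrow> \<psi> (hc_x T n u v i) = opX i"
      "\<And>i. i \<in> {1..n} \<Longrightarrow> \<psi> (hc_y T n u v i) = opY i" "\<And>i. i \<in> {1..n} \<Longrightarrow> \<psi> (hc_c T n u v i) = opC i"
      "\<And>w. w \<in> carrier (weyl_group T n) \<Longrightarrow> \<psi> (hc_w T n u v w) = gW w"
    using representation by blast
  interpret E: complex_algebra "op_algebra :: (complex, hc_op) module" by (rule complex_algebra_op_algebra)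
  note lin = algebra_homD(1)[OF \<psi>] and S = H.complex_space_axioms' E.complex_space_axioms'
  note action = hc_basis_action[OF \<psi> val]
  show "p = 0"
  proof (rule ccontr)
    assume "p \<noteq> 0"
    then obtain k\<^sub>0 where k0: "k\<^sub>0 \<in> Poly_Mapping.keys p" by (metis all_not_in_conv keys_eq_empty)
    \<comment> \<open>The coordinate functional of the basis vector that belongs to k_0. Applied to
      the image of the vacuum under the relation, it leaves a nonzero multiple of the coefficient at
      k_0, as distinct indices have distinct codes.\<close>
    let ?F = "\<lambda>c. if c = code k\<^sub>0 then 1 else (0 :: complex)"
    let ?vac = "({#}, sp_id, {}, {#}) :: nat multiset \<times> basis_tail"
    have A: "\<psi> (linear_combination H (hc_basis T n u v) p) =
        (\<Sum>k\<in>Poly_Mapping.keys p. scalar (Poly_Mapping.lookup p k) * \<psi> (hc_basis T n u v k))"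
    proof -
      have P: "(\<lambda>k. Poly_Mapping.lookup p k \<odot>\<^bsub>H\<^esub> hc_basis T n u v k) \<in> Poly_Mapping.keys p \<rightarrow> carrier H"
        using p(1) hc_basis_closed by blast
      have "\<psi> (linear_combination H (hc_basis T n u v) p) =
          (\<Oplus>\<^bsub>op_algebra\<^esub>k\<in>Poly_Mapping.keys p. \<psi> (Poly_Mapping.lookup p k \<odot>\<^bsub>H\<^esub> hc_basis T n u v k))"
        unfolding linear_combination_def by (rule linear_map_finsum[OF S lin finite_keys P])
      also have "\<dots> = (\<Sum>k\<in>Poly_Mapping.keys p. \<psi> (Poly_Mapping.lookup p k \<odot>\<^bsub>H\<^esub> hc_basis T n u v k))"
        by (rule op_algebra_finsum) simp
      also have "\<dots> = (\<Sum>k\<in>Poly_Mapping.keys p. scalar (Poly_Mapping.lookup p k) * \<psi> (hc_basis T n u v k))"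
        by (rule sum.cong) (use p(1) hc_basis_closed linear_mapD(3)[OF lin] in auto)
      finally show ?thesis .
    qed
    have B: "\<psi> (linear_combination H (hc_basis T n u v) p) = 0"
      using linear_map_zero[OF S lin] p(2) by simp
    have "(\<Sum>k\<in>Poly_Mapping.keys p. Poly_Mapping.lookup p k * app (\<psi> (hc_basis T n u v k)) ?F ?vac) = 0"
      using arg_cong[OF trans[OF A[symmetric] B], of "\<lambda>D. app D ?F ?vac"]
      by (simp only: app_sum app_scalar_mult app_simps(1))
    moreover have "Poly_Mapping.lookup p k * app (\<psi> (hc_basis T n u v k)) ?F ?vac = 0"
      if k: "k \<in> Poly_Mapping.keys p - {k\<^sub>0}" for k
    proof -
      have "code k \<noteq> code k\<^sub>0" using inj_onD[OF code_inj, of k k\<^sub>0] k k0 p(1) by blast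
      moreover obtain s where "\<And>F. app (\<psi> (hc_basis T n u v k)) F ?vac = s * F (code k)"
        using action[of k] k p(1) by blast
      ultimately show ?thesis by simp
    qed
    ultimately have "Poly_Mapping.lookup p k\<^sub>0 * app (\<psi> (hc_basis T n u v k\<^sub>0)) ?F ?vac = 0"
      using sum.remove[OF finite_keys k0, of "\<lambda>k. Poly_Mapping.lookup p k * app (\<psi> (hc_basis T n u v k)) ?F ?vac"]
      by (simp add: sum.neutral)
    moreover obtain s where "s \<noteq> 0" "\<And>F. app (\<psi> (hc_basis T n u v k\<^sub>0)) F ?vac = s * F (code k\<^sub>0)"
      using action[of k\<^sub>0] k0 p(1) by blast
    ultimately show False using k0 by (simp add: in_keys_iff)
  qed
qed


subsection \<open>The tensor product decomposition\<close>

abbreviation "P \<equiv> polynomial_algebra n"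
abbreviation "C \<equiv> clifford_algebra n"
abbreviation "G \<equiv> monoid_algebra (weyl_group T n)"
abbreviation "C_gen \<equiv> GenC ` {1..n}"
abbreviation "C_rel \<equiv> clifford_relations (free_algebra C_gen) n (\<lambda>i. letter (GenC i))"
abbreviation "C_class \<equiv> (+>\<^bsub>free_algebra C_gen\<^esub>) (relation_ideal C_gen C_rel)"
abbreviation "C_monomial \<equiv> ordered_monomial C n (\<lambda>i. C_class (letter (GenC i)))"

lemma exponents: "carrier (product_group {1..n} (\<lambda>_. \<lparr>carrier = UNIV, monoid.mult = (+), one = 0 :: nat\<rparr>)) = {1..n} \<rightarrow>\<^sub>E UNIV"
  by simp

lemma P_space: "complex_space P" and G_space: "complex_space G"
  and P_spanning: "spanning P ((\<lambda>\<alpha>. Poly_Mapping.single \<alpha> 1) ` ({1..n} \<rightarrow>\<^sub>E UNIV))"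
  using complex_space_monoid_algebra spanning_monoid_algebra[of "product_group {1..n} (\<lambda>_. \<lparr>carrier = UNIV, monoid.mult = (+), one = 0 :: nat\<rparr>)"]
  unfolding polynomial_algebra_def exponents by blast+

lemma embeddings_linear:
  "linear_map P H (x_embedding T n u v)" "linear_map P H (y_embedding T n u v)" "linear_map G H (w_embedding T n u v)"
  unfolding x_embedding_def y_embedding_def w_embedding_def polynomial_algebra_def linear_map_monoid_algebra
  by (intro linear_map_linear_combination H.complex_space_axioms' funcsetI monomial_closed H.g_closed; assumption)+

lemma C_rel_subset: "C_rel \<subseteq> carrier (free_algebra C_gen) \<times> carrier (free_algebra C_gen)"
proof -
  interpret F: complex_algebra "free_algebra C_gen" by (rule complex_algebra_free_algebra)
  have lc: "letter (GenC i) \<in> carrier (free_algebra C_gen)" if "i \<in> {1..n}" for i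
    using that by (intro letter_closed imageI)
  show ?thesis
    unfolding clifford_relations_def
    by (intro Un_least subsetI; elim CollectE exE conjE; hypsubst;
        intro SigmaI F.m_closed F.one_closed F.a_inv_closed lc; assumption)
qed

lemmas C_presented = complex_algebra_presented[OF C_rel_subset, folded clifford_algebra_def]
  algebra_hom_class[OF C_rel_subset, folded clifford_algebra_def]

text \<open>The operations of a free algebra do not depend on the set of letters, so the free
  algebra on the c_i is a subset of the large one with literally the same operations.\<close>

lemma hc_class_C_hom: "algebra_hom (free_algebra C_gen) H (hc_class T n u v)"
proof -
  have sub: "p \<in> carrier Free" if "p \<in> carrier (free_algebra C_gen)" for p
  proof -
    have "lists C_gen \<subseteq> lists Gen" by (rule lists_mono) (auto simp: hc_generators_def)
    then show ?thesis using that by (auto simp: free_algebra_def monoid_algebra_simps free_space_simps)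
  qed
  have ops: "p \<otimes>\<^bsub>free_algebra C_gen\<^esub> q = p \<otimes>\<^bsub>Free\<^esub> q" "p \<oplus>\<^bsub>free_algebra C_gen\<^esub> q = p \<oplus>\<^bsub>Free\<^esub> q"
    "a \<odot>\<^bsub>free_algebra C_gen\<^esub> p = a \<odot>\<^bsub>Free\<^esub> p" "\<one>\<^bsub>free_algebra C_gen\<^esub> = \<one>\<^bsub>Free\<^esub>" for p q a
    by (simp_all add: free_algebra_def monoid_algebra_def free_space_def)
  note h = algebra_homD[OF class_hom] linear_mapD[OF algebra_homD(1)[OF class_hom]]
  show ?thesis unfolding algebra_hom_def linear_map_def ops by (auto simp: h sub)
qed

text \<open>\<open>c_embedding\<close> is a union over the elements of a coset. The lift \<chi>
  exists because the Clifford relations hold in H, and it shows that the sets united coincide, so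
  the union is the single class \<chi> B.\<close>

lemma C_embedding:
  "\<exists>\<chi>. algebra_hom C H \<chi> \<and> (\<forall>B\<in>carrier C. c_embedding T n u v B = \<chi> B) \<and>
     (\<forall>i\<in>{1..n}. \<chi> (C_class (letter (GenC i))) = hc_c T n u v i)"
proof -
  interpret F: complex_algebra "free_algebra C_gen" by (rule complex_algebra_free_algebra)
  note h = algebra_homD[OF hc_class_C_hom] linear_mapD[OF algebra_homD(1)[OF hc_class_C_hom]]
  have lc: "letter (GenC i) \<in> carrier (free_algebra C_gen)" if "i \<in> {1..n}" for i
    using that by (intro letter_closed imageI)
  have neg: "hc_class T n u v (\<ominus>\<^bsub>free_algebra C_gen\<^esub> p) = \<ominus>\<^bsub>H\<^esub> hc_class T n u v p"
    if "p \<in> carrier (free_algebra C_gen)" for p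
    by (rule linear_map_minus[OF F.complex_space_axioms' H.complex_space_axioms' h(1) that])
  have rel: "hc_class T n u v l = hc_class T n u v r" if lr: "(l, r) \<in> C_rel" for l r
  proof -
    consider i where "i \<in> {1..n}" "l = letter (GenC i) \<otimes>\<^bsub>free_algebra C_gen\<^esub> letter (GenC i)"
        "r = \<one>\<^bsub>free_algebra C_gen\<^esub>"
      | i j where "i \<in> {1..n}" "j \<in> {1..n}" "i \<noteq> j"
        "l = letter (GenC i) \<otimes>\<^bsub>free_algebra C_gen\<^esub> letter (GenC j)"
        "r = \<ominus>\<^bsub>free_algebra C_gen\<^esub> (letter (GenC j) \<otimes>\<^bsub>free_algebra C_gen\<^esub> letter (GenC i))"
      using lr unfolding clifford_relations_def by blast
    then show ?thesis
    proof cases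
      case 1
      show ?thesis
        unfolding 1(2,3) h(3)[OF lc[OF 1(1)] lc[OF 1(1)]] h(2) hc_c_def[symmetric]
        by (rule H.clifford_relation(1)[OF 1(1)])
    next
      case 2
      show ?thesis
        unfolding 2(4,5) neg[OF F.m_closed[OF lc[OF 2(2)] lc[OF 2(1)]]] h(3)[OF lc[OF 2(1)] lc[OF 2(2)]]
          h(3)[OF lc[OF 2(2)] lc[OF 2(1)]] hc_c_def[symmetric]
        by (rule H.clifford_relation(2)[OF 2(1-3)])
    qed
  qed
  obtain \<chi> where \<chi>: "algebra_hom C H \<chi>" "\<forall>p\<in>carrier (free_algebra C_gen). \<chi> (C_class p) = hc_class T n u v p"
    using presented_lift[OF C_rel_subset presented(1) hc_class_C_hom rel, folded clifford_algebra_def] by blast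
  have "c_embedding T n u v B = \<chi> B" if B: "B \<in> carrier C" for B
  proof -
    obtain p where p: "p \<in> carrier (free_algebra C_gen)" "B = C_class p"
      using presented_cases[OF C_rel_subset, folded clifford_algebra_def, OF B] by blast
    note I = complex_subspace_ideal[OF complex_algebra_free_algebra ideal_relation_ideal[OF C_rel_subset]]
    interpret I: abelian_subgroup "relation_ideal C_gen C_rel" "free_algebra C_gen"
      by (rule complex_subspace_additive_subgroup[OF F.complex_space_axioms' I])
    have 1: "hc_class T n u v q = \<chi> B" if q: "q \<in> B" for q
    proof -
      have q': "q \<in> C_class p" using q unfolding p(2) .
      have "q \<in> carrier (free_algebra C_gen)" by (rule I.a_elemrcos_carrier[OF p(1) q'])
      then have "\<chi> (C_class q) = hc_class T n u v q" using \<chi>(2) by blast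
      then show ?thesis unfolding p(2) I.a_repr_independence'[OF q' p(1)] by (rule sym)
    qed
    have "p \<in> B" unfolding p(2) by (rule I.a_rcos_self[OF p(1)])
    then show ?thesis unfolding c_embedding_def using 1 by auto
  qed
  moreover have "\<chi> (C_class (letter (GenC i))) = hc_c T n u v i" if "i \<in> {1..n}" for i
    using \<chi>(2) lc[OF that] by (simp add: hc_c_def)
  ultimately show ?thesis using \<chi>(1) by blast
qed

text \<open>The reordering lemmas used for H apply again, with only the unit to the right of the
  monomials. Independence of these monomials is obtained through \<open>linear_isoI\<close> from the
  basis of H.\<close>

lemma C_spanning: "spanning C (C_monomial ` ({1..n} \<rightarrow>\<^sub>E {0, 1}))"
proof -
  interpret F: complex_algebra "free_algebra C_gen" by (rule complex_algebra_free_algebra)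
  interpret C: complex_algebra C by (rule C_presented(1))
  note h = algebra_homD[OF C_presented(2)] linear_mapD[OF algebra_homD(1)[OF C_presented(2)]]
  let ?c = "\<lambda>i. C_class (letter (GenC i))"
  have lc: "letter (GenC i) \<in> carrier (free_algebra C_gen)" if "i \<in> {1..n}" for i
    using that by (intro letter_closed imageI)
  have cc: "?c i \<in> carrier C" if "i \<in> {1..n}" for i using lc[OF that] by (rule h(4))
  have sq: "?c i \<otimes>\<^bsub>C\<^esub> ?c i = \<one>\<^bsub>C\<^esub>" if i: "i \<in> {1..n}" for i
  proof -
    have "(letter (GenC i) \<otimes>\<^bsub>free_algebra C_gen\<^esub> letter (GenC i), \<one>\<^bsub>free_algebra C_gen\<^esub>) \<in> C_rel"
      using i unfolding clifford_relations_def by blast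
    from class_of_relation[OF C_rel_subset this] show ?thesis
      by (simp only: h(2) h(3)[OF lc[OF i] lc[OF i]])
  qed
  have anti: "?c i \<otimes>\<^bsub>C\<^esub> ?c j = (- 1) \<odot>\<^bsub>C\<^esub> (?c j \<otimes>\<^bsub>C\<^esub> ?c i)" if ij: "i \<in> {1..n}" "j \<in> {1..n}" "j \<noteq> i" for i j
  proof -
    have "(letter (GenC i) \<otimes>\<^bsub>free_algebra C_gen\<^esub> letter (GenC j),
        \<ominus>\<^bsub>free_algebra C_gen\<^esub> (letter (GenC j) \<otimes>\<^bsub>free_algebra C_gen\<^esub> letter (GenC i))) \<in> C_rel"
      using ij unfolding clifford_relations_def by blast
    from class_of_relation[OF C_rel_subset this]
    have "?c i \<otimes>\<^bsub>C\<^esub> ?c j = \<ominus>\<^bsub>C\<^esub> (?c j \<otimes>\<^bsub>C\<^esub> ?c i)"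
      using linear_map_minus[OF F.complex_space_axioms' C.complex_space_axioms' h(1) F.m_closed[OF lc[OF ij(2)] lc[OF ij(1)]]]
      by (simp only: h(3)[OF lc[OF ij(1)] lc[OF ij(2)]] h(3)[OF lc[OF ij(2)] lc[OF ij(1)]])
    then show ?thesis using cc ij by (simp add: C.smult_minus_one)
  qed
  let ?S = "C.monomials n ?c {0, 1} {\<one>\<^bsub>C\<^esub>}"
  have mc: "C_monomial \<epsilon> \<in> carrier C" for \<epsilon>
    unfolding C.ordered_monomial_eq by (rule C.partial_monomial_closed) (use cc in auto)
  have S: "?S = C_monomial ` ({1..n} \<rightarrow>\<^sub>E {0, 1})"
  proof (intro equalityI subsetI)
    fix a assume "a \<in> ?S"
    then obtain \<epsilon> m where \<epsilon>: "\<epsilon> \<in> {1..n} \<rightarrow>\<^sub>E {0, 1}" and "a = C_monomial \<epsilon> \<otimes>\<^bsub>C\<^esub> m" "m \<in> {\<one>\<^bsub>C\<^esub>}"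
      unfolding C.monomials_def by blast
    then have "a = C_monomial \<epsilon>" by (simp only: singleton_iff C.r_one[OF mc])
    then show "a \<in> C_monomial ` ({1..n} \<rightarrow>\<^sub>E {0, 1})" using \<epsilon> by (rule image_eqI)
  next
    fix a assume "a \<in> C_monomial ` ({1..n} \<rightarrow>\<^sub>E {0, 1})"
    then obtain \<epsilon> where \<epsilon>: "\<epsilon> \<in> {1..n} \<rightarrow>\<^sub>E {0, 1}" "a = C_monomial \<epsilon>" by (rule imageE)
    have "a = C_monomial \<epsilon> \<otimes>\<^bsub>C\<^esub> \<one>\<^bsub>C\<^esub>" unfolding \<epsilon>(2) by (rule C.r_one[OF mc, symmetric])
    then show "a \<in> ?S" unfolding C.monomials_def using \<epsilon>(1) by blast
  qed
  have Sc: "?S \<subseteq> carrier C" by (rule C.monomials_subset) (use cc in auto)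
  have "carrier C \<subseteq> linear_span C ?S"
  proof (rule presented_generated[OF C_rel_subset, folded clifford_algebra_def])
    show "complex_subspace C (linear_span C ?S)" by (rule complex_subspace_linear_span[OF C.complex_space_axioms' Sc])
    show "\<one>\<^bsub>C\<^esub> \<in> linear_span C ?S"
      using C.subset_monomials[of "{\<one>\<^bsub>C\<^esub>}" "{0, 1}" n ?c] linear_span_superset[of ?S C] by auto
    fix s a assume "s \<in> C_gen" and a: "a \<in> linear_span C ?S"
    then obtain i where i: "i \<in> {1..n}" "s = GenC i" by auto
    have "?c i \<otimes>\<^bsub>C\<^esub> a \<in> linear_span C ?S"
    proof (rule C.mult_monomials[where s = "- 1", OF cc _ i(1) anti[OF i(1)] _ a])
      fix k :: nat assume "k \<in> {0, 1}"
      then consider "k = 0" | "k = 1" by blast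
      then show "\<exists>k'\<in>{0, 1}. ?c i \<otimes>\<^bsub>C\<^esub> ?c i [^]\<^bsub>C\<^esub> k = ?c i [^]\<^bsub>C\<^esub> (k' :: nat)"
      proof cases
        case 1
        have "?c i \<otimes>\<^bsub>C\<^esub> ?c i [^]\<^bsub>C\<^esub> k = ?c i [^]\<^bsub>C\<^esub> (1 :: nat)"
          unfolding 1 C.nat_pow_0 C.nat_pow_eone[OF cc[OF i(1)]] by (rule C.r_one[OF cc[OF i(1)]])
        then show ?thesis by (rule bexI) (rule insertI2, rule singletonI)
      next
        case 2
        have "?c i \<otimes>\<^bsub>C\<^esub> ?c i [^]\<^bsub>C\<^esub> k = ?c i [^]\<^bsub>C\<^esub> (0 :: nat)"
          unfolding 2 C.nat_pow_0 C.nat_pow_eone[OF cc[OF i(1)]] by (rule sq[OF i(1)])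
        then show ?thesis by (rule bexI) (rule insertI1)
      qed
    qed auto
    then show "C_class (letter s) \<otimes>\<^bsub>C\<^esub> a \<in> linear_span C ?S" using i(2) by simp
  qed
  then show ?thesis
    unfolding S[symmetric] spanning_def
    using Sc linear_span_least[OF C.complex_space_axioms'] by blast
qed

lemma product_lift:
  assumes V: "complex_space V" and W: "complex_space W" and f: "linear_map V H f" and g: "linear_map W H g"
  shows "\<exists>\<phi>. linear_map (tensor_product V W) H \<phi> \<and>
    (\<forall>a\<in>carrier V. \<forall>b\<in>carrier W. \<phi> (pure_tensor V W a b) = f a \<otimes>\<^bsub>H\<^esub> g b)"
  by (rule tensor_lift[OF V W H.complex_space_axioms'])
    (rule linear_map_comp[OF f H.linear_map_mult_right], erule linear_mapD(1)[OF g],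
     rule linear_map_comp[OF g H.linear_map_mult_left], erule linear_mapD(1)[OF f])

abbreviation "PC \<equiv> tensor_product P C"
abbreviation "PCG \<equiv> tensor_product PC G"
abbreviation "PCGP \<equiv> tensor_product PCG P"

definition tensor_basis where
  "tensor_basis = (\<lambda>(\<alpha>, \<epsilon>, w, \<gamma>). pure_tensor PCG P (pure_tensor PC G
     (pure_tensor P C (Poly_Mapping.single \<alpha> 1) (C_monomial \<epsilon>)) (Poly_Mapping.single w 1)) (Poly_Mapping.single \<gamma> 1))"

lemma tensor_spaces: "complex_space C" "complex_space PC" "complex_space PCG" "complex_space PCGP"
proof -
  interpret C: complex_algebra C by (rule C_presented(1))
  show 1: "complex_space C" by (rule C.complex_space_axioms')
  show 2: "complex_space PC" by (rule complex_space_tensor[OF P_space 1])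
  show 3: "complex_space PCG" by (rule complex_space_tensor[OF 2 G_space])
  show "complex_space PCGP" by (rule complex_space_tensor[OF 3 P_space])
qed

lemma single_closed:
  "\<alpha> \<in> {1..n} \<rightarrow>\<^sub>E UNIV \<Longrightarrow> Poly_Mapping.single \<alpha> 1 \<in> carrier P"
  "\<epsilon> \<in> {1..n} \<rightarrow>\<^sub>E {0, 1} \<Longrightarrow> C_monomial \<epsilon> \<in> carrier C"
  "w \<in> carrier (weyl_group T n) \<Longrightarrow> Poly_Mapping.single w 1 \<in> carrier G"
  by (rule subsetD[OF P_spanning[unfolded spanning_def, THEN conjunct1]], erule imageI)
    (rule subsetD[OF C_spanning[unfolded spanning_def, THEN conjunct1]], erule imageI,
     rule subsetD[OF spanning_monoid_algebra[unfolded spanning_def, THEN conjunct1]], erule imageI)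

lemma spanning_tensor_basis:
  "tensor_basis \<in> hc_index T n \<rightarrow> carrier PCGP" "spanning PCGP (tensor_basis ` hc_index T n)"
proof -
  note sp = tensor_spaces
  show cl: "tensor_basis \<in> hc_index T n \<rightarrow> carrier PCGP"
    unfolding tensor_basis_def hc_index_def
    by (intro funcsetI; elim SigmaE; hypsubst; unfold prod.case;
        intro pure_tensor_closed P_space G_space sp single_closed; assumption)
  note full = spanning_tensor[OF sp(3) P_space spanning_tensor[OF sp(2) G_space
    spanning_tensor[OF P_space sp(1) P_spanning C_spanning] spanning_monoid_algebra] P_spanning]
  show "spanning PCGP (tensor_basis ` hc_index T n)"
    unfolding spanning_def
  proof (intro conjI allI impI; (elim conjE)?)
    show "tensor_basis ` hc_index T n \<subseteq> carrier PCGP" using cl by auto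
    fix N assume N: "complex_subspace PCGP N" "tensor_basis ` hc_index T n \<subseteq> N"
    have mem: "pure_tensor PCG P (pure_tensor PC G (pure_tensor P C (Poly_Mapping.single \<alpha> 1) (C_monomial \<epsilon>))
        (Poly_Mapping.single w 1)) (Poly_Mapping.single \<gamma> 1) \<in> N"
      if "\<alpha> \<in> {1..n} \<rightarrow>\<^sub>E UNIV" "\<epsilon> \<in> {1..n} \<rightarrow>\<^sub>E {0, 1}" "w \<in> carrier (weyl_group T n)" "\<gamma> \<in> {1..n} \<rightarrow>\<^sub>E UNIV" for \<alpha> \<epsilon> w \<gamma>
    proof -
      have "(\<alpha>, \<epsilon>, w, \<gamma>) \<in> hc_index T n" using that by (simp add: hc_index_def)
      then have "tensor_basis (\<alpha>, \<epsilon>, w, \<gamma>) \<in> N" using N(2) by blast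
      then show ?thesis by (simp add: tensor_basis_def)
    qed
    show "carrier PCGP \<subseteq> N"
      by (rule full[unfolded spanning_def, THEN conjunct2, rule_format, OF conjI[OF N(1)]])
        (use mem in auto)
  qed
qed

lemma tensor_decomposition:
  "\<exists>\<phi>\<in>linear_iso PCGP H. \<forall>f\<in>carrier P. \<forall>a\<in>carrier C. \<forall>w\<in>carrier G. \<forall>h\<in>carrier P.
     \<phi> (pure_tensor PCG P (pure_tensor PC G (pure_tensor P C f a) w) h) =
     x_embedding T n u v f \<otimes>\<^bsub>H\<^esub> c_embedding T n u v a \<otimes>\<^bsub>H\<^esub> w_embedding T n u v w \<otimes>\<^bsub>H\<^esub> y_embedding T n u v h"
proof -
  note sp = tensor_spaces and HS = H.complex_space_axioms'
  obtain \<chi> where \<chi>: "algebra_hom C H \<chi>" "\<And>B. B \<in> carrier C \<Longrightarrow> c_embedding T n u v B = \<chi> B"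
    "\<And>i. i \<in> {1..n} \<Longrightarrow> \<chi> (C_class (letter (GenC i))) = hc_c T n u v i"
    using C_embedding by blast
  \<comment> \<open>The multiplication map is built one tensor factor at a time, following the
    bracketing to the left; each stage multiplies the previous map by the embedding of the next
    factor.\<close>
  obtain \<phi>\<^sub>1 where \<phi>1: "linear_map PC H \<phi>\<^sub>1"
    "\<And>f a. f \<in> carrier P \<Longrightarrow> a \<in> carrier C \<Longrightarrow> \<phi>\<^sub>1 (pure_tensor P C f a) = x_embedding T n u v f \<otimes>\<^bsub>H\<^esub> \<chi> a"
    using product_lift[OF P_space sp(1) embeddings_linear(1) algebra_homD(1)[OF \<chi>(1)]] by blast
  obtain \<phi>\<^sub>2 where \<phi>2: "linear_map PCG H \<phi>\<^sub>2"
    "\<And>t w. t \<in> carrier PC \<Longrightarrow> w \<in> carrier G \<Longrightarrow> \<phi>\<^sub>2 (pure_tensor PC G t w) = \<phi>\<^sub>1 t \<otimes>\<^bsub>H\<^esub> w_embedding T n u v w"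
    using product_lift[OF sp(2) G_space \<phi>1(1) embeddings_linear(3)] by blast
  obtain \<phi> where \<phi>: "linear_map PCGP H \<phi>"
    "\<And>t h. t \<in> carrier PCG \<Longrightarrow> h \<in> carrier P \<Longrightarrow> \<phi> (pure_tensor PCG P t h) = \<phi>\<^sub>2 t \<otimes>\<^bsub>H\<^esub> y_embedding T n u v h"
    using product_lift[OF sp(3) P_space \<phi>2(1) embeddings_linear(2)] by blast
  have pure: "\<phi> (pure_tensor PCG P (pure_tensor PC G (pure_tensor P C f a) w) h) =
     x_embedding T n u v f \<otimes>\<^bsub>H\<^esub> \<chi> a \<otimes>\<^bsub>H\<^esub> w_embedding T n u v w \<otimes>\<^bsub>H\<^esub> y_embedding T n u v h"
    if "f \<in> carrier P" "a \<in> carrier C" "w \<in> carrier G" "h \<in> carrier P" for f a w h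
    using that \<phi>1(2) \<phi>2(2) \<phi>(2) pure_tensor_closed[OF P_space sp(1)] pure_tensor_closed[OF sp(2) G_space] by simp
  have emb: "x_embedding T n u v (Poly_Mapping.single \<alpha> 1) = x_monomial T n u v \<alpha>"
    "y_embedding T n u v (Poly_Mapping.single \<alpha> 1) = y_monomial T n u v \<alpha>" for \<alpha>
    unfolding x_embedding_def y_embedding_def
    using linear_combination_single[OF HS, of "x_monomial T n u v" \<alpha> 1]
      linear_combination_single[OF HS, of "y_monomial T n u v" \<alpha> 1] monomial_closed by simp_all
  have embw: "w_embedding T n u v (Poly_Mapping.single w 1) = hc_w T n u v w" if "w \<in> carrier (weyl_group T n)" for w
    unfolding w_embedding_def
    using linear_combination_single[OF HS, of "hc_w T n u v" w 1] H.g_closed[OF that] by simp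
  have embc: "\<chi> (C_monomial \<epsilon>) = c_monomial T n u v \<epsilon>" for \<epsilon>
  proof -
    have cc: "C_class (letter (GenC i)) \<in> carrier C" if "i \<in> {1..n}" for i
      by (rule linear_mapD(1)[OF algebra_homD(1)[OF C_presented(2)]]) (use that in \<open>auto intro: letter_closed\<close>)
    have "\<chi> (C_monomial \<epsilon>) = ordered_monomial H n (\<lambda>i. \<chi> (C_class (letter (GenC i)))) \<epsilon>"
      by (rule ordered_monomial_hom[OF C_presented(1) presented(1) \<chi>(1) cc])
    also have "\<dots> = c_monomial T n u v \<epsilon>"
      unfolding c_monomial_def by (rule ordered_monomial_cong) (rule \<chi>(3))
    finally show ?thesis .
  qed
  have "\<phi> \<in> linear_iso PCGP H"
  proof (rule linear_isoI[OF sp(4) HS \<phi>(1) spanning_tensor_basis linear_basis_hc])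
    fix k assume k: "k \<in> hc_index T n"
    obtain \<alpha> \<epsilon> w \<gamma> where k': "k = (\<alpha>, \<epsilon>, w, \<gamma>)" by (cases k)
    have in1: "\<alpha> \<in> {1..n} \<rightarrow>\<^sub>E UNIV" "\<epsilon> \<in> {1..n} \<rightarrow>\<^sub>E {0, 1}" "w \<in> carrier (weyl_group T n)" "\<gamma> \<in> {1..n} \<rightarrow>\<^sub>E UNIV"
      using k by (simp_all add: k' hc_index_def)
    show "\<phi> (tensor_basis k) = hc_basis T n u v k"
      unfolding k' tensor_basis_def hc_basis_def Let_def prod.case
        pure[OF single_closed(1)[OF in1(1)] single_closed(2)[OF in1(2)] single_closed(3)[OF in1(3)] single_closed(1)[OF in1(4)]]
      by (simp only: emb embw[OF in1(3)] embc)
  qed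
  moreover have "\<forall>f\<in>carrier P. \<forall>a\<in>carrier C. \<forall>w\<in>carrier G. \<forall>h\<in>carrier P.
     \<phi> (pure_tensor PCG P (pure_tensor PC G (pure_tensor P C f a) w) h) =
     x_embedding T n u v f \<otimes>\<^bsub>H\<^esub> c_embedding T n u v a \<otimes>\<^bsub>H\<^esub> w_embedding T n u v w \<otimes>\<^bsub>H\<^esub> y_embedding T n u v h"
    using pure \<chi>(2) by simp
  ultimately show ?thesis by blast
qed

end

theorem theorem3p5:
  fixes T :: weyl_type and n :: nat and u v :: complex
  assumes "valid_rank T n"
  shows
    "(let H = hecke_clifford T n u v;
          P = polynomial_algebra n;
          C = clifford_algebra n;
          G = monoid_algebra (weyl_group T n);
          PC = tensor_product P C;
          PCG = tensor_product PC G;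
          PCGP = tensor_product PCG P
      in
       (\<exists>\<phi>\<in>linear_iso PCGP H.
          \<forall>f\<in>carrier P. \<forall>a\<in>carrier C. \<forall>w\<in>carrier G. \<forall>h\<in>carrier P.
            \<phi> (pure_tensor PCG P (pure_tensor PC G (pure_tensor P C f a) w) h) =
            x_embedding T n u v f \<otimes>\<^bsub>H\<^esub> c_embedding T n u v a \<otimes>\<^bsub>H\<^esub>
            w_embedding T n u v w \<otimes>\<^bsub>H\<^esub> y_embedding T n u v h) \<and>
       linear_basis H
         (({1..n} \<rightarrow>\<^sub>E UNIV) \<times> ({1..n} \<rightarrow>\<^sub>E {0, 1}) \<times> carrier (weyl_group T n) \<times> ({1..n} \<rightarrow>\<^sub>E UNIV))
         (\<lambda>(\<alpha>, \<epsilon>, w, \<gamma>).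
            x_monomial T n u v \<alpha> \<otimes>\<^bsub>H\<^esub> c_monomial T n u v \<epsilon> \<otimes>\<^bsub>H\<^esub>
            hc_w T n u v w \<otimes>\<^bsub>H\<^esub> y_monomial T n u v \<gamma>))"
  unfolding Let_def
proof (rule conjI)
  interpret hc_representation T n u v .
  show "\<exists>\<phi>\<in>linear_iso PCGP H. \<forall>f\<in>carrier P. \<forall>a\<in>carrier C. \<forall>w\<in>carrier G. \<forall>h\<in>carrier P.
     \<phi> (pure_tensor PCG P (pure_tensor PC G (pure_tensor P C f a) w) h) =
     x_embedding T n u v f \<otimes>\<^bsub>H\<^esub> c_embedding T n u v a \<otimes>\<^bsub>H\<^esub> w_embedding T n u v w \<otimes>\<^bsub>H\<^esub> y_embedding T n u v h"
    by (rule tensor_decomposition)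
  show "linear_basis H
         (({1..n} \<rightarrow>\<^sub>E UNIV) \<times> ({1..n} \<rightarrow>\<^sub>E {0, 1}) \<times> carrier (weyl_group T n) \<times> ({1..n} \<rightarrow>\<^sub>E UNIV))
         (\<lambda>(\<alpha>, \<epsilon>, w, \<gamma>).
            x_monomial T n u v \<alpha> \<otimes>\<^bsub>H\<^esub> c_monomial T n u v \<epsilon> \<otimes>\<^bsub>H\<^esub>
            hc_w T n u v w \<otimes>\<^bsub>H\<^esub> y_monomial T n u v \<gamma>)"
    using linear_basis_hc unfolding hc_index_def hc_basis_def Let_def .
qed

end
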